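(* Let $(M,g)$ be a compact Riemannian manifold with boundary, and suppose it is non-trapping. Then the interior lens data $(S^{in},\ell^{in})$ can be recovered from the complete lens data $(S,\ell)$.
   Context: $\partial TM$ is $TM$ restricted to $\partial M$, $\nu$ is the unit outward pointing normal vector field on $\partial M$, $\partial_-TM=\{(x,v)\in\partial TM: g(v,\nu)<0\}$ is the set of inward pointing vectors, $\partial_+TM=\{(x,v)\in\partial TM: g(v,\nu)>0\}$ the set of outward pointing vectors, and $\overline{\partial_\pm TM}=\partial_\pm TM\cup T\partial M$. A geodesic is non-trapping if it exits the manifold in finite time; $(M,g)$ is non-trapping if all its geodesics are. Interior lens data: for $(x,v)\in\partial_-TM$ with corresponding geodesic $\gamma$ (so $\gamma(0)=x$, $\dot\gamma(0)=v$), the interior travel time is $\tau^{in}(x,v)=\sup\{t>0:\gamma((0,t))\subset M^\circ\}$, where $M^\circ$ is the interior of $M$. When it is finite, the interior scattering relation is $S^{in}(x,v)=(\gamma(\tau^{in}(x,v)),\dot\gamma(\tau^{in}(x,v)))$ and the interior length function is $\ell^{in}(x,v)=\tau^{in}(x,v)\,|g(v,v)|^{1/2}$. The pair $(S^{in},\ell^{in})$ is the interior lens data. Complete lens data: let $(\tilde M,\tilde g)$ be any extension of $(M,g)$. For $(x,v)\in\overline{\partial_-TM}$ with corresponding geodesic $\gamma$, the complete travel time is $\tau(x,v)=\sup\{t>0:\gamma([0,t])\subset M\}$ (with value $0$ if this set is empty). When it is finite, the complete scattering relation is $S(x,v)=(\gamma(\tau(x,v)),\dot\gamma(\tau(x,v)))$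 and the complete length function is $\ell(x,v)=\tau(x,v)\,|g(v,v)|^{1/2}$. The pair $(S,\ell)$ is the complete lens data. "Can be recovered from" means that $S^{in}$ and $\ell^{in}$ are determined by knowledge of $S$ and $\ell$. *)

theory Defs
  imports "HOL-Analysis.Analysis"
begin

section \<open>Smooth maps on subsets of Euclidean space\<close>

text \<open>Meaningful for open \<open>U\<close> only.\<close>

primrec Ck_on :: "nat \<Rightarrow> 'e::euclidean_space set \<Rightarrow> ('e \<Rightarrow> 'f::real_normed_vector) \<Rightarrow> bool" where
  "Ck_on 0 U f \<longleftrightarrow> continuous_on U f"
| "Ck_on (Suc k) U f \<longleftrightarrow> f differentiable_on U \<and>
     (\<forall>b\<in>Basis. Ck_on k U (\<lambda>y. frechet_derivative f (at y) b))"

text \<open>On an arbitrary subset, smooth means locally extendable to a \<open>C\<^sup>\<infinity>\<close> map on an open set.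
  This is what is needed for charts with values in a half-space.\<close>

definition smooth_on :: "'e::euclidean_space set \<Rightarrow> ('e \<Rightarrow> 'f::real_normed_vector) \<Rightarrow> bool" where
  "smooth_on S f \<longleftrightarrow> (\<forall>y\<in>S. \<exists>U F. open U \<and> y \<in> U \<and> (\<forall>k. Ck_on k U F) \<and> (\<forall>z\<in>S \<inter> U. F z = f z))"


section \<open>Smooth manifolds with boundary\<close>

text \<open>The model space \<open>\<real>\<^sup>n\<close> is a Euclidean space \<open>'e\<close>. Its half-space consists of the vectors
  with nonnegative coordinate along a fixed basis vector.\<close>

definition e_normal :: "'e::euclidean_space" where
  "e_normal = (SOME b. b \<in> Basis)"

definition halfspace :: "'e::euclidean_space set" where
  "halfspace = {y. 0 \<le> y \<bullet> e_normal}"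

text \<open>A chart is a pair of its domain and its coordinate map; the values of the coordinate map
  outside of the domain are irrelevant.\<close>

type_synonym ('a, 'e) chart = "'a set \<times> ('a \<Rightarrow> 'e)"

record ('a, 'e) manifold =
  mtop :: "'a topology"
  atlas :: "('a, 'e) chart set"

abbreviation points :: "('a, 'e) manifold \<Rightarrow> 'a set" where
  "points M \<equiv> topspace (mtop M)"

definition chart_inv :: "('a, 'e) chart \<Rightarrow> 'e \<Rightarrow> 'a" where
  "chart_inv c = inv_into (fst c) (snd c)"

definition is_chart :: "'a topology \<Rightarrow> ('a, 'e::euclidean_space) chart \<Rightarrow> bool" where
  "is_chart X c \<longleftrightarrow> openin X (fst c) \<and> openin (top_of_set halfspace) (snd c ` fst c) \<and>
     homeomorphic_map (subtopology X (fst c)) (top_of_set (snd c ` fst c)) (snd c)"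

definition overlap :: "('a, 'e) chart \<Rightarrow> ('a, 'e) chart \<Rightarrow> 'e set" where
  "overlap c c' = snd c ` (fst c \<inter> fst c')"

definition transition :: "('a, 'e) chart \<Rightarrow> ('a, 'e) chart \<Rightarrow> 'e \<Rightarrow> 'e" where
  "transition c c' = snd c' \<circ> chart_inv c"

definition smooth_manifold :: "('a, 'e::euclidean_space) manifold \<Rightarrow> bool" where
  "smooth_manifold M \<longleftrightarrow>
     Hausdorff_space (mtop M) \<and> second_countable (mtop M) \<and>
     (\<forall>c\<in>atlas M. is_chart (mtop M) c) \<and>
     points M = (\<Union>c\<in>atlas M. fst c) \<and>
     (\<forall>c\<in>atlas M. \<forall>c'\<in>atlas M. smooth_on (overlap c c') (transition c c'))"

definition mboundary :: "('a, 'e::euclidean_space) manifold \<Rightarrow> 'a set" where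
  "mboundary M = {x. \<exists>c\<in>atlas M. x \<in> fst c \<and> snd c x \<bullet> e_normal = 0}"

definition minterior :: "('a, 'e::euclidean_space) manifold \<Rightarrow> 'a set" where
  "minterior M = points M - mboundary M"


section \<open>Tangent vectors\<close>

text \<open>Every point has a preferred chart, and a tangent vector \<open>v\<close> at \<open>x\<close> is represented by its
  coordinate vector in the preferred chart at \<open>x\<close>. So \<open>T\<^sub>xM\<close> is a copy of \<open>'e\<close> for each \<open>x\<close>, and
  an element of \<open>TM\<close> is a pair \<open>(x, v)\<close>.\<close>

type_synonym ('a, 'e) tvec = "'a \<times> 'e"

definition chart_at :: "('a, 'e) manifold \<Rightarrow> 'a \<Rightarrow> ('a, 'e) chart" where
  "chart_at M x = (SOME c. c \<in> atlas M \<and> x \<in> fst c)"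

definition tangent_bundle :: "('a, 'e) manifold \<Rightarrow> ('a, 'e) tvec set" where
  "tangent_bundle M = points M \<times> UNIV"

text \<open>The linear map converting coordinates in \<open>c\<close> of tangent vectors at \<open>x\<close> into coordinates
  in \<open>c'\<close>. The derivative is one-sided at boundary points.\<close>

definition coord_change ::
    "('a, 'e::euclidean_space) chart \<Rightarrow> ('a, 'e) chart \<Rightarrow> 'a \<Rightarrow> 'e \<Rightarrow> 'e" where
  "coord_change c c' x =
     frechet_derivative (transition c c') (at (snd c x) within overlap c c')"

definition velocity ::
    "('a, 'e::euclidean_space) manifold \<Rightarrow> real set \<Rightarrow> (real \<Rightarrow> 'a) \<Rightarrow> real \<Rightarrow> 'e" where
  "velocity M J \<gamma> t = vector_derivative (snd (chart_at M (\<gamma> t)) \<circ> \<gamma>) (at t within J)"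


section \<open>Riemannian metrics and geodesics\<close>

type_synonym ('a, 'e) metric = "'a \<Rightarrow> 'e \<Rightarrow> 'e \<Rightarrow> real"

definition metric_in_chart ::
    "('a, 'e::euclidean_space) manifold \<Rightarrow> ('a, 'e) metric \<Rightarrow> ('a, 'e) chart \<Rightarrow> 'e \<Rightarrow> 'e \<Rightarrow> 'e \<Rightarrow> real"
  where
  "metric_in_chart M g c y a b =
     (let x = chart_inv c y; A = coord_change c (chart_at M x) x in g x (A a) (A b))"

definition riemannian_manifold ::
    "('a, 'e::euclidean_space) manifold \<Rightarrow> ('a, 'e) metric \<Rightarrow> bool" where
  "riemannian_manifold M g \<longleftrightarrow> smooth_manifold M \<and>
     (\<forall>x\<in>points M. bilinear (g x) \<and> (\<forall>v w. g x v w = g x w v) \<and> (\<forall>v. v \<noteq> 0 \<longrightarrow> 0 < g x v v)) \<and>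
     (\<forall>c\<in>atlas M. \<forall>a b. smooth_on (snd c ` fst c) (\<lambda>y. metric_in_chart M g c y a b))"

text \<open>Christoffel symbols of the first kind,
  \<open>\<Gamma>(a,b;w) = (\<partial>\<^sub>a g(b,w) + \<partial>\<^sub>b g(a,w) - \<partial>\<^sub>w g(a,b)) / 2\<close>, at the point with coordinates \<open>y\<close>.\<close>

definition christoffel ::
    "('a, 'e::euclidean_space) manifold \<Rightarrow> ('a, 'e) metric \<Rightarrow> ('a, 'e) chart \<Rightarrow>
     'e \<Rightarrow> 'e \<Rightarrow> 'e \<Rightarrow> 'e \<Rightarrow> real" where
  "christoffel M g c y a b w =
     (let D = (\<lambda>d p q. frechet_derivative (\<lambda>z. metric_in_chart M g c z p q)
                         (at y within snd c ` fst c) d)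
      in (D a b w + D b a w - D w a b) / 2)"

text \<open>The geodesic equation \<open>u'' + \<Gamma>(u', u') = 0\<close> with the index lowered, required in every chart
  of the atlas. Derivatives are one-sided at endpoints of \<open>J\<close> contained in \<open>J\<close>.\<close>

definition geodesic_on ::
    "('a, 'e::euclidean_space) manifold \<Rightarrow> ('a, 'e) metric \<Rightarrow> real set \<Rightarrow> (real \<Rightarrow> 'a) \<Rightarrow> bool" where
  "geodesic_on M g J \<gamma> \<longleftrightarrow> is_interval J \<and> interior J \<noteq> {} \<and>
     continuous_map (top_of_set J) (mtop M) \<gamma> \<and>
     (\<forall>c\<in>atlas M. \<exists>u' u''. \<forall>t\<in>J. \<gamma> t \<in> fst c \<longrightarrow>
        ((snd c \<circ> \<gamma>) has_vector_derivative u' t) (at t within J) \<and>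
        (u' has_vector_derivative u'' t) (at t within J) \<and>
        (\<forall>w. metric_in_chart M g c (snd c (\<gamma> t)) (u'' t) w
              + christoffel M g c (snd c (\<gamma> t)) (u' t) (u' t) w = 0))"

definition geodesic_from ::
    "('a, 'e::euclidean_space) manifold \<Rightarrow> ('a, 'e) metric \<Rightarrow> ('a, 'e) tvec \<Rightarrow>
     real set \<Rightarrow> (real \<Rightarrow> 'a) \<Rightarrow> bool" where
  "geodesic_from M g \<xi> J \<gamma> \<longleftrightarrow>
     geodesic_on M g J \<gamma> \<and> 0 \<in> J \<and> \<gamma> 0 = fst \<xi> \<and> velocity M J \<gamma> 0 = snd \<xi>"

text \<open>The maximal geodesic with initial data \<open>\<xi>\<close>: its domain, and the pair \<open>(\<gamma>(t), \<gamma>'(t))\<close> at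
  each time \<open>t\<close> of its domain.\<close>

definition geodesic_domain ::
    "('a, 'e::euclidean_space) manifold \<Rightarrow> ('a, 'e) metric \<Rightarrow> ('a, 'e) tvec \<Rightarrow> real set" where
  "geodesic_domain M g \<xi> = {t. \<exists>J \<gamma>. geodesic_from M g \<xi> J \<gamma> \<and> t \<in> J}"

definition geodesic_flow ::
    "('a, 'e::euclidean_space) manifold \<Rightarrow> ('a, 'e) metric \<Rightarrow> ('a, 'e) tvec \<Rightarrow> real \<Rightarrow> ('a, 'e) tvec"
  where
  "geodesic_flow M g \<xi> t =
     (THE \<eta>. \<exists>J \<gamma>. geodesic_from M g \<xi> J \<gamma> \<and> t \<in> J \<and> \<eta> = (\<gamma> t, velocity M J \<gamma> t))"

text \<open>Constant geodesics never exit and are disregarded. Bounding the domain of the maximal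
  geodesic above suffices, as reversing the time replaces \<open>v\<close> by \<open>- v\<close>.\<close>

definition non_trapping ::
    "('a, 'e::euclidean_space) manifold \<Rightarrow> ('a, 'e) metric \<Rightarrow> bool" where
  "non_trapping M g \<longleftrightarrow>
     (\<forall>\<xi>\<in>tangent_bundle M. snd \<xi> \<noteq> 0 \<longrightarrow> bdd_above (geodesic_domain M g \<xi>))"


section \<open>Tangent vectors at the boundary\<close>

definition bd_TM :: "('a, 'e::euclidean_space) manifold \<Rightarrow> ('a, 'e) tvec set" where
  "bd_TM M = mboundary M \<times> UNIV"

definition T_bd :: "('a, 'e::euclidean_space) manifold \<Rightarrow> ('a, 'e) tvec set" where
  "T_bd M = {(x, v). x \<in> mboundary M \<and> v \<bullet> e_normal = 0}"

definition outward_normal ::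
    "('a, 'e::euclidean_space) manifold \<Rightarrow> ('a, 'e) metric \<Rightarrow> 'a \<Rightarrow> 'e" where
  "outward_normal M g x =
     (THE n. g x n n = 1 \<and> (\<forall>w. (x, w) \<in> T_bd M \<longrightarrow> g x n w = 0) \<and> n \<bullet> e_normal < 0)"

definition bd_inward :: "('a, 'e::euclidean_space) manifold \<Rightarrow> ('a, 'e) metric \<Rightarrow> ('a, 'e) tvec set"
  where
  "bd_inward M g = {(x, v) \<in> bd_TM M. g x v (outward_normal M g x) < 0}"

definition bd_inward_closure ::
    "('a, 'e::euclidean_space) manifold \<Rightarrow> ('a, 'e) metric \<Rightarrow> ('a, 'e) tvec set" where
  "bd_inward_closure M g = bd_inward M g \<union> T_bd M"


section \<open>Interior lens data\<close>

text \<open>Travel times are suprema in \<open>ennreal\<close>, so the supremum of the empty set is \<open>0\<close>. The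
  scattering relations and length functions take the value \<open>None\<close> where the travel time is
  infinite.\<close>

definition tau_in ::
    "('a, 'e::euclidean_space) manifold \<Rightarrow> ('a, 'e) metric \<Rightarrow> ('a, 'e) tvec \<Rightarrow> ennreal" where
  "tau_in M g \<xi> = Sup (ennreal ` {t. 0 < t \<and>
     (\<forall>s\<in>{0<..<t}. s \<in> geodesic_domain M g \<xi> \<and> fst (geodesic_flow M g \<xi> s) \<in> minterior M)})"

definition S_in ::
    "('a, 'e::euclidean_space) manifold \<Rightarrow> ('a, 'e) metric \<Rightarrow> ('a, 'e) tvec \<Rightarrow> ('a, 'e) tvec option"
  where
  "S_in M g \<xi> = (if tau_in M g \<xi> < \<infinity>
     then Some (geodesic_flow M g \<xi> (enn2real (tau_in M g \<xi>))) else None)"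

definition ell_in ::
    "('a, 'e::euclidean_space) manifold \<Rightarrow> ('a, 'e) metric \<Rightarrow> ('a, 'e) tvec \<Rightarrow> real option" where
  "ell_in M g \<xi> = (if tau_in M g \<xi> < \<infinity>
     then Some (enn2real (tau_in M g \<xi>) * sqrt \<bar>g (fst \<xi>) (snd \<xi>) (snd \<xi>)\<bar>) else None)"


section \<open>Extensions and complete lens data\<close>

text \<open>The differential at \<open>x\<close> of the inclusion of \<open>M\<close> into \<open>M'\<close>, as a map from \<open>TM\<close> to \<open>TM'\<close>.\<close>

definition tangent_incl ::
    "('a, 'e::euclidean_space) manifold \<Rightarrow> ('a, 'e) manifold \<Rightarrow> ('a, 'e) tvec \<Rightarrow> ('a, 'e) tvec" where
  "tangent_incl M M' \<xi> =
     (fst \<xi>, coord_change (chart_at M (fst \<xi>)) (chart_at M' (fst \<xi>)) (fst \<xi>) (snd \<xi>))"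

text \<open>\<open>(M', g')\<close> is a Riemannian manifold without boundary and of the same dimension, which
  contains \<open>(M, g)\<close> as a smoothly and isometrically embedded submanifold.\<close>

definition is_extension ::
    "('a, 'e::euclidean_space) manifold \<Rightarrow> ('a, 'e) metric \<Rightarrow>
     ('a, 'e) manifold \<Rightarrow> ('a, 'e) metric \<Rightarrow> bool" where
  "is_extension M g M' g' \<longleftrightarrow> riemannian_manifold M' g' \<and> mboundary M' = {} \<and>
     points M \<subseteq> points M' \<and> mtop M = subtopology (mtop M') (points M) \<and>
     (\<forall>c\<in>atlas M. \<forall>c'\<in>atlas M'.
        smooth_on (overlap c c') (transition c c') \<and> smooth_on (overlap c' c) (transition c' c)) \<and>
     (\<forall>x\<in>points M. \<forall>v w.
        g x v w = g' x (snd (tangent_incl M M' (x, v))) (snd (tangent_incl M M' (x, w))))"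

definition tau ::
    "('a, 'e::euclidean_space) manifold \<Rightarrow> ('a, 'e) manifold \<Rightarrow> ('a, 'e) metric \<Rightarrow>
     ('a, 'e) tvec \<Rightarrow> ennreal" where
  "tau M M' g' \<xi> = (let \<xi>' = tangent_incl M M' \<xi> in Sup (ennreal ` {t. 0 < t \<and>
     (\<forall>s\<in>{0..t}. s \<in> geodesic_domain M' g' \<xi>' \<and> fst (geodesic_flow M' g' \<xi>' s) \<in> points M)}))"

text \<open>The exit vector of the geodesic of \<open>M'\<close>, based at a point of \<open>M\<close>, is regarded as an element
  of \<open>TM\<close>.\<close>

definition S_complete ::
    "('a, 'e::euclidean_space) manifold \<Rightarrow> ('a, 'e) manifold \<Rightarrow> ('a, 'e) metric \<Rightarrow>
     ('a, 'e) tvec \<Rightarrow> ('a, 'e) tvec option" where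
  "S_complete M M' g' \<xi> = (if tau M M' g' \<xi> < \<infinity>
     then Some (inv_into (tangent_bundle M) (tangent_incl M M')
                 (geodesic_flow M' g' (tangent_incl M M' \<xi>) (enn2real (tau M M' g' \<xi>))))
     else None)"

definition ell_complete ::
    "('a, 'e::euclidean_space) manifold \<Rightarrow> ('a, 'e) metric \<Rightarrow> ('a, 'e) manifold \<Rightarrow> ('a, 'e) metric \<Rightarrow>
     ('a, 'e) tvec \<Rightarrow> real option" where
  "ell_complete M g M' g' \<xi> = (if tau M M' g' \<xi> < \<infinity>
     then Some (enn2real (tau M M' g' \<xi>) * sqrt \<bar>g (fst \<xi>) (snd \<xi>) (snd \<xi>)\<bar>) else None)"


section \<open>Equality of lens data\<close>

text \<open>The lens data of two different manifolds can be compared once the sets on which they live are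
  identified.\<close>

definition boundary_identification ::
    "('a, 'e::euclidean_space) manifold \<Rightarrow> ('a, 'e) metric \<Rightarrow>
     ('b, 'f::euclidean_space) manifold \<Rightarrow> ('b, 'f) metric \<Rightarrow>
     (('a, 'e) tvec \<Rightarrow> ('b, 'f) tvec) \<Rightarrow> bool" where
  "boundary_identification M g N h \<Phi> \<longleftrightarrow>
     bij_betw \<Phi> (bd_TM M) (bd_TM N) \<and>
     \<Phi> ` bd_inward M g = bd_inward N h \<and> \<Phi> ` T_bd M = T_bd N"

end

theory Submission
  imports Defs
begin

text \<open>
  Let the geodesic of an inward vector \<open>\<xi>\<close> meet the boundary for the first time at time \<open>s\<close>. Either it
  leaves \<open>M\<close> there, and the interior and the complete data of \<open>\<xi>\<close> agree; or it touches the boundary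
  tangentially in some \<open>\<eta>\<close> and continues in \<open>M\<close>. Then \<open>S(\<eta>) = S(\<xi>)\<close> and \<open>\<ell>(\<eta>) < \<ell>(\<xi>)\<close>, and by uniqueness of
  geodesics backwards in time every boundary vector with these two properties lies on the geodesic
  of \<open>\<xi>\<close>, at time \<open>s\<close> or later. So \<open>S\<^sup>i\<^sup>n(\<xi>)\<close> is the one among them that maximises \<open>\<ell>\<close>, and
  \<open>\<ell>\<^sup>i\<^sup>n(\<xi>) = \<ell>(\<xi>) - \<ell>(\<eta>)\<close>: both are expressed by the complete data.
\<close>

text \<open>Uniqueness cannot be argued inside \<open>M\<close>: at a boundary point only one-sided
  derivatives exist, and a geodesic of \<open>M\<close> may have no continuation there. Existence
  and uniqueness are therefore proved in the extension, whose charts have open images, and carried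
  to \<open>M\<close> by the invariance of the geodesic equation under coordinate changes. The
  extension need not be geodesically complete; that the geodesic of \<xi> still reaches its exit
  point and passes it comes from the compactness of \<open>M\<close> and the constancy of the speed.
  The same constancy makes lengths comparable: vectors with the same exit vector have the same
  speed, so a smaller \<ell> means less time before the exit. Non-trapping enters because a geodesic
  of the extension that stays in \<open>M\<close> is a geodesic of \<open>M\<close>, so the complete
  travel time of a nonzero vector is finite. Contact with the boundary before the exit is tangential
  by the first derivative test, since the normal coordinate has a minimum there; this is why \<eta>
  lies in the domain of the complete data.\<close>

section \<open>Calculus\<close>

definition Cinf_on :: "'e::euclidean_space set \<Rightarrow> ('e \<Rightarrow> 'f::real_normed_vector) \<Rightarrow> bool" where
  "Cinf_on U F \<longleftrightarrow> open U \<and> (\<forall>k. Ck_on k U F)"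

definition d1 :: "('e::euclidean_space \<Rightarrow> 'f::real_normed_vector) \<Rightarrow> 'e \<Rightarrow> 'e \<Rightarrow> 'f" where
  "d1 F y = frechet_derivative F (at y)"

text \<open>The second differential. It gives the inhomogeneous term in the way accelerations
  transform under a change of coordinates.\<close>

definition d2 :: "('e::euclidean_space \<Rightarrow> 'f::real_normed_vector) \<Rightarrow> 'e \<Rightarrow> 'e \<Rightarrow> 'e \<Rightarrow> 'f" where
  "d2 F y a b = d1 (\<lambda>z. d1 F z b) y a"

lemma smooth_onE:
  assumes "smooth_on S f" "y \<in> S"
  obtains U F where "Cinf_on U F" "y \<in> U" "\<And>z. z \<in> S \<Longrightarrow> z \<in> U \<Longrightarrow> F z = f z"
  using assms unfolding smooth_on_def Cinf_on_def by (metis IntI)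

lemma Cinf_on_open: "Cinf_on U F \<Longrightarrow> open U"
  by (simp add: Cinf_on_def)

lemma d1_eqI: "(F has_derivative D) (at y) \<Longrightarrow> d1 F y = D"
  unfolding d1_def using frechet_derivative_at by metis

lemma Cinf_on_d1:
  assumes "Cinf_on U F" "y \<in> U"
  shows "(F has_derivative d1 F y) (at y)"
proof -
  have "Ck_on (Suc 0) U F" "open U" using assms by (auto simp: Cinf_on_def)
  then have "F differentiable (at y)"
    using assms(2) by (auto simp: differentiable_on_eq_differentiable_at)
  then show ?thesis by (simp add: d1_def frechet_derivative_works)
qed

text \<open>\<open>Ck_on\<close> only speaks of directions in \<open>Basis\<close>; other directions
  are reached by linearity, in \<open>Cinf_on_d2\<close>.\<close>

lemma Cinf_on_partial:
  assumes "Cinf_on U F" "b \<in> Basis"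
  shows "Cinf_on U (\<lambda>z. d1 F z b)"
  unfolding Cinf_on_def d1_def
proof (intro conjI allI)
  show "open U" using assms Cinf_on_open by blast
  fix k
  have "Ck_on (Suc k) U F" using assms by (simp add: Cinf_on_def)
  then show "Ck_on k U (\<lambda>z. frechet_derivative F (at z) b)" using assms(2) by simp
qed

lemma Cinf_on_linear_d1:
  assumes "Cinf_on U F" "y \<in> U"
  shows "linear (d1 F y)"
  using has_derivative_bounded_linear[OF Cinf_on_d1[OF assms]] bounded_linear.linear by blast

lemma linear_sum_Basis:
  fixes f :: "'e::euclidean_space \<Rightarrow> 'f::real_vector"
  assumes "linear f"
  shows "f b = (\<Sum>i\<in>Basis. (b \<bullet> i) *\<^sub>R f i)"
proof -
  have "f b = f (\<Sum>i\<in>Basis. (b \<bullet> i) *\<^sub>R i)" by (simp add: euclidean_representation)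
  also have "\<dots> = (\<Sum>i\<in>Basis. (b \<bullet> i) *\<^sub>R f i)"
    by (simp add: linear_sum[OF assms] linear_cmul[OF assms])
  finally show ?thesis .
qed

lemma Cinf_on_d2:
  assumes "Cinf_on U F" "y \<in> U"
  shows "((\<lambda>z. d1 F z b) has_derivative (\<lambda>a. d2 F y a b)) (at y)"
proof -
  have D: "((\<lambda>z. d1 F z i) has_derivative d1 (\<lambda>z. d1 F z i) y) (at y)" if "i \<in> Basis" for i
    using Cinf_on_d1[OF Cinf_on_partial[OF assms(1) that] assms(2)] .
  have "((\<lambda>z. \<Sum>i\<in>Basis. (b \<bullet> i) *\<^sub>R d1 F z i) has_derivative
      (\<lambda>a. \<Sum>i\<in>Basis. (b \<bullet> i) *\<^sub>R d1 (\<lambda>z. d1 F z i) y a)) (at y)"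
    by (intro has_derivative_sum has_derivative_scaleR_right D)
  then have "((\<lambda>z. d1 F z b) has_derivative
      (\<lambda>a. \<Sum>i\<in>Basis. (b \<bullet> i) *\<^sub>R d1 (\<lambda>z. d1 F z i) y a)) (at y)"
    by (rule has_derivative_transform_within_open[OF _ Cinf_on_open[OF assms(1)] assms(2)])
       (use linear_sum_Basis[OF Cinf_on_linear_d1[OF assms(1)], symmetric] in auto)
  then show ?thesis unfolding d2_def using d1_eqI by metis
qed

lemma Cinf_on_linear_d2:
  assumes "Cinf_on U F" "y \<in> U"
  shows "linear (\<lambda>a. d2 F y a b)"
  using has_derivative_bounded_linear[OF Cinf_on_d2[OF assms]] bounded_linear.linear by blast

text \<open>Continuity of the derivative in operator norm is what the local injectivity theorem asks
  for when a chart of \<open>M\<close> is extended across the boundary. The norm is controlled by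
  the finitely many partial derivatives.\<close>

lemma d1_continuous_onorm:
  assumes F: "Cinf_on U F" "a \<in> U" and e: "(e :: real) > 0"
  obtains d where "d > 0" "ball a d \<subseteq> U" "\<And>x. dist a x < d \<Longrightarrow> onorm (\<lambda>v. d1 F x v - d1 F a v) < e"
proof -
  obtain r where r: "r > 0" "ball a r \<subseteq> U" using F Cinf_on_open openE by blast
  have "continuous (at a) (\<lambda>x. d1 F x i)" if "i \<in> Basis" for i
    using Cinf_on_d1[OF Cinf_on_partial[OF F(1) that] F(2)] has_derivative_continuous by blast
  then have "continuous (at a) (\<lambda>x. \<Sum>i\<in>Basis. norm (d1 F x i - d1 F a i))"
    by (intro continuous_intros) auto
  then obtain s where s: "s > 0" "\<And>x. dist x a < s \<Longrightarrow>
      dist (\<Sum>i\<in>Basis. norm (d1 F x i - d1 F a i)) (\<Sum>i\<in>Basis. norm (d1 F a i - d1 F a i)) < e"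
    using e unfolding continuous_at_eps_delta by blast
  show ?thesis
  proof (rule that[of "min r s"])
    show "ball a (min r s) \<subseteq> U" using r by auto
    fix x assume x: "dist a x < min r s"
    then have xU: "x \<in> U" using r by auto
    have "bounded_linear (\<lambda>v. d1 F x v - d1 F a v)"
      using has_derivative_bounded_linear[OF Cinf_on_d1[OF F(1)]] F(2) xU by (intro bounded_linear_sub) auto
    then have "onorm (\<lambda>v. d1 F x v - d1 F a v) \<le> (\<Sum>i\<in>Basis. norm (d1 F x i - d1 F a i))"
      by (rule onorm_componentwise)
    also have "\<dots> < e"
    proof -
      have "dist (\<Sum>i\<in>Basis. norm (d1 F x i - d1 F a i)) (\<Sum>i\<in>Basis. norm (d1 F a i - d1 F a i)) < e"
        by (rule s(2)) (use x in \<open>simp add: dist_commute\<close>)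
      then show ?thesis by (simp add: dist_real_def)
    qed
    finally show "onorm (\<lambda>v. d1 F x v - d1 F a v) < e" .
  qed (use r s in auto)
qed

lemma has_derivative_littleo:
  assumes "(f has_derivative f') (at y)" "e > 0"
  obtains d where "d > 0" "\<And>h. norm h < d \<Longrightarrow> norm (f (y + h) - f y - f' h) \<le> e * norm h"
proof -
  obtain d where d: "d > 0" "\<forall>z. norm (z - y) < d \<longrightarrow> norm (f z - f y - f' (z - y)) \<le> e * norm (z - y)"
    using assms unfolding has_derivative_at_alt by blast
  show ?thesis by (rule that[OF d(1)]) (use d(2) in \<open>metis add_diff_cancel_left'\<close>)
qed

text \<open>The second difference of \<open>F\<close> is symmetric in \<open>a\<close>, \<open>b\<close>; by the mean value theorem it
  approximates \<open>t\<^sup>2\<close> times the second derivative.\<close>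

lemma second_difference:
  fixes f :: "'e::euclidean_space \<Rightarrow> real"
  assumes U: "open U" "y \<in> U"
    and f: "\<And>z. z \<in> U \<Longrightarrow> (f has_derivative f' z) (at z)"
    and f'': "((\<lambda>z. f' z a) has_derivative D) (at y)"
    and "e > 0"
  obtains d where "d > 0" "\<And>t. 0 < t \<Longrightarrow> t < d \<Longrightarrow>
     \<bar>f (y + t *\<^sub>R a + t *\<^sub>R b) - f (y + t *\<^sub>R a) - f (y + t *\<^sub>R b) + f y - t\<^sup>2 * D b\<bar> \<le> e * t\<^sup>2"
proof -
  \<comment> \<open>\<open>t * K\<close> dominates the sum of the lengths of both displacements from
    \<open>y\<close> for every \<open>s\<close> between \<open>0\<close> and \<open>t\<close>; the
    summand \<open>1\<close> keeps \<open>K\<close> positive when \<open>a\<close> and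
    \<open>b\<close> vanish.\<close>
  define K where "K = 2 * norm a + norm b + 1"
  have K: "K > 0" by (auto simp: K_def intro: add_nonneg_pos)
  obtain d0 where d0: "d0 > 0"
    "\<And>h. norm h < d0 \<Longrightarrow> norm (f' (y + h) a - f' y a - D h) \<le> e / K * norm h"
    using has_derivative_littleo[OF f'', of "e / K"] \<open>e > 0\<close> K by auto
  obtain r where r: "r > 0" "ball y r \<subseteq> U" using U openE by blast
  define d where "d = min d0 r / K"
  have "d > 0" using d0 r K by (simp add: d_def)
  interpret D: bounded_linear D using f'' has_derivative_bounded_linear by blast
  have main: "\<bar>f (y + t *\<^sub>R a + t *\<^sub>R b) - f (y + t *\<^sub>R a) - f (y + t *\<^sub>R b) + f y - t\<^sup>2 * D b\<bar> \<le> e * t\<^sup>2"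
    if t: "0 < t" "t < d" for t
  proof -
    have tK: "t * K < min d0 r" using t K by (simp add: d_def field_simps)
    have small: "norm (s *\<^sub>R a + t *\<^sub>R b) < min d0 r" "norm (s *\<^sub>R a) < min d0 r"
      "norm (s *\<^sub>R a + t *\<^sub>R b) + norm (s *\<^sub>R a) \<le> t * K" if s: "0 \<le> s" "s \<le> t" for s
    proof -
      have "norm (s *\<^sub>R a) \<le> t * norm a" using s by (simp add: mult_right_mono)
      moreover have "norm (s *\<^sub>R a + t *\<^sub>R b) \<le> norm (s *\<^sub>R a) + t * norm b"
        using norm_triangle_ineq[of "s *\<^sub>R a" "t *\<^sub>R b"] t by simp
      moreover have "t * K = 2 * (t * norm a) + t * norm b + t"
        by (simp add: K_def algebra_simps)
      moreover have "0 \<le> t * norm a" "0 \<le> t * norm b" using t by simp_all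
      ultimately show "norm (s *\<^sub>R a + t *\<^sub>R b) < min d0 r" "norm (s *\<^sub>R a) < min d0 r"
        "norm (s *\<^sub>R a + t *\<^sub>R b) + norm (s *\<^sub>R a) \<le> t * K" using tK t by linarith+
    qed
    \<comment> \<open>The increment of \<phi> from \<open>0\<close> to \<open>t\<close> is the
      second difference, so the mean value theorem expresses it by a difference of two first
      derivatives.\<close>
    define \<phi> where "\<phi> = (\<lambda>s. f (y + s *\<^sub>R a + t *\<^sub>R b) - f (y + s *\<^sub>R a))"
    define \<phi>' where "\<phi>' = (\<lambda>s. f' (y + s *\<^sub>R a + t *\<^sub>R b) a - f' (y + s *\<^sub>R a) a)"
    have inU: "y + s *\<^sub>R a + t *\<^sub>R b \<in> U" "y + s *\<^sub>R a \<in> U" if "0 \<le> s" "s \<le> t" for s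
    proof -
      have "dist y (y + s *\<^sub>R a + t *\<^sub>R b) = norm (s *\<^sub>R a + t *\<^sub>R b)"
        by (metis add.assoc add_diff_cancel_left' dist_commute dist_norm)
      moreover have "dist y (y + s *\<^sub>R a) = norm (s *\<^sub>R a)"
        by (simp add: dist_norm)
      ultimately show "y + s *\<^sub>R a + t *\<^sub>R b \<in> U" "y + s *\<^sub>R a \<in> U"
        using small[OF that] r by auto
    qed
    have der: "(\<phi> has_derivative (\<lambda>h. h * \<phi>' s)) (at s within {0..t})" if "0 \<le> s" "s \<le> t" for s
    proof -
      have "((\<lambda>s. y + s *\<^sub>R a + t *\<^sub>R b) has_derivative (\<lambda>h. h *\<^sub>R a)) (at s within {0..t})"
        "((\<lambda>s. y + s *\<^sub>R a) has_derivative (\<lambda>h. h *\<^sub>R a)) (at s within {0..t})"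
        by (auto intro!: derivative_eq_intros)
      from has_derivative_compose[OF this(1) f[OF inU(1)[OF that]]]
        has_derivative_compose[OF this(2) f[OF inU(2)[OF that]]]
      have "(\<phi> has_derivative (\<lambda>h. f' (y + s *\<^sub>R a + t *\<^sub>R b) (h *\<^sub>R a) - f' (y + s *\<^sub>R a) (h *\<^sub>R a)))
         (at s within {0..t})" unfolding \<phi>_def by (rule has_derivative_diff)
      moreover have "f' z (h *\<^sub>R a) = h * f' z a" if "z \<in> U" for z h
        using f[OF that] by (simp add: bounded_linear.linear has_derivative_bounded_linear linear_cmul)
      ultimately show ?thesis using inU[OF that] by (simp add: \<phi>'_def algebra_simps)
    qed
    obtain s where s: "s \<in> {0<..<t}" "\<phi> t - \<phi> 0 = (t - 0) * \<phi>' s"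
      using mvt_simple[OF t(1), of \<phi> "\<lambda>s h. h * \<phi>' s"] der by auto
    have s': "0 \<le> s" "s \<le> t" using s by auto
    define h1 h2 where "h1 = s *\<^sub>R a + t *\<^sub>R b" and "h2 = s *\<^sub>R a"
    have b1: "\<bar>f' (y + h1) a - f' y a - D h1\<bar> \<le> e / K * norm h1"
      using d0(2)[of h1] small(1)[OF s'] by (simp add: h1_def)
    have b2: "\<bar>f' (y + h2) a - f' y a - D h2\<bar> \<le> e / K * norm h2"
      using d0(2)[of h2] small(2)[OF s'] by (simp add: h2_def)
    have "\<phi>' s - t * D b = (f' (y + h1) a - f' y a - D h1) - (f' (y + h2) a - f' y a - D h2)"
      by (simp add: \<phi>'_def h1_def h2_def D.add D.scaleR add.assoc)
    then have "\<bar>\<phi>' s - t * D b\<bar> \<le> e / K * norm h1 + e / K * norm h2" using b1 b2 by linarith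
    also have "\<dots> = e / K * (norm h1 + norm h2)" by (simp add: algebra_simps)
    also have "\<dots> \<le> e / K * (t * K)"
      using small(3)[OF s'] \<open>e > 0\<close> K unfolding h1_def h2_def by (intro mult_left_mono) auto
    finally have "\<bar>\<phi>' s - t * D b\<bar> \<le> e * t" using K by simp
    then have "t * \<bar>\<phi>' s - t * D b\<bar> \<le> t * (e * t)" using t by (intro mult_left_mono) auto
    moreover have "\<bar>t * \<phi>' s - t\<^sup>2 * D b\<bar> = t * \<bar>\<phi>' s - t * D b\<bar>"
    proof -
      have "t * \<phi>' s - t\<^sup>2 * D b = t * (\<phi>' s - t * D b)"
        by (simp add: power2_eq_square algebra_simps)
      then show ?thesis using t by (simp add: abs_mult)
    qed
    ultimately have "\<bar>t * \<phi>' s - t\<^sup>2 * D b\<bar> \<le> e * t\<^sup>2"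
      by (simp add: power2_eq_square algebra_simps)
    moreover have "f (y + t *\<^sub>R a + t *\<^sub>R b) - f (y + t *\<^sub>R a) - f (y + t *\<^sub>R b) + f y = t * \<phi>' s"
      using s(2) by (simp add: \<phi>_def)
    ultimately show ?thesis by simp
  qed
  show ?thesis by (rule that[OF \<open>d > 0\<close> main])
qed

lemma second_derivative_symmetric_real:
  fixes f :: "'e::euclidean_space \<Rightarrow> real"
  assumes U: "open U" "y \<in> U"
    and f: "\<And>z. z \<in> U \<Longrightarrow> (f has_derivative f' z) (at z)"
    and f'': "\<And>b. ((\<lambda>z. f' z b) has_derivative (\<lambda>a. D a b)) (at y)"
  shows "D a b = D b a"
proof (rule ccontr)
  assume "D a b \<noteq> D b a"
  \<comment> \<open>Both approximations have error at most \<open>e * t\<^sup>2\<close>, so the gap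
    would be at most \<open>2 * e\<close>, half of what it is.\<close>
  define e where "e = \<bar>D a b - D b a\<bar> / 4"
  have e: "e > 0" using \<open>D a b \<noteq> D b a\<close> by (simp add: e_def)
  obtain d1 where d1: "d1 > 0" "\<And>t. 0 < t \<Longrightarrow> t < d1 \<Longrightarrow>
     \<bar>f (y + t *\<^sub>R a + t *\<^sub>R b) - f (y + t *\<^sub>R a) - f (y + t *\<^sub>R b) + f y - t\<^sup>2 * D b a\<bar> \<le> e * t\<^sup>2"
    using second_difference[OF U f f'' e] by metis
  obtain d2 where d2: "d2 > 0" "\<And>t. 0 < t \<Longrightarrow> t < d2 \<Longrightarrow>
     \<bar>f (y + t *\<^sub>R b + t *\<^sub>R a) - f (y + t *\<^sub>R b) - f (y + t *\<^sub>R a) + f y - t\<^sup>2 * D a b\<bar> \<le> e * t\<^sup>2"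
    using second_difference[OF U f f'' e] by metis
  define t where "t = min d1 d2 / 2"
  have t: "0 < t" "t < d1" "t < d2" using d1(1) d2(1) by (auto simp: t_def)
  have eq: "y + t *\<^sub>R b + t *\<^sub>R a = y + t *\<^sub>R a + t *\<^sub>R b" by (simp add: algebra_simps)
  have "\<bar>f (y + t *\<^sub>R a + t *\<^sub>R b) - f (y + t *\<^sub>R b) - f (y + t *\<^sub>R a) + f y - t\<^sup>2 * D a b\<bar>
      \<le> e * t\<^sup>2" using d2(2)[OF t(1,3)] unfolding eq by simp
  with d1(2)[OF t(1,2)] have "\<bar>t\<^sup>2 * D a b - t\<^sup>2 * D b a\<bar> \<le> 2 * (e * t\<^sup>2)"
    by linarith
  moreover have "t\<^sup>2 * D a b - t\<^sup>2 * D b a = t\<^sup>2 * (D a b - D b a)" by (simp add: algebra_simps)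
  ultimately have "t\<^sup>2 * \<bar>D a b - D b a\<bar> \<le> t\<^sup>2 * (2 * e)"
    by (simp only: abs_mult abs_power2) (simp add: mult_ac)
  then have "\<bar>D a b - D b a\<bar> \<le> 2 * e" using t(1) by simp
  then show False using e by (simp add: e_def)
qed

lemma d2_symmetric:
  fixes F :: "'e::euclidean_space \<Rightarrow> 'f::euclidean_space"
  assumes "Cinf_on U F" "y \<in> U"
  shows "d2 F y a b = d2 F y b a"
proof (rule euclidean_eqI)
  fix k :: 'f assume "k \<in> Basis"
  show "d2 F y a b \<bullet> k = d2 F y b a \<bullet> k"
  proof (rule second_derivative_symmetric_real[OF Cinf_on_open[OF assms(1)] assms(2)])
    show "((\<lambda>z. F z \<bullet> k) has_derivative (\<lambda>h. d1 F z h \<bullet> k)) (at z)" if "z \<in> U" for z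
      using Cinf_on_d1[OF assms(1) that] by (rule has_derivative_inner_left)
    show "((\<lambda>z. d1 F z b \<bullet> k) has_derivative (\<lambda>a. d2 F y a b \<bullet> k)) (at y)" for b
      using Cinf_on_d2[OF assms] by (rule has_derivative_inner_left)
  qed
qed

subsection \<open>Relatively open subsets of the half-space\<close>

abbreviation half_open :: "'e::euclidean_space set \<Rightarrow> bool" where
  "half_open \<equiv> openin (top_of_set halfspace)"

lemma e_normal_Basis: "e_normal \<in> Basis"
  unfolding e_normal_def by (rule someI_ex) (use nonempty_Basis in blast)

lemma half_open_cone:
  assumes "half_open Y" "y \<in> Y" "0 \<le> b \<bullet> e_normal"
  obtains e where "e > 0" "\<And>d. 0 \<le> d \<Longrightarrow> d < e \<Longrightarrow> y + d *\<^sub>R b \<in> Y"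
proof -
  obtain T where T: "open T" "Y = halfspace \<inter> T" using assms(1) by (auto simp: openin_open)
  obtain r where r: "r > 0" "ball y r \<subseteq> T" using T assms(2) openE by blast
  define e where "e = r / (norm b + 1)"
  have p: "norm b + 1 > 0" by (simp add: add_nonneg_pos)
  have "y + d *\<^sub>R b \<in> Y" if "0 \<le> d" "d < e" for d
  proof -
    have "d * norm b \<le> d * (norm b + 1)" using that by (intro mult_left_mono) auto
    also have "\<dots> < r" using that p by (simp add: e_def field_simps)
    finally have "y + d *\<^sub>R b \<in> ball y r" using that by (simp add: dist_norm)
    moreover have "y + d *\<^sub>R b \<in> halfspace"
      using assms that T by (auto simp: halfspace_def inner_add_left)
    ultimately show ?thesis using r T by auto
  qed
  moreover have "e > 0" using r p by (simp add: e_def)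
  ultimately show ?thesis using that by blast
qed

text \<open>Every basis vector has a nonnegative component along \<open>e_normal\<close>. So even at
  a boundary point \<open>Y\<close> contains a short segment in each basis direction, and these
  directions determine a linear map.\<close>

lemma half_open_derivative_unique:
  assumes "half_open Y" "y \<in> Y"
    and "(f has_derivative f') (at y within Y)" "(f has_derivative f'') (at y within Y)"
  shows "f' = f''"
proof (rule frechet_derivative_unique_within[OF assms(3,4)])
  fix i :: 'a and e :: real assume "i \<in> Basis" "e > 0"
  then have "0 \<le> i \<bullet> e_normal"
    using inner_Basis[OF _ e_normal_Basis, of i] by simp
  then obtain r where r: "r > 0" "\<And>d. 0 \<le> d \<Longrightarrow> d < r \<Longrightarrow> y + d *\<^sub>R i \<in> Y"
    using half_open_cone[OF assms(1,2)] by metis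
  define d where "d = min r e / 2"
  have "0 < d" "d < r" "d < e" using r(1) \<open>e > 0\<close> by (auto simp: d_def)
  then show "\<exists>d. 0 < \<bar>d\<bar> \<and> \<bar>d\<bar> < e \<and> y + d *\<^sub>R i \<in> Y" using r(2)[of d] by (intro exI[of _ d]) auto
qed

text \<open>One-sided derivatives can be read off from any local smooth extension, which is how
  two-sided calculus is applied at the boundary.\<close>

lemma has_derivative_extension:
  assumes "Cinf_on U F" "y \<in> U" "y \<in> S" "\<And>z. z \<in> S \<Longrightarrow> z \<in> U \<Longrightarrow> F z = f z"
  shows "(f has_derivative d1 F y) (at y within S)"
proof -
  obtain r where r: "r > 0" "ball y r \<subseteq> U" using assms Cinf_on_open openE by blast
  have "(F has_derivative d1 F y) (at y within S)"
    using Cinf_on_d1[OF assms(1,2)] has_derivative_at_withinI by blast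
  then show ?thesis
  proof (rule has_derivative_transform_within[OF _ r(1) assms(3)])
    fix z assume "z \<in> S" "dist z y < r"
    then show "F z = f z" using assms(4)[of z] r(2) by (simp add: dist_commute subset_iff)
  qed
qed

lemma smooth_on_differentiable:
  assumes "smooth_on S f" "y \<in> S"
  shows "f differentiable (at y within S)"
  using smooth_onE[OF assms] has_derivative_extension[OF _ _ assms(2)] differentiableI by metis

section \<open>The geodesic equation in coordinates\<close>

lemma bilinear_expand:
  fixes B :: "'e::euclidean_space \<Rightarrow> 'e \<Rightarrow> real"
  assumes "bilinear B"
  shows "B a b = (\<Sum>i\<in>Basis. \<Sum>j\<in>Basis. (a \<bullet> i) * (b \<bullet> j) * B i j)"
proof -
  have 1: "linear (\<lambda>x. B x b)" for b using assms by (simp add: bilinear_def)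
  have 2: "linear (B a)" for a using assms by (simp add: bilinear_def)
  have "B a b = (\<Sum>i\<in>Basis. (a \<bullet> i) * B i b)" using linear_sum_Basis[OF 1, of a b] by simp
  also have "\<dots> = (\<Sum>i\<in>Basis. (a \<bullet> i) * (\<Sum>j\<in>Basis. (b \<bullet> j) * B i j))"
    using linear_sum_Basis[OF 2, of _ b] by simp
  finally show ?thesis by (simp add: sum_distrib_left mult.assoc)
qed

lemma bilinear_sum_coeffs:
  "bilinear (\<lambda>a b :: 'e::euclidean_space. (\<Sum>i\<in>Basis. \<Sum>j\<in>Basis. (a \<bullet> i) * (b \<bullet> j) * (C i j :: real)))"
  unfolding bilinear_def
  by (auto intro!: linearI simp: inner_add_left algebra_simps sum.distrib sum_distrib_left)

text \<open>The coordinate expression of a Riemannian metric. Allowing relatively open subsets of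
  the half-space covers charts of \<open>M\<close> at the boundary as well as charts of
  \<open>M'\<close>.\<close>

locale metric_field =
  fixes Y :: "'e::euclidean_space set" and G :: "'e \<Rightarrow> 'e \<Rightarrow> 'e \<Rightarrow> real"
  assumes half_open: "half_open Y"
    and bilin: "y \<in> Y \<Longrightarrow> bilinear (G y)"
    and sym: "y \<in> Y \<Longrightarrow> G y a b = G y b a"
    and pos: "y \<in> Y \<Longrightarrow> a \<noteq> 0 \<Longrightarrow> 0 < G y a a"
    and smooth: "smooth_on Y (\<lambda>y. G y a b)"
begin

definition DG :: "'e \<Rightarrow> 'e \<Rightarrow> 'e \<Rightarrow> 'e \<Rightarrow> real" where
  "DG y d a b = frechet_derivative (\<lambda>z. G z a b) (at y within Y) d"

definition \<Gamma> :: "'e \<Rightarrow> 'e \<Rightarrow> 'e \<Rightarrow> 'e \<Rightarrow> real" where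
  "\<Gamma> y a b w = (DG y a b w + DG y b a w - DG y w a b) / 2"

lemma has_derivative_G:
  assumes "y \<in> Y"
  shows "((\<lambda>z. G z a b) has_derivative (\<lambda>d. DG y d a b)) (at y within Y)"
  using smooth_on_differentiable[OF smooth assms] by (simp add: DG_def frechet_derivative_works)

lemma DG_unique:
  assumes "y \<in> Y" "((\<lambda>z. G z a b) has_derivative D) (at y within Y)"
  shows "DG y d a b = D d"
  using half_open_derivative_unique[OF half_open assms(1) has_derivative_G[OF assms(1)] assms(2)]
  by metis

lemma DG_linear: "y \<in> Y \<Longrightarrow> linear (\<lambda>d. DG y d a b)"
  using has_derivative_G has_derivative_bounded_linear bounded_linear.linear by blast

text \<open>Derivatives are taken of functions with fixed \<open>a\<close> and \<open>b\<close>;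
  bilinearity in these arguments passes from \<open>G\<close> to the derivative by
  uniqueness.\<close>

lemma DG_expand:
  assumes "y \<in> Y"
  shows "DG y d a b = (\<Sum>i\<in>Basis. \<Sum>j\<in>Basis. (a \<bullet> i) * (b \<bullet> j) * DG y d i j)"
proof (rule DG_unique[OF assms])
  have "((\<lambda>z. \<Sum>i\<in>Basis. \<Sum>j\<in>Basis. (a \<bullet> i) * (b \<bullet> j) * G z i j) has_derivative
     (\<lambda>d. \<Sum>i\<in>Basis. \<Sum>j\<in>Basis. (a \<bullet> i) * (b \<bullet> j) * DG y d i j)) (at y within Y)"
    by (intro has_derivative_sum has_derivative_mult_right has_derivative_G assms)
  then show "((\<lambda>z. G z a b) has_derivative
     (\<lambda>d. \<Sum>i\<in>Basis. \<Sum>j\<in>Basis. (a \<bullet> i) * (b \<bullet> j) * DG y d i j)) (at y within Y)"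
    by (rule has_derivative_transform[rotated 2]) (use assms bilin bilinear_expand in auto)
qed

lemma DG_bilinear: "y \<in> Y \<Longrightarrow> bilinear (DG y d)"
  by (subst ext[OF ext[OF DG_expand]]) (auto intro: bilinear_sum_coeffs)

lemma nondegenerate:
  assumes "y \<in> Y" "\<And>w. G y a w = G y b w"
  shows "a = b"
proof (rule ccontr)
  assume "a \<noteq> b"
  then have "0 < G y (a - b) (a - b)" using pos assms(1) by simp
  also have "\<dots> = 0" using assms(2) bilin[OF assms(1)] by (simp add: bilinear_lsub)
  finally show False by simp
qed

text \<open>Expanding both vectors in the basis reduces this product rule to derivatives of
  \<open>G\<close> with constant arguments. It serves for the change of coordinates and for the
  constancy of the speed.\<close>

lemma has_derivative_product:
  assumes \<phi>: "(\<phi> has_derivative \<phi>') (at x within S)" "\<phi> ` S \<subseteq> Y" "x \<in> S"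
    and p: "(p has_derivative p') (at x within S)"
    and q: "(q has_derivative q') (at x within S)"
  shows "((\<lambda>z. G (\<phi> z) (p z) (q z)) has_derivative
     (\<lambda>d. DG (\<phi> x) (\<phi>' d) (p x) (q x) + G (\<phi> x) (p' d) (q x) + G (\<phi> x) (p x) (q' d))) (at x within S)"
proof -
  have Yx: "\<phi> x \<in> Y" using \<phi> by auto
  have "((\<lambda>z. G (\<phi> z) a b) has_derivative (\<lambda>d. DG (\<phi> x) (\<phi>' d) a b)) (at x within S)" for a b
    using has_derivative_in_compose2[OF has_derivative_G \<phi>(2,3,1)] by simp
  moreover have "((\<lambda>z. p z \<bullet> i) has_derivative (\<lambda>d. p' d \<bullet> i)) (at x within S)"
    "((\<lambda>z. q z \<bullet> i) has_derivative (\<lambda>d. q' d \<bullet> i)) (at x within S)" for i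
    using p q by (auto intro: has_derivative_inner_left)
  ultimately have "((\<lambda>z. \<Sum>i\<in>Basis. \<Sum>j\<in>Basis. (p z \<bullet> i) * (q z \<bullet> j) * G (\<phi> z) i j) has_derivative
     (\<lambda>d. \<Sum>i\<in>Basis. \<Sum>j\<in>Basis. (p x \<bullet> i) * (q x \<bullet> j) * DG (\<phi> x) (\<phi>' d) i j
        + ((p x \<bullet> i) * (q' d \<bullet> j) + (p' d \<bullet> i) * (q x \<bullet> j)) * G (\<phi> x) i j)) (at x within S)"
    by (intro has_derivative_sum has_derivative_mult)
  moreover have "(\<Sum>i\<in>Basis. \<Sum>j\<in>Basis. (p x \<bullet> i) * (q x \<bullet> j) * DG (\<phi> x) (\<phi>' d) i j
        + ((p x \<bullet> i) * (q' d \<bullet> j) + (p' d \<bullet> i) * (q x \<bullet> j)) * G (\<phi> x) i j)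
     = DG (\<phi> x) (\<phi>' d) (p x) (q x) + G (\<phi> x) (p' d) (q x) + G (\<phi> x) (p x) (q' d)" for d
    unfolding DG_expand[OF Yx, of _ "p x" "q x"] bilinear_expand[OF bilin[OF Yx], of "p' d"]
      bilinear_expand[OF bilin[OF Yx], of "p x" "q' d"]
    by (simp add: sum.distrib algebra_simps)
  ultimately have "((\<lambda>z. \<Sum>i\<in>Basis. \<Sum>j\<in>Basis. (p z \<bullet> i) * (q z \<bullet> j) * G (\<phi> z) i j) has_derivative
     (\<lambda>d. DG (\<phi> x) (\<phi>' d) (p x) (q x) + G (\<phi> x) (p' d) (q x) + G (\<phi> x) (p x) (q' d))) (at x within S)"
    by (simp only:)
  then show ?thesis
    by (rule has_derivative_transform[rotated 2]) (use \<phi> in \<open>auto intro!: bilinear_expand bilin\<close>)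
qed

end

text \<open>Models a coordinate change that respects the metrics: \<open>F\<close> is a smooth
  extension of it to an open set, while the isometry identity is available only at the points of
  \<open>Y\<close>.\<close>

locale isometric_coords = A: metric_field Y G + B: metric_field Y' G'
  for Y :: "'e::euclidean_space set" and G and Y' :: "'e set" and G' +
  fixes U :: "'e set" and F :: "'e \<Rightarrow> 'e"
  assumes F: "Cinf_on U F" "\<And>z. z \<in> Y \<Longrightarrow> z \<in> U \<Longrightarrow> F z \<in> Y'"
    and iso: "\<And>z a b. z \<in> Y \<Longrightarrow> z \<in> U \<Longrightarrow> G z a b = G' (F z) (d1 F z a) (d1 F z b)"
begin

lemma DG_transform:
  assumes y: "y \<in> Y" "y \<in> U"
  shows "A.DG y d a b = B.DG (F y) (d1 F y d) (d1 F y a) (d1 F y b)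
     + G' (F y) (d2 F y d a) (d1 F y b) + G' (F y) (d1 F y a) (d2 F y d b)"
proof (rule A.DG_unique[OF y(1)])
  have D: "((\<lambda>z. G' (F z) (d1 F z a) (d1 F z b)) has_derivative
     (\<lambda>d. B.DG (F y) (d1 F y d) (d1 F y a) (d1 F y b)
     + G' (F y) (d2 F y d a) (d1 F y b) + G' (F y) (d1 F y a) (d2 F y d b))) (at y within Y \<inter> U)"
  proof (rule B.has_derivative_product)
    show "F ` (Y \<inter> U) \<subseteq> Y'" "y \<in> Y \<inter> U" using F(2) y by auto
    show "(F has_derivative d1 F y) (at y within Y \<inter> U)"
      using Cinf_on_d1[OF F(1) y(2)] by (rule has_derivative_at_withinI)
    show "((\<lambda>z. d1 F z a) has_derivative (\<lambda>d. d2 F y d a)) (at y within Y \<inter> U)"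
      "((\<lambda>z. d1 F z b) has_derivative (\<lambda>d. d2 F y d b)) (at y within Y \<inter> U)"
      using Cinf_on_d2[OF F(1) y(2)] has_derivative_at_withinI by blast+
  qed
  have "at y within Y \<inter> U = at y within Y"
    by (rule at_within_nhd[OF y(2) Cinf_on_open[OF F(1)]]) auto
  moreover have "((\<lambda>z. G z a b) has_derivative (\<lambda>d. B.DG (F y) (d1 F y d) (d1 F y a) (d1 F y b)
     + G' (F y) (d2 F y d a) (d1 F y b) + G' (F y) (d1 F y a) (d2 F y d b))) (at y within Y \<inter> U)"
    by (rule has_derivative_transform[OF _ _ D]) (use y iso in auto)
  ultimately show "((\<lambda>z. G z a b) has_derivative (\<lambda>d. B.DG (F y) (d1 F y d) (d1 F y a) (d1 F y b)
     + G' (F y) (d2 F y d a) (d1 F y b) + G' (F y) (d1 F y a) (d2 F y d b))) (at y within Y)"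
    by simp
qed

text \<open>Differentiating the isometry identity adds two terms with second derivatives of
  \<open>F\<close> to each derivative of the metric. By the symmetry of \<open>d2\<close>, those
  from \<open>DG y w p p\<close> cancel, after halving, the unwanted one from
  \<open>DG y p p w\<close>. What remains is the pairing with \<open>d2 F y p p + d1 F y q\<close>,
  the acceleration in the new coordinates.\<close>

lemma geodesic_equation_transform:
  assumes y: "y \<in> Y" "y \<in> U"
  shows "G y q w + A.\<Gamma> y p p w
    = G' (F y) (d2 F y p p + d1 F y q) (d1 F y w) + B.\<Gamma> (F y) (d1 F y p) (d1 F y p) (d1 F y w)"
proof -
  have Fy: "F y \<in> Y'" using F y by blast
  have s1: "d2 F y p w = d2 F y w p" using d2_symmetric[OF F(1) y(2)] .
  have s2: "G' (F y) (d1 F y p) (d2 F y w p) = G' (F y) (d2 F y w p) (d1 F y p)"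
    using B.sym[OF Fy] .
  show ?thesis
    unfolding A.\<Gamma>_def B.\<Gamma>_def DG_transform[OF y] iso[OF y] bilinear_ladd[OF B.bilin[OF Fy]] s1 s2
    by (simp add: field_simps)
qed

end

section \<open>Ordinary differential equations\<close>

lemma vector_derivative_bound:
  fixes z :: "real \<Rightarrow> 'z::real_normed_vector"
  assumes "convex J"
    and der: "\<And>t. t \<in> J \<Longrightarrow> (z has_vector_derivative z' t) (at t within J)"
    and B: "\<And>t. t \<in> J \<Longrightarrow> norm (z' t) \<le> B"
    and J: "s \<in> J" "t \<in> J"
  shows "norm (z s - z t) \<le> B * \<bar>s - t\<bar>"
proof -
  have "norm (z s - z t) \<le> B * norm (s - t)"
  proof (rule differentiable_bound[OF assms(1) _ _ J])
    fix r assume r: "r \<in> J"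
    show "(z has_derivative (\<lambda>h. h *\<^sub>R z' r)) (at r within J)"
      using der[OF r] by (simp add: has_vector_derivative_def)
    show "onorm (\<lambda>h. h *\<^sub>R z' r) \<le> B"
    proof (rule onorm_bound)
      show "0 \<le> B" using B[OF r] norm_ge_zero order_trans by blast
      show "norm (h *\<^sub>R z' r) \<le> B * norm h" for h
        using mult_right_mono[OF B[OF r], of "norm h"] by (simp add: mult.commute)
    qed
  qed
  then show ?thesis by simp
qed

text \<open>Where the difference of the two solutions has its largest norm on \<open>J\<close>, the
  mean value estimate bounds that norm by half of itself.\<close>

lemma ode_unique_local:
  fixes z w :: "real \<Rightarrow> 'z::real_normed_vector"
  assumes J: "compact J" "convex J" "t0 \<in> J" "\<And>t. t \<in> J \<Longrightarrow> L * \<bar>t - t0\<bar> \<le> 1 / 2"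
    and L: "L-lipschitz_on S X"
    and z: "\<And>t. t \<in> J \<Longrightarrow> z t \<in> S" "\<And>t. t \<in> J \<Longrightarrow> (z has_vector_derivative X (z t)) (at t within J)"
    and w: "\<And>t. t \<in> J \<Longrightarrow> w t \<in> S" "\<And>t. t \<in> J \<Longrightarrow> (w has_vector_derivative X (w t)) (at t within J)"
    and eq: "z t0 = w t0" and t: "t \<in> J"
  shows "z t = w t"
proof -
  define v where "v = (\<lambda>t. z t - w t)"
  have v: "(v has_vector_derivative (X (z t) - X (w t))) (at t within J)" if "t \<in> J" for t
    unfolding v_def using z(2)[OF that] w(2)[OF that] by (rule has_vector_derivative_diff)
  then have "continuous_on J v"
    using has_vector_derivative_continuous continuous_on_eq_continuous_within by blast
  then have "continuous_on J (\<lambda>t. norm (v t))" by (rule continuous_on_norm)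
  then obtain m where m: "m \<in> J" "\<And>t. t \<in> J \<Longrightarrow> norm (v t) \<le> norm (v m)"
    using continuous_attains_sup[OF J(1)] J(3) by blast
  have "norm (v m - v t0) \<le> (L * norm (v m)) * \<bar>m - t0\<bar>"
  proof (rule vector_derivative_bound[OF J(2) v _ m(1) J(3)])
    fix t assume t: "t \<in> J"
    have "norm (X (z t) - X (w t)) \<le> L * norm (v t)"
      using lipschitz_on_normD[OF L z(1)[OF t] w(1)[OF t]] by (simp add: v_def)
    also have "\<dots> \<le> L * norm (v m)"
      using m(2)[OF t] lipschitz_on_nonneg[OF L] by (rule mult_left_mono)
    finally show "norm (X (z t) - X (w t)) \<le> L * norm (v m)" .
  qed
  also have "\<dots> = (L * \<bar>m - t0\<bar>) * norm (v m)" by simp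
  also have "\<dots> \<le> 1 / 2 * norm (v m)" using J(4)[OF m(1)] by (rule mult_right_mono) simp
  finally have "norm (v m) \<le> 0" using eq by (simp add: v_def)
  then have "norm (v t) \<le> 0" using m(2)[OF t] by linarith
  then show ?thesis by (simp add: v_def)
qed

lemma picard_global:
  fixes X :: "'z::euclidean_space \<Rightarrow> 'z"
  assumes L: "L-lipschitz_on UNIV X" and e: "0 \<le> e" "L * e \<le> 1 / 2"
  obtains z where "z 0 = z0" "\<And>t. t \<in> {0..e} \<Longrightarrow> (z has_vector_derivative X (z t)) (at t within {0..e})"
proof -
  \<comment> \<open>Clamping the time to \<open>{0..e}\<close> turns curves on the interval into
    bounded continuous functions on the whole line, a complete space on which the fixed point
    theorem applies.\<close>
  define cl where "cl = (\<lambda>t::real. max 0 (min e t))"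
  have cl: "cl t \<in> {0..e}" for t using e by (auto simp: cl_def)
  have contcl: "continuous_on UNIV cl" unfolding cl_def by (intro continuous_intros)
  have contX: "continuous_on UNIV X" using L by (rule lipschitz_on_continuous_on)
  define I where "I = (\<lambda>(z :: real \<Rightarrow>\<^sub>C 'z) t. z0 + integral {0..t} (\<lambda>s. X (apply_bcontfun z s)))"
  have contXz: "continuous_on S (\<lambda>s. X (apply_bcontfun z s))" for z :: "real \<Rightarrow>\<^sub>C 'z" and S
    using continuous_on_compose2[OF contX continuous_on_apply_bcontfun] by simp
  have contI: "continuous_on {0..e} (I z)" for z
    unfolding I_def
    by (intro continuous_intros indefinite_integral_continuous_1 integrable_continuous_real contXz)
  define T where "T = (\<lambda>z. Bcontfun (\<lambda>t. I z (cl t)))"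
  have T: "apply_bcontfun (T z) t = I z (cl t)" for z t
  proof -
    have "continuous_on UNIV (\<lambda>t. I z (cl t))"
      by (rule continuous_on_compose2[OF contI contcl]) (use cl in auto)
    moreover have "bounded (range (\<lambda>t. I z (cl t)))"
      by (rule bounded_subset[OF compact_imp_bounded[OF compact_continuous_image[OF contI compact_Icc]]])
         (use cl in auto)
    ultimately have "(\<lambda>t. I z (cl t)) \<in> bcontfun" by (simp add: bcontfun_def)
    then show ?thesis by (simp add: T_def Bcontfun_inverse)
  qed
  \<comment> \<open>The Picard integral operator contracts distances by the factor
    \<open>L * e\<close>, which is at most one half.\<close>
  have "\<exists>!z. T z = z"
  proof (rule banach_fix_type)
    show "\<forall>z w. dist (T z) (T w) \<le> 1 / 2 * dist z w"
    proof (intro allI dist_bound)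
      fix z w t
      define c where "c = cl t"
      have c: "0 \<le> c" "c \<le> e" using cl[of t] by (auto simp: c_def)
      have "dist (T z t) (T w t) = norm (integral {0..c} (\<lambda>s. X (z s)) - integral {0..c} (\<lambda>s. X (w s)))"
        by (simp add: T I_def dist_norm c_def)
      also have "\<dots> = norm (integral {0..c} (\<lambda>s. X (z s) - X (w s)))"
        by (subst integral_diff) (auto intro: integrable_continuous_real contXz)
      also have "\<dots> \<le> L * dist z w * (c - 0)"
      proof (rule integral_bound[OF c(1)])
        show "continuous_on {0..c} (\<lambda>s. X (z s) - X (w s))" by (intro continuous_intros contXz)
        show "norm (X (z s) - X (w s)) \<le> L * dist z w" for s
        proof -
          have "norm (X (z s) - X (w s)) \<le> L * dist (z s) (w s)"
            using lipschitz_on_normD[OF L] by (simp add: dist_norm)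
          also have "\<dots> \<le> L * dist z w"
            using dist_bounded lipschitz_on_nonneg[OF L] by (intro mult_left_mono)
          finally show ?thesis .
        qed
      qed
      also have "\<dots> = (L * c) * dist z w" by simp
      also have "L * c \<le> 1 / 2"
        using mult_left_mono[OF c(2) lipschitz_on_nonneg[OF L]] e(2) by linarith
      then have "(L * c) * dist z w \<le> 1 / 2 * dist z w" by (rule mult_right_mono) simp
      finally show "dist (T z t) (T w t) \<le> 1 / 2 * dist z w" .
    qed
  qed auto
  then obtain z where z: "T z = z" by blast
  have zI: "apply_bcontfun z t = I z t" if "t \<in> {0..e}" for t
    using T[of z t] that by (simp add: z cl_def)
  show ?thesis
  proof (rule that[of "I z"])
    show "I z 0 = z0" by (simp add: I_def)
    fix t assume t: "t \<in> {0..e}"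
    have "(I z has_vector_derivative (0 + X (apply_bcontfun z t))) (at t within {0..e})"
      unfolding I_def
      by (intro has_vector_derivative_add has_vector_derivative_const integral_has_vector_derivative
        contXz t)
    then show "(I z has_vector_derivative X (I z t)) (at t within {0..e})" by (simp add: zI[OF t])
  qed
qed

text \<open>Composing \<open>X\<close> with the nearest point projection onto \<open>S\<close> gives
  a globally Lipschitz field with the same constant. The speed bound \<open>B\<close> keeps its
  solution in \<open>S\<close> up to time \<open>e\<close>, and there the projection changes
  nothing.\<close>

lemma picard_local:
  fixes X :: "'z::euclidean_space \<Rightarrow> 'z"
  assumes S: "compact S" "convex S" and z0: "z0 \<in> S"
    and L: "L-lipschitz_on S X" and B: "\<And>x. x \<in> S \<Longrightarrow> norm (X x) \<le> B"
    and e: "0 \<le> e" "L * e \<le> 1 / 2" "cball z0 (B * e) \<subseteq> S"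
  obtains z where "z 0 = z0" "\<And>t. t \<in> {0..e} \<Longrightarrow> z t \<in> S"
    "\<And>t. t \<in> {0..e} \<Longrightarrow> (z has_vector_derivative X (z t)) (at t within {0..e})"
proof -
  have False: "S \<noteq> {}" using z0 by blast
  have cS: "closed S" using S compact_imp_closed by blast
  let ?cp = "closest_point S"
  have cp: "?cp x \<in> S" for x using closest_point_in_set[OF cS False] .
  have "1-lipschitz_on UNIV ?cp"
    by (rule lipschitz_onI) (use closest_point_lipschitz[OF S(2) cS False] in auto)
  moreover have "L-lipschitz_on (range ?cp) X" by (rule lipschitz_on_subset[OF L]) (use cp in auto)
  ultimately have "(L * 1)-lipschitz_on UNIV (\<lambda>x. X (?cp x))" by (rule lipschitz_on_compose2)
  then have "L-lipschitz_on UNIV (\<lambda>x. X (?cp x))" by simp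
  from picard_global[OF this e(1,2)] obtain z where z: "z 0 = z0"
    "\<And>t. t \<in> {0..e} \<Longrightarrow> (z has_vector_derivative X (?cp (z t))) (at t within {0..e})" by blast
  have zS: "z t \<in> S" if t: "t \<in> {0..e}" for t
  proof -
    have "norm (z t - z 0) \<le> B * \<bar>t - 0\<bar>"
      by (rule vector_derivative_bound[where J = "{0..e}", OF _ z(2)]) (use t e B cp in auto)
    also have "\<dots> \<le> B * e"
    proof (rule mult_left_mono)
      show "0 \<le> B" using B[OF cp[of z0]] norm_ge_zero order_trans by blast
    qed (use t in auto)
    finally have "z t \<in> cball z0 (B * e)" using z(1) by (simp add: dist_norm norm_minus_commute)
    then show ?thesis using e by blast
  qed
  show ?thesis
  proof (rule that)
    show "(z has_vector_derivative X (z t)) (at t within {0..e})" if "t \<in> {0..e}" for t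
      using z(2)[OF that] by (simp add: closest_point_self[OF zS[OF that]])
  qed (use z(1) zS in auto)
qed

section \<open>Locally Lipschitz functions\<close>

definition locally_lip :: "('z::metric_space \<Rightarrow> 'w::metric_space) \<Rightarrow> 'z \<Rightarrow> bool" where
  "locally_lip f z \<longleftrightarrow> (\<exists>r>0. \<exists>L. L-lipschitz_on (cball z r) f)"

lemma locally_lipI: "r > 0 \<Longrightarrow> L-lipschitz_on (cball z r) f \<Longrightarrow> locally_lip f z"
  unfolding locally_lip_def by blast

lemma locally_lip_common:
  assumes "finite I" "\<And>i. i \<in> I \<Longrightarrow> locally_lip (f i) z" "r0 > 0"
  obtains r L where "r > 0" "r \<le> r0" "L \<ge> 0" "\<And>i. i \<in> I \<Longrightarrow> L-lipschitz_on (cball z r) (f i)"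
  using assms(1,2)
proof (induction arbitrary: thesis rule: finite_induct)
  case empty
  show ?case by (rule empty(1)[of r0 0]) (use assms in auto)
next
  case (insert i I)
  obtain r L where r: "r > 0" "r \<le> r0" "L \<ge> 0" "\<And>i. i \<in> I \<Longrightarrow> L-lipschitz_on (cball z r) (f i)"
    using insert by blast
  obtain s K where s: "s > 0" "K-lipschitz_on (cball z s) (f i)"
    using insert.prems(2)[of i] unfolding locally_lip_def by blast
  have "(max L K)-lipschitz_on (cball z (min r s)) (f j)" if j: "j \<in> insert i I" for j
  proof (cases "j = i")
    case True
    then show ?thesis using lipschitz_on_mono[OF s(2), of "cball z (min r s)" "max L K"] by fastforce
  next
    case False
    then show ?thesis using j lipschitz_on_mono[OF r(4), of j "cball z (min r s)" "max L K"] by fastforce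
  qed
  then show ?case by (intro insert.prems(1)[of "min r s" "max L K"]) (use r s in auto)
qed

lemma locally_lip_common2:
  assumes "locally_lip f z" "locally_lip g z"
  obtains r L where "r > 0" "L \<ge> 0" "L-lipschitz_on (cball z r) f" "L-lipschitz_on (cball z r) g"
proof -
  obtain r L where r: "r > 0" "L-lipschitz_on (cball z r) f" using assms(1) unfolding locally_lip_def by blast
  obtain s K where s: "s > 0" "K-lipschitz_on (cball z s) g" using assms(2) unfolding locally_lip_def by blast
  show ?thesis
  proof (rule that[of "min r s" "max L K"])
    show "(max L K)-lipschitz_on (cball z (min r s)) f"
      by (rule lipschitz_on_mono[OF r(2)]) auto
    show "(max L K)-lipschitz_on (cball z (min r s)) g"
      by (rule lipschitz_on_mono[OF s(2)]) auto
  qed (use r s lipschitz_on_nonneg[OF r(2)] in auto)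
qed

lemma locally_lip_const: "locally_lip (\<lambda>_. c) z"
  by (rule locally_lipI[of 1 0]) (auto intro: lipschitz_on_constant)

lemma locally_lip_bounded_linear: "bounded_linear f \<Longrightarrow> locally_lip f z"
  using bounded_linear.lipschitz_boundE locally_lipI[of 1] by (metis zero_less_one)

lemma locally_lip_add:
  fixes f g :: "'z::metric_space \<Rightarrow> 'w::real_normed_vector"
  assumes "locally_lip f z" "locally_lip g z"
  shows "locally_lip (\<lambda>x. f x + g x) z"
proof -
  obtain r L where r: "r > 0" "L-lipschitz_on (cball z r) f" "L-lipschitz_on (cball z r) g"
    using locally_lip_common2[OF assms] by blast
  show ?thesis by (rule locally_lipI[OF r(1) lipschitz_on_add[OF r(2,3)]])
qed

lemma locally_lip_sum:
  fixes f :: "'i \<Rightarrow> 'z::metric_space \<Rightarrow> 'w::real_normed_vector"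
  assumes "\<And>i. i \<in> I \<Longrightarrow> locally_lip (f i) z"
  shows "locally_lip (\<lambda>x. \<Sum>i\<in>I. f i x) z"
  using assms by (induction I rule: infinite_finite_induct) (auto intro: locally_lip_const locally_lip_add)

lemma locally_lip_bounded:
  fixes f :: "'z::metric_space \<Rightarrow> 'w::real_normed_vector"
  assumes "L-lipschitz_on (cball z r) f" "x \<in> cball z r"
  shows "norm (f x) \<le> norm (f z) + L * r"
proof -
  have "0 \<le> r" using assms(2) by (metis mem_cball order_trans zero_le_dist)
  then have "norm (f x - f z) \<le> L * dist x z"
    using lipschitz_onD[OF assms, of z] by (simp add: dist_norm)
  also have "\<dots> \<le> L * r"
    using assms(2) lipschitz_on_nonneg[OF assms(1)] by (intro mult_left_mono) (auto simp: dist_commute)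
  finally show ?thesis using norm_triangle_sub[of "f x" "f z"] by linarith
qed

lemma locally_lip_mult:
  fixes f g :: "'z::metric_space \<Rightarrow> real"
  assumes "locally_lip f z" "locally_lip g z"
  shows "locally_lip (\<lambda>x. f x * g x) z"
proof -
  obtain r L where r: "r > 0" "L \<ge> 0" "L-lipschitz_on (cball z r) f" "L-lipschitz_on (cball z r) g"
    using locally_lip_common2[OF assms] .
  \<comment> \<open>A common bound for both factors on the ball.\<close>
  define C where "C = \<bar>f z\<bar> + \<bar>g z\<bar> + L * r"
  have C: "0 \<le> C" using r by (simp add: C_def)
  have fC: "\<bar>f x\<bar> \<le> C" and gC: "\<bar>g x\<bar> \<le> C" if "x \<in> cball z r" for x
    using locally_lip_bounded[OF r(3) that] locally_lip_bounded[OF r(4) that] by (auto simp: C_def)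
  have "(C * L + C * L)-lipschitz_on (cball z r) (\<lambda>x. f x * g x)"
  proof (rule lipschitz_onI)
    fix x y assume x: "x \<in> cball z r" and y: "y \<in> cball z r"
    have "f x * g x - f y * g y = f x * (g x - g y) + g y * (f x - f y)" by (simp add: algebra_simps)
    then have "\<bar>f x * g x - f y * g y\<bar> \<le> \<bar>f x\<bar> * \<bar>g x - g y\<bar> + \<bar>g y\<bar> * \<bar>f x - f y\<bar>"
      by (metis abs_mult abs_triangle_ineq)
    also have "\<dots> \<le> C * (L * dist x y) + C * (L * dist x y)"
      using fC[OF x] gC[OF y] lipschitz_onD[OF r(4) x y] lipschitz_onD[OF r(3) x y] C
      by (intro add_mono mult_mono) (auto simp: dist_real_def)
    finally show "dist (f x * g x) (f y * g y) \<le> (C * L + C * L) * dist x y"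
      by (simp add: dist_real_def algebra_simps)
  qed (use C r in auto)
  then show ?thesis using r(1) locally_lipI by blast
qed

lemma locally_lip_compose:
  assumes "locally_lip g z" "locally_lip f (g z)"
  shows "locally_lip (\<lambda>x. f (g x)) z"
proof -
  obtain r L where r: "r > 0" "L-lipschitz_on (cball z r) g" using assms(1) unfolding locally_lip_def by blast
  obtain s K where s: "s > 0" "K-lipschitz_on (cball (g z) s) f" using assms(2) unfolding locally_lip_def by blast
  \<comment> \<open>Within distance \<open>s / (L + 1)\<close> of \<open>z\<close> the values of
    \<open>g\<close> stay in the ball where \<open>f\<close> is Lipschitz; adding \<open>1\<close>
    avoids a division by zero.\<close>
  define d where "d = min r (s / (L + 1))"
  have L: "L \<ge> 0" using r lipschitz_on_nonneg by blast
  have d: "d > 0" using r s L by (simp add: d_def)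
  have "g x \<in> cball (g z) s" if "x \<in> cball z d" for x
  proof -
    have x: "x \<in> cball z r" "z \<in> cball z r" "dist x z \<le> s / (L + 1)"
      using that r by (auto simp: d_def dist_commute)
    have "dist (g x) (g z) \<le> L * dist x z" using lipschitz_onD[OF r(2) x(1,2)] .
    also have "\<dots> \<le> (L + 1) * (s / (L + 1))" using L x(3) by (intro mult_mono) auto
    finally show ?thesis using L by (simp add: dist_commute)
  qed
  then have "K-lipschitz_on (g ` cball z d) f" by (intro lipschitz_on_subset[OF s(2)]) auto
  moreover have "L-lipschitz_on (cball z d) g" by (rule lipschitz_on_subset[OF r(2)]) (auto simp: d_def)
  ultimately have "(K * L)-lipschitz_on (cball z d) (\<lambda>x. f (g x))" by (intro lipschitz_on_compose2)
  then show ?thesis using d locally_lipI by blast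
qed

lemma locally_lip_cong:
  assumes "locally_lip f z" "open U" "z \<in> U" "\<And>x. x \<in> U \<Longrightarrow> f x = g x"
  shows "locally_lip g z"
proof -
  obtain r L where r: "r > 0" "L-lipschitz_on (cball z r) f" using assms(1) unfolding locally_lip_def by blast
  obtain s where s: "s > 0" "cball z s \<subseteq> U" using assms(2,3) open_contains_cball by blast
  have "L-lipschitz_on (cball z (min r s)) f" by (rule lipschitz_on_subset[OF r(2)]) auto
  then have "L-lipschitz_on (cball z (min r s)) g"
    by (rule lipschitz_on_transform) (use s assms(4) in auto)
  then show ?thesis using r s locally_lipI[of "min r s"] by auto
qed

text \<open>The partial derivatives are bounded on a compact ball, and the mean value inequality
  turns their bound into a Lipschitz constant.\<close>

lemma Cinf_on_locally_lip:
  assumes "Cinf_on U F" "y \<in> U"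
  shows "locally_lip F y"
proof -
  obtain r where r: "r > 0" "cball y r \<subseteq> U"
    using assms Cinf_on_open open_contains_cball by metis
  have "\<exists>C. \<forall>z\<in>cball y r. norm (d1 F z i) \<le> C" if "i \<in> Basis" for i
  proof -
    have "continuous_on U (\<lambda>z. d1 F z i)"
      using Cinf_on_d1[OF Cinf_on_partial[OF assms(1) that]] Cinf_on_open[OF assms(1)]
      by (meson continuous_at_imp_continuous_on has_derivative_continuous)
    then have "compact ((\<lambda>z. d1 F z i) ` cball y r)"
      using r continuous_on_subset compact_continuous_image compact_cball by blast
    then have "bounded ((\<lambda>z. d1 F z i) ` cball y r)" by (rule compact_imp_bounded)
    then show ?thesis by (auto simp: bounded_iff)
  qed
  then obtain C where C: "\<And>i z. i \<in> Basis \<Longrightarrow> z \<in> cball y r \<Longrightarrow> norm (d1 F z i) \<le> C i" by metis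
  define K where "K = (\<Sum>i\<in>Basis. C i)"
  have bnd: "norm (d1 F z b) \<le> K * norm b" if "z \<in> cball y r" for z b
  proof -
    have "norm (d1 F z b) = norm (\<Sum>i\<in>Basis. (b \<bullet> i) *\<^sub>R d1 F z i)"
      using linear_sum_Basis[OF Cinf_on_linear_d1[OF assms(1)]] that r by (metis subsetD)
    also have "\<dots> \<le> (\<Sum>i\<in>Basis. norm b * C i)"
      using C that by (intro sum_norm_le) (auto intro!: mult_mono Basis_le_norm)
    also have "\<dots> = K * norm b" by (simp add: K_def sum_distrib_left mult.commute)
    finally show ?thesis .
  qed
  have K: "0 \<le> K" unfolding K_def
  proof (rule sum_nonneg)
    fix i :: 'a assume "i \<in> Basis"
    then show "0 \<le> C i" using C[of i y] r norm_ge_zero order_trans by (metis centre_in_cball less_imp_le)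
  qed
  have "K-lipschitz_on (cball y r) F"
  proof (rule lipschitz_onI[OF _ K])
    fix a b assume "a \<in> cball y r" "b \<in> cball y r"
    then have "norm (F a - F b) \<le> K * norm (a - b)"
    proof (rule differentiable_bound[OF convex_cball, rotated 2])
      fix z assume z: "z \<in> cball y r"
      show "(F has_derivative d1 F z) (at z within cball y r)"
        using has_derivative_at_withinI[OF Cinf_on_d1[OF assms(1), of z]] z r by blast
      show "onorm (d1 F z) \<le> K" using bnd[OF z] K by (intro onorm_bound)
    qed
    then show "dist (F a) (F b) \<le> K * dist a b" by (simp add: dist_norm)
  qed
  then show ?thesis using r(1) locally_lipI by blast
qed

lemma picard_locally_lip:
  fixes X :: "'z::euclidean_space \<Rightarrow> 'z"
  assumes "locally_lip X z0" "open W" "z0 \<in> W"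
  obtains r e where "r > 0" "e > 0" "\<And>z1. z1 \<in> cball z0 r \<Longrightarrow> \<exists>z. z 0 = z1 \<and>
     (\<forall>t\<in>{0..e}. z t \<in> W \<and> (z has_vector_derivative X (z t)) (at t within {0..e}))"
proof -
  obtain s L where s: "s > 0" "L-lipschitz_on (cball z0 s) X" using assms(1) unfolding locally_lip_def by blast
  obtain w where w: "w > 0" "cball z0 w \<subseteq> W" using assms(2,3) open_contains_cball by blast
  \<comment> \<open>One half of the available radius is for the starting points, the other half for
    the distance a solution travels.\<close>
  define r where "r = min s w / 2"
  have r: "r > 0" "2 * r \<le> s" "2 * r \<le> w" using s w by (auto simp: r_def)
  have L: "L-lipschitz_on (cball z0 (2 * r)) X"
    by (rule lipschitz_on_subset[OF s(2)]) (use r in auto)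
  define B where "B = norm (X z0) + L * (2 * r) + 1"
  have L0: "L \<ge> 0" using L lipschitz_on_nonneg by blast
  have B: "B > 0" unfolding B_def using L0 r by (simp add: add_nonneg_pos)
  have XB: "norm (X x) \<le> B" if "x \<in> cball z0 (2 * r)" for x
    using locally_lip_bounded[OF L that] by (simp add: B_def)
  \<comment> \<open>The first bound limits the distance travelled to \<open>r\<close>, the second
    makes the Picard operator a contraction.\<close>
  define e where "e = min (r / B) (1 / (2 * (L + 1)))"
  have e: "e > 0" using r B L0 by (simp add: e_def)
  have "L * e \<le> (L + 1) * (1 / (2 * (L + 1)))"
    using L0 e by (intro mult_mono) (auto simp: e_def)
  moreover have "(L + 1) * (1 / (2 * (L + 1))) = 1 / 2" using L0 by (simp add: field_simps)
  ultimately have Le: "L * e \<le> 1 / 2" by linarith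
  have "B * e \<le> B * (r / B)" using B by (intro mult_left_mono) (auto simp: e_def)
  then have Be: "B * e \<le> r" using B by simp
  show ?thesis
  proof (rule that[OF r(1) e])
    fix z1 assume z1: "z1 \<in> cball z0 r"
    have sub: "cball z1 (B * e) \<subseteq> cball z0 (2 * r)"
      using z1 Be by (simp add: cball_subset_cball_iff dist_commute)
    have "z1 \<in> cball z0 (2 * r)" using z1 r(1) by simp
    from picard_local[OF compact_cball convex_cball this L XB less_imp_le[OF e] Le sub]
    obtain z where z: "z 0 = z1" "\<And>t. t \<in> {0..e} \<Longrightarrow> z t \<in> cball z0 (2 * r)"
      "\<And>t. t \<in> {0..e} \<Longrightarrow> (z has_vector_derivative X (z t)) (at t within {0..e})" by blast
    moreover have "cball z0 (2 * r) \<subseteq> W" using w r by (meson subset_cball subset_trans)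
    ultimately show "\<exists>z. z 0 = z1 \<and>
       (\<forall>t\<in>{0..e}. z t \<in> W \<and> (z has_vector_derivative X (z t)) (at t within {0..e}))" by blast
  qed
qed

text \<open>Finitely many balls of half the local radius cover \<open>K\<close>; the smallest half
  radius and the smallest existence time among them work at every point of \<open>K\<close>.\<close>

lemma picard_compact:
  fixes X :: "'z::euclidean_space \<Rightarrow> 'z"
  assumes K: "compact K" "K \<subseteq> W" and "open W" and X: "\<And>z. z \<in> K \<Longrightarrow> locally_lip X z"
  obtains r e where "r > 0" "e > 0" "\<And>z0 z1. z0 \<in> K \<Longrightarrow> z1 \<in> cball z0 r \<Longrightarrow> \<exists>z. z 0 = z1 \<and>
     (\<forall>t\<in>{0..e}. z t \<in> W \<and> (z has_vector_derivative X (z t)) (at t within {0..e}))"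
proof -
  define sol where "sol = (\<lambda>z1 e. \<exists>z. z 0 = z1 \<and>
     (\<forall>t\<in>{0..e}. z t \<in> W \<and> (z has_vector_derivative X (z t)) (at t within {0..e})))"
  have "\<exists>r e. r > 0 \<and> e > 0 \<and> (\<forall>z1\<in>cball z0 r. sol z1 e)" if "z0 \<in> K" for z0
    using picard_locally_lip[OF X[OF that] \<open>open W\<close>] K(2) that unfolding sol_def by (metis subsetD)
  then obtain r e where re: "\<And>z0. z0 \<in> K \<Longrightarrow> r z0 > 0 \<and> e z0 > 0 \<and> (\<forall>z1\<in>cball z0 (r z0). sol z1 (e z0))"
    by metis
  have sol_mono: "sol z1 d" if "sol z1 d'" "d \<le> d'" for z1 d d'
  proof -
    have "{0..d} \<subseteq> {0..d'}" using that(2) by auto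
    from that(1)[unfolded sol_def] obtain z where "z 0 = z1"
      "\<forall>t\<in>{0..d'}. z t \<in> W \<and> (z has_vector_derivative X (z t)) (at t within {0..d'})"
      by blast
    with \<open>{0..d} \<subseteq> {0..d'}\<close> show ?thesis unfolding sol_def
      by (intro exI[of _ z]) (meson has_vector_derivative_within_subset subsetD)
  qed
  have cov: "K \<subseteq> (\<Union>z0\<in>K. ball z0 (r z0 / 2))" using re by force
  obtain C where C: "C \<subseteq> K" "finite C" "K \<subseteq> (\<Union>z0\<in>C. ball z0 (r z0 / 2))"
    by (rule compactE_image[OF K(1) _ cov]) auto
  define rr where "rr = Min (insert 1 ((\<lambda>z0. r z0 / 2) ` C))"
  define ee where "ee = Min (insert 1 (e ` C))"
  have rr: "rr > 0" "\<And>z0. z0 \<in> C \<Longrightarrow> rr \<le> r z0 / 2"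
    using C re by (auto simp: rr_def subset_iff intro!: Min_le simp del: le_divide_eq_numeral1)
  have ee: "ee > 0" "\<And>z0. z0 \<in> C \<Longrightarrow> ee \<le> e z0" using C re by (auto simp: ee_def subset_iff)
  show ?thesis
  proof (rule that[OF rr(1) ee(1)])
    fix z0 z1 assume "z0 \<in> K" "z1 \<in> cball z0 rr"
    then obtain c where c: "c \<in> C" "dist c z0 < r c / 2" using C(3) by auto
    have "dist c z1 \<le> r c"
      using dist_triangle[of c z1 z0] c rr(2)[OF c(1)] \<open>z1 \<in> cball z0 rr\<close> by simp
    then have "sol z1 (e c)" using re c C by auto
    then have "sol z1 ee" using sol_mono ee(2)[OF c(1)] by blast
    then show "\<exists>z. z 0 = z1 \<and>
       (\<forall>t\<in>{0..ee}. z t \<in> W \<and> (z has_vector_derivative X (z t)) (at t within {0..ee}))"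
      by (simp add: sol_def)
  qed
qed

section \<open>The acceleration as a function of position and velocity\<close>

context metric_field
begin

lemma DG_add:
  assumes "y \<in> Y"
  shows "DG y (c + d) a b = DG y c a b + DG y d a b" "DG y (r *\<^sub>R d) a b = r * DG y d a b"
    "DG y d (a + a') b = DG y d a b + DG y d a' b" "DG y d (r *\<^sub>R a) b = r * DG y d a b"
    "DG y d a (b + b') = DG y d a b + DG y d a b'" "DG y d a (r *\<^sub>R b) = r * DG y d a b"
  using linear_add[OF DG_linear[OF assms]] linear_cmul[OF DG_linear[OF assms]]
    bilinear_ladd[OF DG_bilinear[OF assms]] bilinear_lmul[OF DG_bilinear[OF assms]]
    bilinear_radd[OF DG_bilinear[OF assms]] bilinear_rmul[OF DG_bilinear[OF assms]]
  by simp_all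

lemma \<Gamma>_bilinear: assumes "y \<in> Y" shows "bilinear (\<lambda>a b. \<Gamma> y a b w)"
  unfolding bilinear_def \<Gamma>_def
  by (auto intro!: linearI simp: DG_add[OF assms] algebra_simps add_divide_distrib diff_divide_distrib)

lemma \<Gamma>_linear: assumes "y \<in> Y" shows "linear (\<Gamma> y a b)"
  unfolding \<Gamma>_def[abs_def]
  by (auto intro!: linearI simp: DG_add[OF assms] algebra_simps add_divide_distrib diff_divide_distrib)

definition acceleration :: "'e \<Rightarrow> 'e \<Rightarrow> 'e" where
  "acceleration y p = (THE q. \<forall>w. G y q w + \<Gamma> y p p w = 0)"

text \<open>Positive definiteness makes the map from vectors to covectors given by
  \<open>G y\<close> injective, hence surjective in finite dimension. So the geodesic equation can
  be solved for the second derivative.\<close>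

lemma acceleration_iff:
  assumes y: "y \<in> Y"
  shows "(\<forall>w. G y q w + \<Gamma> y p p w = 0) \<longleftrightarrow> q = acceleration y p"
proof -
  have linG: "linear (\<lambda>q. G y q w)" and linG': "linear (G y q)" for w q
    using bilin[OF y] by (auto simp: bilinear_def)
  \<comment> \<open>\<open>f q\<close> represents the covector \<open>G y q\<close> in the inner
    product of the model space, which makes the map from vectors to covectors an
    endomorphism.\<close>
  define f where "f = (\<lambda>q. \<Sum>i\<in>Basis. G y q i *\<^sub>R i)"
  have f: "linear f" unfolding f_def
    by (rule linearI) (simp_all add: linear_add[OF linG] linear_cmul[OF linG] algebra_simps
      sum.distrib scaleR_sum_right)
  have fi: "f q \<bullet> i = G y q i" if "i \<in> Basis" for q i
    using that by (simp add: f_def)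
  have Gf: "G y q w = f q \<bullet> w" for q w
  proof -
    have "G y q w = (\<Sum>i\<in>Basis. (w \<bullet> i) * G y q i)" by (subst linear_sum_Basis[OF linG']) simp
    also have "\<dots> = (\<Sum>i\<in>Basis. (f q \<bullet> i) * (w \<bullet> i))" by (intro sum.cong) (simp_all add: fi)
    finally show ?thesis using euclidean_inner[of "f q" w] by (simp only:)
  qed
  have "inj f"
  proof (rule injI)
    fix a b assume "f a = f b"
    then show "a = b" using nondegenerate[OF y] Gf by metis
  qed
  then have "surj f" using f linear_injective_imp_surjective by blast
  then obtain q0 where q0: "f q0 = (\<Sum>i\<in>Basis. (- \<Gamma> y p p i) *\<^sub>R i)" by (metis surjD)
  have q0: "G y q0 w + \<Gamma> y p p w = 0" for w
  proof -
    have "G y q0 w = (\<Sum>i\<in>Basis. (w \<bullet> i) * (- \<Gamma> y p p i))"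
      unfolding Gf q0 inner_sum_left inner_scaleR_left
      by (intro sum.cong refl) (simp add: inner_commute)
    moreover have "\<Gamma> y p p w = (\<Sum>i\<in>Basis. (w \<bullet> i) * \<Gamma> y p p i)"
      by (subst linear_sum_Basis[OF \<Gamma>_linear[OF y]]) simp
    ultimately show ?thesis by (simp add: sum_negf)
  qed
  have uniq: "q = q0" if "\<forall>w. G y q w + \<Gamma> y p p w = 0" for q
    using nondegenerate[OF y] that q0 by (metis add_right_cancel)
  have "acceleration y p = q0"
    unfolding acceleration_def by (rule the_equality) (use q0 uniq in auto)
  then show ?thesis using uniq q0 by blast
qed

end

text \<open>For charts of manifolds without boundary: in an open set the solutions of the geodesic
  equation can be followed in every direction.\<close>

locale open_metric_field = metric_field Y G for Y :: "'e::euclidean_space set" and G +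
  assumes open_Y: "open Y"
begin

lemma G_locally_lip: assumes "y \<in> Y" shows "locally_lip (\<lambda>y. G y a b) y"
proof -
  obtain U F where F: "Cinf_on U F" "y \<in> U" "\<And>z. z \<in> Y \<Longrightarrow> z \<in> U \<Longrightarrow> F z = G z a b"
    using smooth_onE[OF smooth assms] by metis
  show ?thesis
    by (rule locally_lip_cong[OF Cinf_on_locally_lip[OF F(1,2)], of "Y \<inter> U"])
       (use F assms open_Y Cinf_on_open[OF F(1)] in auto)
qed

lemma DG_locally_lip:
  assumes "y \<in> Y" "k \<in> Basis"
  shows "locally_lip (\<lambda>y. DG y k a b) y"
proof -
  obtain U F where F: "Cinf_on U F" "y \<in> U" "\<And>z. z \<in> Y \<Longrightarrow> z \<in> U \<Longrightarrow> F z = G z a b"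
    using smooth_onE[OF smooth assms(1)] by metis
  have "d1 F z k = DG z k a b" if "z \<in> Y \<inter> U" for z
  proof -
    have "((\<lambda>z. G z a b) has_derivative d1 F z) (at z within Y)"
      by (rule has_derivative_extension[OF F(1)]) (use F(3) that in auto)
    then show ?thesis using DG_unique that by simp
  qed
  then show ?thesis
    by (intro locally_lip_cong[OF Cinf_on_locally_lip[OF Cinf_on_partial[OF F(1) assms(2)] F(2)], of "Y \<inter> U"])
       (use F assms open_Y Cinf_on_open[OF F(1)] in auto)
qed

text \<open>For basis arguments \<Gamma> combines partial derivatives of smooth functions, and its
  dependence on the velocity is a quadratic polynomial.\<close>

lemma \<Gamma>_locally_lip:
  assumes "y \<in> Y" "i \<in> Basis"
  shows "locally_lip (\<lambda>z. \<Gamma> (fst z) (snd z) (snd z) i) (y, p)"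
proof -
  have c: "locally_lip (\<lambda>y. \<Gamma> y k l i) y" if "k \<in> Basis" "l \<in> Basis" for k l
  proof -
    have "locally_lip (\<lambda>y. (1 / 2) * DG y k l i + (1 / 2) * DG y l k i + (- 1 / 2) * DG y i k l) y"
      by (intro locally_lip_add locally_lip_mult locally_lip_const DG_locally_lip assms that)
    then show ?thesis unfolding \<Gamma>_def by (simp add: add_divide_distrib diff_divide_distrib)
  qed
  have c': "locally_lip (\<lambda>z. \<Gamma> (fst z) k l i) (y, p)" if "k \<in> Basis" "l \<in> Basis" for k l
    by (rule locally_lip_compose[where g = fst and f = "\<lambda>y. \<Gamma> y k l i"])
       (use c[OF that] locally_lip_bounded_linear[OF bounded_linear_fst] in auto)
  have p: "locally_lip (\<lambda>z. snd z \<bullet> k) (y, p)" for k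
    by (intro locally_lip_bounded_linear bounded_linear_inner_left_comp bounded_linear_snd)
  have "locally_lip (\<lambda>z. \<Sum>k\<in>Basis. \<Sum>l\<in>Basis. (snd z \<bullet> k) * (snd z \<bullet> l) * \<Gamma> (fst z) k l i) (y, p)"
    by (intro locally_lip_sum locally_lip_mult p c')
  then show ?thesis
  proof (rule locally_lip_cong)
    show "open (Y \<times> (UNIV ::'e set))" by (intro open_Times open_Y open_UNIV)
    show "(\<Sum>k\<in>Basis. \<Sum>l\<in>Basis. (snd z \<bullet> k) * (snd z \<bullet> l) * \<Gamma> (fst z) k l i)
        = \<Gamma> (fst z) (snd z) (snd z) i" if "z \<in> Y \<times> UNIV" for z
      by (rule bilinear_expand[OF \<Gamma>_bilinear, symmetric]) (use that in auto)
  qed (use assms in auto)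
qed

text \<open>The finitely many coefficients of \<open>G\<close> in the basis share a Lipschitz
  constant, and bilinearity spreads it to all \<open>a\<close> and \<open>b\<close>.\<close>

lemma G_uniform:
  assumes "y0 \<in> Y"
  obtains r L where "r > 0" "cball y0 r \<subseteq> Y" "L \<ge> 0"
    "\<And>y z a b. y \<in> cball y0 r \<Longrightarrow> z \<in> cball y0 r \<Longrightarrow>
       \<bar>G y a b - G z a b\<bar> \<le> L * dist y z * norm a * norm b"
proof -
  obtain r0 where r0: "r0 > 0" "cball y0 r0 \<subseteq> Y" using open_Y assms open_contains_cball by blast
  obtain r K where r: "r > 0" "r \<le> r0" "K \<ge> 0"
    "\<And>i. i \<in> Basis \<times> Basis \<Longrightarrow> K-lipschitz_on (cball y0 r) (\<lambda>y. G y (fst i) (snd i))"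
    by (rule locally_lip_common[of "Basis \<times> (Basis ::'e set)" "\<lambda>i y. G y (fst i) (snd i)" y0 r0,
        OF _ G_locally_lip[OF assms] r0(1)]) auto
  have rY: "cball y0 r \<subseteq> Y" using r0 r by (meson subset_cball subset_trans)
  define L where "L = (\<Sum>i\<in>(Basis::'e set). \<Sum>j\<in>(Basis::'e set). K)"
  show ?thesis
  proof (rule that[OF r(1) rY, of L])
    show "L \<ge> 0" using r by (simp add: L_def sum_nonneg)
    fix y z a b assume yz: "y \<in> cball y0 r" "z \<in> cball y0 r"
    have K: "\<bar>G y i j - G z i j\<bar> \<le> K * dist y z" if "i \<in> Basis" "j \<in> Basis" for i j
      using lipschitz_onD[OF r(4)[of "(i, j)"] yz] that by (simp add: dist_real_def)
    have "G y a b - G z a b = (\<Sum>i\<in>Basis. \<Sum>j\<in>Basis. (a \<bullet> i) * (b \<bullet> j) * (G y i j - G z i j))"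
      using bilinear_expand[OF bilin, of y a b] bilinear_expand[OF bilin, of z a b] yz rY
      by (auto simp: subset_iff sum_subtractf right_diff_distrib)
    also have "\<bar>\<dots>\<bar> \<le> (\<Sum>i\<in>(Basis::'e set). \<Sum>j\<in>(Basis::'e set). norm a * norm b * (K * dist y z))"
    proof (intro order_trans[OF sum_abs] sum_mono)
      fix i j :: 'e assume "i \<in> Basis" "j \<in> Basis"
      then show "\<bar>(a \<bullet> i) * (b \<bullet> j) * (G y i j - G z i j)\<bar> \<le> norm a * norm b * (K * dist y z)"
        unfolding abs_mult by (intro mult_mono Basis_le_norm K) auto
    qed
    also have "\<dots> = L * dist y z * norm a * norm b"
      by (simp add: L_def algebra_simps)
    finally show "\<bar>G y a b - G z a b\<bar> \<le> L * dist y z * norm a * norm b" .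
  qed
qed

text \<open>At \<open>y0\<close> the quadratic form has a positive minimum on the compact unit
  sphere, and \<open>G_uniform\<close> carries half of it to nearby points.\<close>

lemma G_lower:
  assumes "y0 \<in> Y"
  obtains r m where "r > 0" "cball y0 r \<subseteq> Y" "m > 0"
    "\<And>y a. y \<in> cball y0 r \<Longrightarrow> m * (norm a)\<^sup>2 \<le> G y a a"
proof -
  obtain r L where r: "r > 0" "cball y0 r \<subseteq> Y" "L \<ge> 0"
    "\<And>y z a b. y \<in> cball y0 r \<Longrightarrow> z \<in> cball y0 r \<Longrightarrow>
       \<bar>G y a b - G z a b\<bar> \<le> L * dist y z * norm a * norm b"
    using G_uniform[OF assms] by metis
  have bb: "bounded_bilinear (G y0)"
    using bilin[OF assms] by (simp add: bilinear_conv_bounded_bilinear)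
  have "continuous_on (sphere 0 1) (\<lambda>a. G y0 a a)"
    by (intro bounded_bilinear.continuous_on[OF bb] continuous_intros)
  moreover have "sphere (0::'e) 1 \<noteq> {}"
    using vector_choose_size[of 1] by (metis mem_sphere_0 empty_iff zero_le_one)
  ultimately obtain a0 where a0: "a0 \<in> sphere 0 1" "\<And>a. a \<in> sphere 0 1 \<Longrightarrow> G y0 a0 a0 \<le> G y0 a a"
    using continuous_attains_inf[OF compact_sphere] by blast
  define m where "m = G y0 a0 a0"
  have m: "m > 0" using pos[OF assms, of a0] a0(1) unfolding m_def by (cases "a0 = 0") auto
  have low: "m * (norm a)\<^sup>2 \<le> G y0 a a" for a
  proof (cases "a = 0")
    case True
    then show ?thesis using bilinear_lzero[OF bilin[OF assms]] by simp
  next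
    case False
    have "G y0 (a /\<^sub>R norm a) (a /\<^sub>R norm a) = G y0 a a / (norm a)\<^sup>2"
      by (simp add: bilinear_lmul[OF bilin[OF assms]] bilinear_rmul[OF bilin[OF assms]]
        power2_eq_square field_simps)
    then have "G y0 a a = (norm a)\<^sup>2 * G y0 (a /\<^sub>R norm a) (a /\<^sub>R norm a)" using False by simp
    moreover have "m \<le> G y0 (a /\<^sub>R norm a) (a /\<^sub>R norm a)"
      using a0(2)[of "a /\<^sub>R norm a"] False by (simp add: m_def)
    ultimately show ?thesis by (metis mult.commute mult_left_mono zero_le_power2)
  qed
  \<comment> \<open>Small enough that moving the base point changes the quadratic form by at most
    half of its minimum.\<close>
  define s where "s = min r (m / (2 * (L + 1)))"
  have s: "s > 0" "s \<le> r" using r m by (auto simp: s_def)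
  have "L * s \<le> (L + 1) * (m / (2 * (L + 1)))" using r s by (intro mult_mono) (auto simp: s_def)
  moreover have "(L + 1) * (m / (2 * (L + 1))) = m / 2" using r by (simp add: field_simps)
  ultimately have Ls: "L * s \<le> m / 2" by linarith
  show ?thesis
  proof (rule that[of s "m / 2"])
    show "cball y0 s \<subseteq> Y" using r s by (meson subset_cball subset_trans)
    fix y a assume y: "y \<in> cball y0 s"
    have "\<bar>G y a a - G y0 a a\<bar> \<le> L * dist y y0 * norm a * norm a"
      by (rule r(4)) (use y s r(1) in auto)
    also have "\<dots> = (L * dist y y0) * (norm a)\<^sup>2" by (simp add: power2_eq_square)
    also have "\<dots> \<le> (L * s) * (norm a)\<^sup>2"
      using y r(3) by (intro mult_right_mono mult_left_mono) (auto simp: dist_commute)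
    also have "\<dots> \<le> m / 2 * (norm a)\<^sup>2" using Ls by (intro mult_right_mono) auto
    finally show "m / 2 * (norm a)\<^sup>2 \<le> G y a a" using low[of a] by linarith
  qed (use s m in auto)
qed

text \<open>The lower bound for \<open>G\<close> turns differences of the covectors \<open>G(q, \<cdot>)\<close> into differences of the
  accelerations \<open>q\<close>, so that no formula for the inverse of \<open>G\<close> is needed.\<close>

lemma acceleration_locally_lip:
  assumes "y0 \<in> Y"
  shows "locally_lip (\<lambda>z. acceleration (fst z) (snd z)) (y0, p0)"
proof -
  obtain r1 L where r1: "r1 > 0" "cball y0 r1 \<subseteq> Y" "L \<ge> 0"
    "\<And>y z a b. y \<in> cball y0 r1 \<Longrightarrow> z \<in> cball y0 r1 \<Longrightarrow>
       \<bar>G y a b - G z a b\<bar> \<le> L * dist y z * norm a * norm b"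
    using G_uniform[OF assms] by metis
  obtain r2 m where r2: "r2 > 0" "cball y0 r2 \<subseteq> Y" "m > 0"
    "\<And>y a. y \<in> cball y0 r2 \<Longrightarrow> m * (norm a)\<^sup>2 \<le> G y a a"
    using G_lower[OF assms] by metis
  define \<Gamma>' where "\<Gamma>' = (\<lambda>z w. \<Gamma> (fst z) (snd z) (snd z) w)"
  have "min r1 r2 > 0" using r1 r2 by simp
  have \<Gamma>ll: "locally_lip (\<lambda>z. \<Gamma>' z i) (y0, p0)" if "i \<in> Basis" for i
    unfolding \<Gamma>'_def by (rule \<Gamma>_locally_lip[OF assms that])
  obtain r K where r: "r > 0" "r \<le> min r1 r2" "K \<ge> 0"
    "\<And>i. i \<in> Basis \<Longrightarrow> K-lipschitz_on (cball (y0, p0) r) (\<lambda>z. \<Gamma>' z i)"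
    by (rule locally_lip_common[of "Basis ::'e set" "\<lambda>i z. \<Gamma>' z i" "(y0, p0)" "min r1 r2",
        OF finite_Basis \<Gamma>ll \<open>min r1 r2 > 0\<close>]) auto
  define S where "S = cball (y0, p0) r"
  have fst_S: "fst z \<in> cball y0 r1" "fst z \<in> cball y0 r2" "fst z \<in> Y" if "z \<in> S" for z
  proof -
    have "dist y0 (fst z) \<le> dist (y0, p0) z" using dist_fst_le[of "(y0, p0)" z] by simp
    then show "fst z \<in> cball y0 r1" "fst z \<in> cball y0 r2" using that r by (auto simp: S_def)
    then show "fst z \<in> Y" using r1 by blast
  qed
  \<comment> \<open>\<open>C\<close> bounds the covectors \<open>\<Gamma>' z\<close> for
    \<open>z\<close> in \<open>S\<close>; the constant \<open>D\<close> below is a Lipschitz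
    constant for them.\<close>
  define C where "C = (\<Sum>i\<in>Basis. \<bar>\<Gamma>' (y0, p0) i\<bar> + K * r)"
  have C: "C \<ge> 0" unfolding C_def using r by (intro sum_nonneg) auto
  have \<Gamma>exp: "\<Gamma>' z w = (\<Sum>i\<in>Basis. (w \<bullet> i) * \<Gamma>' z i)" if "z \<in> S" for z w
    unfolding \<Gamma>'_def by (subst linear_sum_Basis[OF \<Gamma>_linear[OF fst_S(3)[OF that]]]) simp
  have \<Gamma>0: "\<bar>\<Gamma>' z i\<bar> \<le> \<bar>\<Gamma>' (y0, p0) i\<bar> + K * r" if "z \<in> S" "i \<in> Basis" for z i
    using locally_lip_bounded[OF r(4)[OF that(2)], of z] that(1) by (simp add: S_def)
  have \<Gamma>bound: "\<bar>\<Gamma>' z w\<bar> \<le> C * norm w" if "z \<in> S" for z w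
  proof -
    have "\<bar>\<Sum>i\<in>Basis. (w \<bullet> i) * \<Gamma>' z i\<bar> \<le> (\<Sum>i\<in>Basis. norm w * (\<bar>\<Gamma>' (y0, p0) i\<bar> + K * r))"
    proof (intro order_trans[OF sum_abs] sum_mono)
      fix i :: 'e assume i: "i \<in> Basis"
      show "\<bar>(w \<bullet> i) * \<Gamma>' z i\<bar> \<le> norm w * (\<bar>\<Gamma>' (y0, p0) i\<bar> + K * r)"
        unfolding abs_mult by (intro mult_mono Basis_le_norm i \<Gamma>0 that) auto
    qed
    then show ?thesis unfolding \<Gamma>exp[OF that, of w, symmetric] C_def sum_distrib_left[symmetric]
      by (simp only: mult.commute)
  qed
  define D where "D = (\<Sum>i\<in>(Basis ::'e set). K)"
  have D: "D \<ge> 0" unfolding D_def using r by (intro sum_nonneg) auto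
  have \<Gamma>diff: "\<bar>\<Gamma>' x w - \<Gamma>' z w\<bar> \<le> D * dist x z * norm w" if "x \<in> S" "z \<in> S" for x z w
  proof -
    have "\<Gamma>' x w - \<Gamma>' z w = (\<Sum>i\<in>Basis. (w \<bullet> i) * \<Gamma>' x i) - (\<Sum>i\<in>Basis. (w \<bullet> i) * \<Gamma>' z i)"
      by (rule arg_cong2[OF \<Gamma>exp[OF that(1)] \<Gamma>exp[OF that(2)]])
    also have "\<dots> = (\<Sum>i\<in>Basis. (w \<bullet> i) * (\<Gamma>' x i - \<Gamma>' z i))"
      by (simp add: sum_subtractf right_diff_distrib)
    also have "\<bar>\<dots>\<bar> \<le> (\<Sum>i\<in>(Basis ::'e set). norm w * (K * dist x z))"
    proof (intro order_trans[OF sum_abs] sum_mono)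
      fix i :: 'e assume i: "i \<in> Basis"
      have "\<bar>\<Gamma>' x i - \<Gamma>' z i\<bar> \<le> K * dist x z"
        using lipschitz_onD[OF r(4)[OF i], of x z] that by (simp add: S_def dist_real_def)
      then show "\<bar>(w \<bullet> i) * (\<Gamma>' x i - \<Gamma>' z i)\<bar> \<le> norm w * (K * dist x z)"
        unfolding abs_mult by (intro mult_mono Basis_le_norm i) auto
    qed
    also have "\<dots> = D * dist x z * norm w" by (simp add: D_def algebra_simps)
    finally show ?thesis .
  qed
  define A where "A = (\<lambda>z. acceleration (fst z) (snd z))"
  have A: "G (fst z) (A z) w = - \<Gamma>' z w" if "z \<in> S" for z w
    using acceleration_iff[OF fst_S(3)[OF that], of "A z" "snd z"] unfolding A_def \<Gamma>'_def
    by (metis add_eq_0_iff2)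
  \<comment> \<open>The equation for the acceleration is tested against the acceleration
    itself.\<close>
  have Abound: "norm (A z) \<le> C / m" if z: "z \<in> S" for z
  proof -
    have "m * (norm (A z))\<^sup>2 \<le> C * norm (A z)"
      using r2(4)[OF fst_S(2)[OF z], of "A z"] A[OF z, of "A z"] \<Gamma>bound[OF z, of "A z"] by linarith
    then have "m * norm (A z) \<le> C \<or> norm (A z) = 0"
      by (simp add: power2_eq_square) (smt (verit, best) mult.assoc mult_right_le_imp_le norm_ge_zero norm_eq_zero mult_le_cancel_right)
    then show ?thesis using r2(3) C by (auto simp: field_simps)
  qed
  \<comment> \<open>The result of dividing the estimate of \<open>m * (norm w)\<^sup>2\<close> below
    by \<open>m * norm w\<close>; the summand \<open>L * (C / m)\<close> is the change of the metric
    acting on a bounded acceleration.\<close>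
  define M where "M = (D + L * (C / m)) / m"
  have M: "M \<ge> 0" using r1 r2 C D by (simp add: M_def)
  have "M-lipschitz_on S A"
  proof (rule lipschitz_onI[OF _ M])
    fix x z assume x: "x \<in> S" and z: "z \<in> S"
    define w where "w = A x - A z"
    note bl = bilinear_lsub[OF bilin[OF fst_S(3)[OF x]]]
    have "m * (norm w)\<^sup>2 \<le> G (fst x) w w" using r2(4)[OF fst_S(2)[OF x]] .
    also have "\<dots> = G (fst x) (A x) w - G (fst x) (A z) w" by (simp add: w_def bl)
    also have "\<dots> = - (\<Gamma>' x w - \<Gamma>' z w) - (G (fst x) (A z) w - G (fst z) (A z) w)"
      by (simp add: A[OF x] A[OF z])
    also have "\<dots> \<le> D * dist x z * norm w + L * dist (fst x) (fst z) * norm (A z) * norm w"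
      using \<Gamma>diff[OF x z, of w] r1(4)[OF fst_S(1)[OF x] fst_S(1)[OF z], of "A z" w] by linarith
    also have "\<dots> \<le> D * dist x z * norm w + L * dist x z * (C / m) * norm w"
      by (intro add_left_mono mult_right_mono mult_mono) (use Abound[OF z] r1 C r2 dist_fst_le[of x z] in auto)
    also have "\<dots> = (m * M * dist x z) * norm w" using r2(3) by (simp add: M_def field_simps)
    finally have "m * norm w * norm w \<le> (m * M * dist x z) * norm w"
      by (simp add: power2_eq_square mult.assoc)
    then have "norm w = 0 \<or> m * norm w \<le> m * M * dist x z"
      using mult_right_le_imp_le[of "m * norm w" "norm w" "m * M * dist x z"] by fastforce
    then have "norm w \<le> M * dist x z" using r2(3) M by (auto simp: mult.assoc)
    then show "dist (A x) (A z) \<le> M * dist x z" by (simp add: w_def dist_norm)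
  qed
  then show ?thesis unfolding S_def A_def using r(1) locally_lipI by blast
qed

text \<open>The geodesic equation as an autonomous first order system.\<close>

definition spray :: "'e \<times> 'e \<Rightarrow> 'e \<times> 'e" where
  "spray z = (snd z, acceleration (fst z) (snd z))"

lemma spray_locally_lip:
  assumes "fst z \<in> Y"
  shows "locally_lip spray z"
proof -
  have a: "locally_lip (\<lambda>z. acceleration (fst z) (snd z)) z"
    using acceleration_locally_lip[OF assms, of "snd z"] by simp
  have b: "locally_lip snd z" by (rule locally_lip_bounded_linear[OF bounded_linear_snd])
  obtain r L where r: "r > 0" "L-lipschitz_on (cball z r) snd"
    "L-lipschitz_on (cball z r) (\<lambda>z. acceleration (fst z) (snd z))"
    by (rule locally_lip_common2[OF b a]) blast
  show ?thesis unfolding spray_def using locally_lipI[OF r(1) lipschitz_on_Pair[OF r(2,3)]] .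
qed

text \<open>The uniformity in the velocity matters: near an accumulation point of a geodesic only a
  bound on its velocity is known. It comes from the compactness of the set of velocities of norm at
  most \<open>R\<close>.\<close>

lemma coordinate_geodesic_exists:
  assumes "y0 \<in> Y"
  obtains r e where "r > 0" "e > 0"
    "\<And>y p. y \<in> cball y0 r \<Longrightarrow> norm p \<le> R \<Longrightarrow> \<exists>u u'. u 0 = y \<and> u' 0 = p \<and> (\<forall>t\<in>{0..e}. u t \<in> Y \<and>
       (u has_vector_derivative u' t) (at t within {0..e}) \<and>
       (u' has_vector_derivative acceleration (u t) (u' t)) (at t within {0..e}))"
proof -
  have "compact ({y0} \<times> cball (0 ::'e) R)" by (intro compact_Times) auto
  moreover have "{y0} \<times> cball (0 ::'e) R \<subseteq> Y \<times> UNIV" using assms by auto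
  moreover have "open (Y \<times> (UNIV ::'e set))" by (intro open_Times open_Y open_UNIV)
  moreover have "locally_lip spray z" if "z \<in> {y0} \<times> cball 0 R" for z
    by (rule spray_locally_lip) (use that assms in auto)
  ultimately obtain r e where re: "r > 0" "e > 0"
    "\<And>z0 z1. z0 \<in> {y0} \<times> cball 0 R \<Longrightarrow> z1 \<in> cball z0 r \<Longrightarrow> \<exists>z. z 0 = z1 \<and>
     (\<forall>t\<in>{0..e}. z t \<in> Y \<times> UNIV \<and> (z has_vector_derivative spray (z t)) (at t within {0..e}))"
    using picard_compact[of "{y0} \<times> cball 0 R" "Y \<times> UNIV" spray thesis] by blast
  show ?thesis
  proof (rule that[OF re(1,2)])
    fix y p ::'e assume "y \<in> cball y0 r" "norm p \<le> R"
    then have "(y0, p) \<in> {y0} \<times> cball 0 R" "(y, p) \<in> cball (y0, p) r" by (auto simp: dist_Pair_Pair)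
    from re(3)[OF this] obtain z where z: "z 0 = (y, p)"
      "\<And>t. t \<in> {0..e} \<Longrightarrow> z t \<in> Y \<times> UNIV"
      "\<And>t. t \<in> {0..e} \<Longrightarrow> (z has_vector_derivative spray (z t)) (at t within {0..e})" by blast
    have "((\<lambda>t. fst (z t)) has_vector_derivative fst (spray (z t))) (at t within {0..e})"
      "((\<lambda>t. snd (z t)) has_vector_derivative snd (spray (z t))) (at t within {0..e})"
      if "t \<in> {0..e}" for t
      using bounded_linear.has_vector_derivative[OF bounded_linear_fst z(3)[OF that]]
        bounded_linear.has_vector_derivative[OF bounded_linear_snd z(3)[OF that]] by auto
    then show "\<exists>u u'. u 0 = y \<and> u' 0 = p \<and> (\<forall>t\<in>{0..e}. u t \<in> Y \<and>
       (u has_vector_derivative u' t) (at t within {0..e}) \<and>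
       (u' has_vector_derivative acceleration (u t) (u' t)) (at t within {0..e}))"
      using z by (intro exI[of _ "\<lambda>t. fst (z t)"] exI[of _ "\<lambda>t. snd (z t)"])
        (auto simp: spray_def mem_Times_iff)
  qed
qed

lemma coordinate_geodesic_unique:
  assumes "d0 > 0" "t0 \<in> {a..b}"
    and u: "\<And>t. t \<in> {a..b} \<Longrightarrow> \<bar>t - t0\<bar> < d0 \<Longrightarrow> u t \<in> Y \<and>
       (u has_vector_derivative u' t) (at t within {a..b}) \<and>
       (u' has_vector_derivative acceleration (u t) (u' t)) (at t within {a..b})"
    and v: "\<And>t. t \<in> {a..b} \<Longrightarrow> \<bar>t - t0\<bar> < d0 \<Longrightarrow> v t \<in> Y \<and>
       (v has_vector_derivative v' t) (at t within {a..b}) \<and>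
       (v' has_vector_derivative acceleration (v t) (v' t)) (at t within {a..b})"
    and eq: "u t0 = v t0" "u' t0 = v' t0"
  obtains d where "d > 0" "\<And>t. t \<in> {a..b} \<Longrightarrow> \<bar>t - t0\<bar> < d \<Longrightarrow> u t = v t \<and> u' t = v' t"
proof -
  define z w where "z = (\<lambda>t. (u t, u' t))" and "w = (\<lambda>t. (v t, v' t))"
  have z: "(z has_vector_derivative spray (z t)) (at t within {a..b})"
   and w: "(w has_vector_derivative spray (w t)) (at t within {a..b})"
    if "t \<in> {a..b}" "\<bar>t - t0\<bar> < d0" for t
    using u[OF that] v[OF that] unfolding z_def w_def spray_def
    by (auto intro: has_vector_derivative_Pair)
  have "fst (z t0) \<in> Y" using u[OF assms(2)] \<open>d0 > 0\<close> by (simp add: z_def)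
  then obtain r L where r: "r > 0" "L-lipschitz_on (cball (z t0) r) spray"
    using spray_locally_lip unfolding locally_lip_def by blast
  have L: "L \<ge> 0" using r lipschitz_on_nonneg by blast
  have wz: "w t0 = z t0" using eq by (simp add: z_def w_def)
  have "continuous (at t0 within {a..b}) z" "continuous (at t0 within {a..b}) w"
    using z w assms(1,2) has_vector_derivative_continuous by (metis abs_zero diff_self)+
  then obtain d1 d2 where d: "d1 > 0" "d2 > 0"
    "\<And>t. t \<in> {a..b} \<Longrightarrow> dist t t0 < d1 \<Longrightarrow> dist (z t) (z t0) < r"
    "\<And>t. t \<in> {a..b} \<Longrightarrow> dist t t0 < d2 \<Longrightarrow> dist (w t) (z t0) < r"
    unfolding continuous_within_eps_delta wz using r(1) by metis
  define c where "c = 1 / (2 * (L + 1))"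
  have c: "c > 0" using L by (simp add: c_def)
  \<comment> \<open>Within time \<open>e\<close> of \<open>t0\<close> both curves obey the equation
    and stay in the ball where \<open>spray\<close> is Lipschitz, and the bound \<open>c\<close>
    makes \<open>L * e\<close> at most one half.\<close>
  define e where "e = min (min d0 (min d1 d2)) c / 2"
  have e: "e > 0" "e < d0" "e < d1" "e < d2" "e \<le> c"
    using d assms(1) c unfolding e_def by auto
  have "L * e \<le> (L + 1) * (1 / (2 * (L + 1)))"
    using L e by (intro mult_mono) (auto simp: c_def)
  moreover have "(L + 1) * (1 / (2 * (L + 1))) = 1 / 2" using L by (simp add: field_simps)
  ultimately have Le: "L * e \<le> 1 / 2" by linarith
  define J where "J = {a..b} \<inter> cball t0 e"
  have J: "compact J" "convex J" "t0 \<in> J" "J \<subseteq> {a..b}"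
    using assms(2) e by (auto simp: J_def intro!: compact_Int_closed convex_Int)
  have J': "t \<in> {a..b}" "\<bar>t - t0\<bar> \<le> e" if "t \<in> J" for t
    using that by (auto simp: J_def dist_real_def)
  have "z t = w t" if "t \<in> J" for t
  proof (rule ode_unique_local[where z = z and w = w, OF J(1,2,3) _ r(2) _ _ _ _ wz[symmetric] that])
    fix s assume s: "s \<in> J"
    note s' = J'[OF s]
    have "L * \<bar>s - t0\<bar> \<le> L * e" using s' L by (intro mult_left_mono)
    then show "L * \<bar>s - t0\<bar> \<le> 1 / 2" using Le by linarith
    show "z s \<in> cball (z t0) r" "w s \<in> cball (z t0) r"
      using d(3,4)[of s] s' e by (auto simp: dist_commute dist_real_def less_imp_le)
    show "(z has_vector_derivative spray (z s)) (at s within J)"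
      "(w has_vector_derivative spray (w s)) (at s within J)"
      using z[of s] w[of s] s' e J(4) by (auto intro: has_vector_derivative_within_subset)
  qed
  then show ?thesis using that[OF e(1)] by (auto simp: J_def z_def w_def dist_real_def abs_minus_commute)
qed

end

section \<open>Charts and coordinate changes\<close>

lemma Ck_on_subset: "Ck_on k U F \<Longrightarrow> V \<subseteq> U \<Longrightarrow> Ck_on k V F"
  by (induction k arbitrary: F) (auto intro: continuous_on_subset differentiable_on_subset)

lemma Cinf_on_subset: "Cinf_on U F \<Longrightarrow> V \<subseteq> U \<Longrightarrow> open V \<Longrightarrow> Cinf_on V F"
  unfolding Cinf_on_def using Ck_on_subset by blast

lemma is_chart_subset: "is_chart X c \<Longrightarrow> fst c \<subseteq> topspace X"
  by (auto simp: is_chart_def dest: openin_subset)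

lemma is_chart_inj:
  assumes "is_chart X c"
  shows "inj_on (snd c) (fst c)"
proof -
  have "homeomorphic_map (subtopology X (fst c)) (top_of_set (snd c ` fst c)) (snd c)"
    using assms by (simp add: is_chart_def)
  from homeomorphic_imp_injective_map[OF this] show ?thesis
    using is_chart_subset[OF assms] by (simp add: Int_absorb1 inf_commute topspace_subtopology)
qed

lemma chart_inv_left: "inj_on (snd c) (fst c) \<Longrightarrow> x \<in> fst c \<Longrightarrow> chart_inv c (snd c x) = x"
  by (simp add: chart_inv_def)

lemma chart_inv_right: "y \<in> snd c ` fst c \<Longrightarrow> snd c (chart_inv c y) = y"
  by (simp add: chart_inv_def f_inv_into_f)

lemma chart_inv_in: "y \<in> snd c ` fst c \<Longrightarrow> chart_inv c y \<in> fst c"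
  by (simp add: chart_inv_def inv_into_into)

lemma is_chart_open_image:
  assumes "is_chart X c" "openin X W"
  shows "half_open (snd c ` (fst c \<inter> W))"
proof -
  have h: "homeomorphic_map (subtopology X (fst c)) (top_of_set (snd c ` fst c)) (snd c)"
    using assms by (simp add: is_chart_def)
  have "openin (subtopology X (fst c)) (fst c \<inter> W)"
    using assms by (auto simp: openin_subtopology)
  then have "openin (top_of_set (snd c ` fst c)) (snd c ` (fst c \<inter> W))"
    using homeomorphic_imp_open_map[OF h] by (simp add: open_map_def)
  then show ?thesis using assms(1) openin_trans by (auto simp: is_chart_def)
qed

lemma is_chart_continuous:
  assumes "is_chart X c"
  shows "continuous_map (subtopology X (fst c)) euclidean (snd c)"
proof -
  have "homeomorphic_map (subtopology X (fst c)) (top_of_set (snd c ` fst c)) (snd c)"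
    using assms by (simp add: is_chart_def)
  then show ?thesis
    using homeomorphic_imp_continuous_map continuous_map_in_subtopology by blast
qed

lemma is_chart_open_vimage:
  assumes "is_chart X c" "open V"
  shows "openin X {x \<in> fst c. snd c x \<in> V}"
proof -
  have "openin (subtopology X (fst c)) {x \<in> topspace (subtopology X (fst c)). snd c x \<in> V}"
    using openin_continuous_map_preimage[OF is_chart_continuous[OF assms(1)], of V] assms(2)
    by (simp flip: open_openin)
  moreover have "topspace (subtopology X (fst c)) = fst c"
    using is_chart_subset[OF assms(1)] by (auto simp: topspace_subtopology)
  ultimately show ?thesis using assms(1) openin_trans_full by (metis is_chart_def)
qed

lemma is_chart_inv_continuous:
  assumes "is_chart X c"
  shows "continuous_map (top_of_set (snd c ` fst c)) X (chart_inv c)"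
  unfolding continuous_map_def
proof (intro conjI allI impI)
  show "chart_inv c \<in> topspace (top_of_set (snd c ` fst c)) \<rightarrow> topspace X"
    using chart_inv_in[of _ c] is_chart_subset[OF assms] by (auto simp: Pi_def)
  fix W assume W: "openin X W"
  have h: "homeomorphic_map (subtopology X (fst c)) (top_of_set (snd c ` fst c)) (snd c)"
    using assms by (simp add: is_chart_def)
  have "openin (subtopology X (fst c)) (fst c \<inter> W)"
    using W by (auto simp: openin_subtopology)
  then have "openin (top_of_set (snd c ` fst c)) (snd c ` (fst c \<inter> W))"
    using homeomorphic_imp_open_map[OF h] by (simp add: open_map_def)
  moreover have "snd c ` (fst c \<inter> W) = {y \<in> snd c ` fst c. chart_inv c y \<in> W}"
    using chart_inv_left[OF is_chart_inj[OF assms]] by auto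
  ultimately show "openin (top_of_set (snd c ` fst c))
      {x \<in> topspace (top_of_set (snd c ` fst c)). chart_inv c x \<in> W}" by simp
qed

lemma transition_eq: "inj_on (snd c) (fst c) \<Longrightarrow> x \<in> fst c \<Longrightarrow> transition c d (snd c x) = snd d x"
  by (simp add: transition_def chart_inv_left)

lemma overlapI: "x \<in> fst c \<Longrightarrow> x \<in> fst d \<Longrightarrow> snd c x \<in> overlap c d"
  by (auto simp: overlap_def)

lemma overlap_iff:
  assumes "inj_on (snd c) (fst c)" "x \<in> fst c"
  shows "snd c x \<in> overlap c d \<longleftrightarrow> x \<in> fst d"
  using assms by (auto simp: overlap_def inj_on_def)

text \<open>The two charts may come from different atlases, so that transitions within
  \<open>M\<close>, within \<open>M'\<close> and between the two are treated alike.\<close>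

definition smooth_pair :: "('a, 'e::euclidean_space) chart \<Rightarrow> ('a, 'e) chart \<Rightarrow> bool" where
  "smooth_pair c d \<longleftrightarrow> inj_on (snd c) (fst c) \<and> inj_on (snd d) (fst d) \<and>
     smooth_on (overlap c d) (transition c d) \<and> smooth_on (overlap d c) (transition d c)"

lemma smooth_pair_sym: "smooth_pair c d \<Longrightarrow> smooth_pair d c"
  by (auto simp: smooth_pair_def)

lemma coord_change_works:
  assumes "smooth_pair c d" "x \<in> fst c" "x \<in> fst d"
  shows "(transition c d has_derivative coord_change c d x) (at (snd c x) within overlap c d)"
  using smooth_on_differentiable[of "overlap c d" "transition c d" "snd c x"] assms
  by (simp add: smooth_pair_def coord_change_def overlapI frechet_derivative_works)

lemma coord_change_linear:
  assumes "smooth_pair c d" "x \<in> fst c" "x \<in> fst d"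
  shows "linear (coord_change c d x)"
  using coord_change_works[OF assms] has_derivative_bounded_linear bounded_linear.linear by blast

text \<open>The chain rule on the triple overlap, which is relatively open, so that derivatives
  there are unique even at boundary points.\<close>

lemma coord_change_cocycle:
  assumes cd: "smooth_pair c d" "half_open (overlap c d)"
    and ce: "smooth_pair c e" "half_open (overlap c e)"
    and de: "smooth_pair d e"
    and x: "x \<in> fst c" "x \<in> fst d" "x \<in> fst e"
  shows "coord_change d e x (coord_change c d x v) = coord_change c e x v"
proof -
  define Y where "Y = overlap c d \<inter> overlap c e"
  have Y: "half_open Y" "snd c x \<in> Y"
    using cd ce x by (auto simp: Y_def intro: overlapI)
  have inj: "inj_on (snd c) (fst c)" "inj_on (snd d) (fst d)" using cd(1) by (auto simp: smooth_pair_def)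
  have YE: "\<exists>z. y = snd c z \<and> z \<in> fst c \<and> z \<in> fst d \<and> z \<in> fst e" if "y \<in> Y" for y
    using that inj(1) by (auto simp: Y_def overlap_def inj_on_def)
  have im: "transition c d ` Y \<subseteq> overlap d e"
    using YE inj by (fastforce simp: transition_eq intro: overlapI)
  have "(transition c d has_derivative coord_change c d x) (at (snd c x) within Y)"
    using coord_change_works[OF cd(1) x(1,2)] by (rule has_derivative_subset) (auto simp: Y_def)
  moreover have "(transition d e has_derivative coord_change d e x)
      (at (transition c d (snd c x)) within transition c d ` Y)"
    using has_derivative_subset[OF coord_change_works[OF de x(2,3)] im] x inj by (simp add: transition_eq)
  ultimately have "((\<lambda>y. transition d e (transition c d y)) has_derivative
      (\<lambda>v. coord_change d e x (coord_change c d x v))) (at (snd c x) within Y)"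
    by (rule has_derivative_in_compose)
  then have "(transition c e has_derivative
      (\<lambda>v. coord_change d e x (coord_change c d x v))) (at (snd c x) within Y)"
  proof (rule has_derivative_transform[OF Y(2), rotated])
    fix y assume "y \<in> Y"
    then show "transition c e y = transition d e (transition c d y)"
      using YE[of y] inj by (auto simp: transition_eq)
  qed
  moreover have "(transition c e has_derivative coord_change c e x) (at (snd c x) within Y)"
    using coord_change_works[OF ce(1) x(1,3)] by (rule has_derivative_subset) (auto simp: Y_def)
  ultimately show ?thesis using half_open_derivative_unique[OF Y] by metis
qed

lemma coord_change_self:
  assumes "smooth_pair c c" "half_open (overlap c c)" "x \<in> fst c"
  shows "coord_change c c x v = v"
proof -
  have "(transition c c has_derivative (\<lambda>v. v)) (at (snd c x) within overlap c c)"
    by (rule has_derivative_transform[OF _ _ has_derivative_ident])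
       (use assms in \<open>auto simp: overlap_def transition_eq smooth_pair_def\<close>)
  then show ?thesis
    using half_open_derivative_unique[OF assms(2) _ coord_change_works[OF assms(1,3,3)]]
      overlapI[OF assms(3,3)] by metis
qed

text \<open>\<open>F\<close> is a smooth extension of the transition map to an open set. At boundary
  points the overlap is not open, and derivatives of \<open>F\<close> replace one-sided
  ones.\<close>

definition chart_map :: "('a, 'e::euclidean_space) chart \<Rightarrow> ('a, 'e) chart \<Rightarrow> 'a \<Rightarrow> 'e set \<Rightarrow> ('e \<Rightarrow> 'e) \<Rightarrow> bool" where
  "chart_map c d x U F \<longleftrightarrow> Cinf_on U F \<and> snd c x \<in> U \<and>
     (\<forall>z. z \<in> fst c \<longrightarrow> z \<in> fst d \<longrightarrow> snd c z \<in> U \<longrightarrow> F (snd c z) = snd d z)"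

lemma chart_map_ex:
  assumes "smooth_pair c d" "x \<in> fst c" "x \<in> fst d"
  obtains U F where "chart_map c d x U F"
proof -
  have "smooth_on (overlap c d) (transition c d)" "inj_on (snd c) (fst c)"
    using assms by (auto simp: smooth_pair_def)
  from smooth_onE[OF this(1) overlapI[OF assms(2,3)]] obtain U F where
    "Cinf_on U F" "snd c x \<in> U" "\<And>z. z \<in> overlap c d \<Longrightarrow> z \<in> U \<Longrightarrow> F z = transition c d z" by metis
  then have "chart_map c d x U F"
    using \<open>inj_on (snd c) (fst c)\<close> by (auto simp: chart_map_def overlapI transition_eq)
  then show ?thesis using that by blast
qed

lemma coord_change_eq_d1:
  assumes "smooth_pair c d" "half_open (overlap c d)" "chart_map c d x U F"
    "z \<in> fst c" "z \<in> fst d" "snd c z \<in> U"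
  shows "coord_change c d z = d1 F (snd c z)"
proof (rule half_open_derivative_unique[OF assms(2) overlapI[OF assms(4,5)]])
  show "(transition c d has_derivative coord_change c d z) (at (snd c z) within overlap c d)"
    using coord_change_works[OF assms(1,4,5)] .
  show "(transition c d has_derivative d1 F (snd c z)) (at (snd c z) within overlap c d)"
  proof (rule has_derivative_extension[of U])
    show "F y = transition c d y" if "y \<in> overlap c d" "y \<in> U" for y
      using that assms(1,3) by (auto simp: overlap_def chart_map_def smooth_pair_def transition_eq)
  qed (use assms in \<open>auto simp: chart_map_def intro: overlapI\<close>)
qed

text \<open>For a chart \<open>c\<close> of \<open>M\<close> and a chart \<open>d\<close> of
  \<open>M'\<close>, the set \<open>overlap d c\<close> may lie on one side of the image of the
  boundary, so derivatives are compared on \<open>overlap c d\<close>: there an extension of the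
  reverse transition, composed with the transition, is the identity.\<close>

lemma chart_map_inverse:
  assumes "smooth_pair c d" "half_open (overlap c d)" "x \<in> fst c" "x \<in> fst d"
    and H: "chart_map d c x V H"
  shows "d1 H (snd d x) (coord_change c d x v) = v"
proof -
  have inj: "inj_on (snd c) (fst c)" "inj_on (snd d) (fst d)" using assms(1) by (auto simp: smooth_pair_def)
  have H': "Cinf_on V H" "snd d x \<in> V" using H by (auto simp: chart_map_def)
  have y: "snd c x \<in> overlap c d" using assms by (auto intro: overlapI)
  have tx: "transition c d (snd c x) = snd d x" using inj assms by (simp add: transition_eq)
  have T: "(transition c d has_derivative coord_change c d x) (at (snd c x) within overlap c d)"
    using coord_change_works[OF assms(1,3,4)] .
  have "(H has_derivative d1 H (snd d x)) (at (transition c d (snd c x)))"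
    using Cinf_on_d1[OF H'] by (simp add: tx)
  from has_derivative_compose[OF T this]
  have D: "((\<lambda>y. H (transition c d y)) has_derivative (\<lambda>v. d1 H (snd d x) (coord_change c d x v)))
      (at (snd c x) within overlap c d)" .
  have "continuous (at (snd c x) within overlap c d) (transition c d)"
    using T has_derivative_continuous by blast
  then have "\<forall>\<^sub>F y in at (snd c x) within overlap c d. transition c d y \<in> V"
    using H'(2) Cinf_on_open[OF H'(1)] tx unfolding continuous_within by (metis topological_tendstoD)
  moreover have "\<forall>\<^sub>F y in at (snd c x) within overlap c d. y \<in> overlap c d"
    by (simp add: eventually_at_filter)
  ultimately have "\<forall>\<^sub>F y in at (snd c x) within overlap c d. H (transition c d y) = y"
  proof eventually_elim
    case (elim y)
    then obtain z where "y = snd c z" "z \<in> fst c" "z \<in> fst d" by (auto simp: overlap_def)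
    then show ?case using elim H inj by (simp add: chart_map_def transition_eq)
  qed
  moreover have "H (transition c d (snd c x)) = snd c x"
    using H assms tx by (simp add: chart_map_def)
  ultimately have "((\<lambda>y. y) has_derivative (\<lambda>v. d1 H (snd d x) (coord_change c d x v)))
      (at (snd c x) within overlap c d)"
    by (intro has_derivative_transform_eventually[OF D _ _ y]) auto
  then have "(\<lambda>v. d1 H (snd d x) (coord_change c d x v)) = (\<lambda>v. v)"
    by (rule half_open_derivative_unique[OF assms(2) y _ has_derivative_ident])
  then show ?thesis by metis
qed

lemma coord_change_bij:
  assumes "smooth_pair c d" "half_open (overlap c d)" "x \<in> fst c" "x \<in> fst d"
  shows "bij (coord_change c d x)"
proof -
  obtain V H where "chart_map d c x V H"
    using chart_map_ex[OF smooth_pair_sym[OF assms(1)] assms(4,3)] .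
  then have "inj (coord_change c d x)"
    using chart_map_inverse[OF assms] by (metis injI)
  then show ?thesis
    using coord_change_linear[OF assms(1,3,4)] linear_injective_imp_surjective by (auto simp: bij_def)
qed

section \<open>Curves\<close>

text \<open>All conditions on a curve \<open>\<gamma>\<close> on \<open>J\<close> near a time \<open>t\<close> are phrased with \<open>nhds t\<close> and \<open>principal J\<close>,
  that is, \<open>at t within J\<close> with \<open>t\<close> itself included.\<close>

abbreviation near :: "real \<Rightarrow> real set \<Rightarrow> real filter" where
  "near t J \<equiv> inf (nhds t) (principal J)"

lemma eventually_near: "eventually P (near t J) \<longleftrightarrow> (\<exists>e>0. \<forall>s\<in>J. \<bar>s - t\<bar> < e \<longrightarrow> P s)"
  unfolding eventually_inf_principal eventually_nhds_metric dist_real_def by blast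

lemma eventually_near_eventually:
  assumes "eventually P (near t J)"
  shows "eventually (\<lambda>s. eventually P (near s J)) (near t J)"
proof -
  obtain e where e: "e > 0" "\<And>s. s \<in> J \<Longrightarrow> \<bar>s - t\<bar> < e \<Longrightarrow> P s" using assms(1) unfolding eventually_near by blast
  have "eventually P (near s J)" if "s \<in> J" "\<bar>s - t\<bar> < e / 2" for s
  proof -
    have "P r" if "r \<in> J" "\<bar>r - s\<bar> < e / 2" for r
      by (rule e(2)) (use that \<open>\<bar>s - t\<bar> < e / 2\<close> in linarith)+
    then show ?thesis unfolding eventually_near using e(1) half_gt_zero by blast
  qed
  then show ?thesis unfolding eventually_near[where P = "\<lambda>s. eventually P (near s J)"]
    using e(1) half_gt_zero by blast
qed

lemma eventually_nearD: "eventually P (near t J) \<Longrightarrow> t \<in> J \<Longrightarrow> P t"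
  unfolding eventually_near by (metis abs_zero diff_self)

lemma has_vector_derivative_near_cong:
  assumes "eventually (\<lambda>s. f s = h s) (near t J)" "t \<in> J" "(f has_vector_derivative p) (at t within J)"
  shows "(h has_vector_derivative p) (at t within J)"
proof -
  obtain e where e: "e > 0" "\<And>s. s \<in> J \<Longrightarrow> \<bar>s - t\<bar> < e \<Longrightarrow> f s = h s" using assms(1) unfolding eventually_near by blast
  show ?thesis
    by (rule has_vector_derivative_transform_within[OF assms(3) e(1) assms(2)])
       (use e(2) in \<open>auto simp: dist_real_def abs_minus_commute\<close>)
qed

text \<open>An interval with interior has no isolated points; this makes one-sided derivatives at
  its ends unique.\<close>

lemma interval_at_within_nontrivial:
  fixes J :: "real set"
  assumes "is_interval J" "interior J \<noteq> {}" "t \<in> J"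
  shows "at t within J \<noteq> bot"
proof -
  have "J \<noteq> {t}" using assms(2) by auto
  moreover have "connected J" using assms(1) is_interval_connected by blast
  ultimately have "t islimpt J" using connected_imp_perfect[of J t] assms(3) by auto
  then show ?thesis by (simp add: trivial_limit_within)
qed

lemma interval_vector_derivative_unique:
  fixes J :: "real set"
  assumes "is_interval J" "interior J \<noteq> {}" "t \<in> J"
    "(f has_vector_derivative p) (at t within J)" "(f has_vector_derivative q) (at t within J)"
  shows "p = q"
  using vector_derivative_unique_within[OF interval_at_within_nontrivial[OF assms(1-3)] assms(4,5)] .

lemma interval_vector_derivative_eq:
  fixes J :: "real set"
  assumes "is_interval J" "interior J \<noteq> {}" "t \<in> J" "(f has_vector_derivative p) (at t within J)"
  shows "vector_derivative f (at t within J) = p"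
  using vector_derivative_within[OF interval_at_within_nontrivial[OF assms(1-3)] assms(4)] .

lemma continuous_map_near:
  assumes "continuous_map (top_of_set J) X \<gamma>" "t \<in> J" "openin X W" "\<gamma> t \<in> W"
  shows "eventually (\<lambda>s. \<gamma> s \<in> W) (near t J)"
proof -
  have "openin (top_of_set J) {s \<in> J. \<gamma> s \<in> W}"
    using openin_continuous_map_preimage[OF assms(1,3)] by simp
  then obtain e where "e > 0" "\<And>s. s \<in> J \<Longrightarrow> dist s t < e \<Longrightarrow> s \<in> {s \<in> J. \<gamma> s \<in> W}"
    unfolding openin_euclidean_subtopology_iff using assms(2,4) by blast
  then show ?thesis unfolding eventually_near by (auto simp: dist_real_def)
qed

lemma has_vector_derivative_compose_d1:
  assumes "Cinf_on U F" "u t \<in> U" "(u has_vector_derivative p) (at t within J)"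
  shows "((\<lambda>s. F (u s)) has_vector_derivative d1 F (u t) p) (at t within J)"
  using has_derivative_compose[OF assms(3)[unfolded has_vector_derivative_def] Cinf_on_d1[OF assms(1,2)]]
    linear_cmul[OF Cinf_on_linear_d1[OF assms(1,2)]]
  by (simp add: has_vector_derivative_def)

lemma chart_map_velocity:
  assumes F: "chart_map c d x U F" "snd c (\<gamma> t) \<in> U" and t: "t \<in> J"
    and ev: "eventually (\<lambda>s. \<gamma> s \<in> fst c \<and> \<gamma> s \<in> fst d) (near t J)"
    and p: "((snd c \<circ> \<gamma>) has_vector_derivative p) (at t within J)"
  shows "((snd d \<circ> \<gamma>) has_vector_derivative d1 F (snd c (\<gamma> t)) p) (at t within J)"
    and "eventually (\<lambda>s. snd c (\<gamma> s) \<in> U) (near t J)"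
proof -
  have F': "Cinf_on U F" using F by (simp add: chart_map_def)
  have cont: "continuous (at t within J) (snd c \<circ> \<gamma>)"
    using p has_vector_derivative_continuous by blast
  then have "((snd c \<circ> \<gamma>) \<longlongrightarrow> snd c (\<gamma> t)) (at t within J)" by (simp add: continuous_within)
  then have "eventually (\<lambda>s. (snd c \<circ> \<gamma>) s \<in> U) (at t within J)"
    using Cinf_on_open[OF F'] F(2) topological_tendstoD by blast
  then have "eventually (\<lambda>s. s \<noteq> t \<longrightarrow> s \<in> J \<longrightarrow> snd c (\<gamma> s) \<in> U) (nhds t)"
    by (simp add: eventually_at_filter)
  then have "eventually (\<lambda>s. s \<in> J \<longrightarrow> snd c (\<gamma> s) \<in> U) (nhds t)"
    by eventually_elim (use F(2) in auto)
  then show *: "eventually (\<lambda>s. snd c (\<gamma> s) \<in> U) (near t J)"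
    by (simp add: eventually_inf_principal)
  have "((\<lambda>s. F ((snd c \<circ> \<gamma>) s)) has_vector_derivative d1 F ((snd c \<circ> \<gamma>) t) p) (at t within J)"
    by (rule has_vector_derivative_compose_d1[OF F' _ p]) (use F in simp)
  moreover have "eventually (\<lambda>s. F ((snd c \<circ> \<gamma>) s) = (snd d \<circ> \<gamma>) s) (near t J)"
    using * ev by eventually_elim (use F in \<open>auto simp: chart_map_def\<close>)
  ultimately show "((snd d \<circ> \<gamma>) has_vector_derivative d1 F (snd c (\<gamma> t)) p) (at t within J)"
    using has_vector_derivative_near_cong t by fastforce
qed

text \<open>\<open>p\<close> has to be the velocity at all times near \<open>t\<close>, as its own
  derivative is taken at \<open>t\<close>. Being local in time, the condition can be moved from one
  chart to another.\<close>

definition second_order :: "('a, 'e::euclidean_space) chart \<Rightarrow> real set \<Rightarrow> (real \<Rightarrow> 'a) \<Rightarrow> real \<Rightarrow> (real \<Rightarrow> 'e) \<Rightarrow> 'e \<Rightarrow> bool" where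
  "second_order c J \<gamma> t p q \<longleftrightarrow>
     eventually (\<lambda>s. \<gamma> s \<in> fst c \<and> ((snd c \<circ> \<gamma>) has_vector_derivative p s) (at s within J)) (near t J) \<and>
     (p has_vector_derivative q) (at t within J)"

lemma second_orderD:
  assumes "second_order c J \<gamma> t p q" "t \<in> J"
  shows "\<gamma> t \<in> fst c" "((snd c \<circ> \<gamma>) has_vector_derivative p t) (at t within J)"
    "(p has_vector_derivative q) (at t within J)"
  using assms by (auto simp: second_order_def dest: eventually_nearD)

text \<open>By the chain rule the acceleration of the composite with \<open>F\<close> is exactly the
  vector that occurs in \<open>geodesic_equation_transform\<close>.\<close>

lemma chart_map_second_order:
  assumes F: "chart_map c d x U F" "snd c (\<gamma> t) \<in> U" and t: "t \<in> J"
    and ev: "eventually (\<lambda>s. \<gamma> s \<in> fst d) (near t J)"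
    and so: "second_order c J \<gamma> t p q"
  shows "second_order d J \<gamma> t (\<lambda>s. d1 F (snd c (\<gamma> s)) (p s))
    (d2 F (snd c (\<gamma> t)) (p t) (p t) + d1 F (snd c (\<gamma> t)) q)"
proof -
  have F': "Cinf_on U F" using F by (simp add: chart_map_def)
  note soD = second_orderD[OF so t]
  have ev2: "eventually (\<lambda>s. \<gamma> s \<in> fst c \<and> \<gamma> s \<in> fst d) (near t J)"
    using ev so unfolding second_order_def by (auto elim: eventually_elim2)
  have evU: "eventually (\<lambda>s. snd c (\<gamma> s) \<in> U) (near t J)"
    by (rule chart_map_velocity(2)[OF F t ev2 soD(2)])
  have "eventually (\<lambda>s. s \<in> J) (near t J)" by (simp add: eventually_inf_principal)
  with eventually_near_eventually[OF ev2] evU so[unfolded second_order_def, THEN conjunct1] ev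
  have 1: "eventually (\<lambda>s. \<gamma> s \<in> fst d \<and>
     ((snd d \<circ> \<gamma>) has_vector_derivative d1 F (snd c (\<gamma> s)) (p s)) (at s within J)) (near t J)"
  proof eventually_elim
    case (elim s)
    then show ?case using chart_map_velocity(1)[of c d x U F \<gamma> s J "p s"] F(1) by blast
  qed
  let ?u = "snd c \<circ> \<gamma>"
  have ui: "((\<lambda>s. d1 F (?u s) i) has_vector_derivative d2 F (?u t) (p t) i) (at t within J)" for i
  proof -
    have "((\<lambda>z. d1 F z i) has_derivative (\<lambda>a. d2 F (?u t) a i)) (at (?u t))"
      by (rule Cinf_on_d2[OF F']) (use F in simp)
    from has_derivative_compose[OF soD(2)[unfolded has_vector_derivative_def] this]
    show ?thesis using linear_cmul[OF Cinf_on_linear_d2[OF F' F(2)]]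
      by (simp add: has_vector_derivative_def)
  qed
  have "((\<lambda>s. p s \<bullet> i) has_vector_derivative q \<bullet> i) (at t within J)" for i
    using bounded_linear.has_vector_derivative[OF bounded_linear_inner_left soD(3)] .
  \<comment> \<open>Both the base point and the direction in \<open>d1 F\<close> move with time, so
    the direction is expanded in the basis and the product rule is applied to each term.\<close>
  then have "((\<lambda>s. \<Sum>i\<in>Basis. (p s \<bullet> i) *\<^sub>R d1 F (?u s) i) has_vector_derivative
     (\<Sum>i\<in>Basis. (p t \<bullet> i) *\<^sub>R d2 F (?u t) (p t) i + (q \<bullet> i) *\<^sub>R d1 F (?u t) i)) (at t within J)"
    by (intro has_vector_derivative_sum has_vector_derivative_scaleR ui)
       (simp add: has_real_derivative_iff_has_vector_derivative)
  moreover have "(\<Sum>i\<in>Basis. (p t \<bullet> i) *\<^sub>R d2 F (?u t) (p t) i + (q \<bullet> i) *\<^sub>R d1 F (?u t) i)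
     = d2 F (?u t) (p t) (p t) + d1 F (?u t) q"
  proof -
    have "linear (d2 F (?u t) (p t))"
    proof -
      have "d2 F (?u t) (p t) = (\<lambda>b. d2 F (?u t) b (p t))"
        using d2_symmetric[OF F'] F(2) by (auto simp: fun_eq_iff)
      then show ?thesis using Cinf_on_linear_d2[OF F', of "?u t" "p t"] F(2) by simp
    qed
    from linear_sum_Basis[OF this, of "p t"] linear_sum_Basis[OF Cinf_on_linear_d1[OF F' F(2)], of q]
    show ?thesis by (simp add: sum.distrib)
  qed
  ultimately have "((\<lambda>s. \<Sum>i\<in>Basis. (p s \<bullet> i) *\<^sub>R d1 F (?u s) i) has_vector_derivative
     d2 F (?u t) (p t) (p t) + d1 F (?u t) q) (at t within J)" by simp
  then have 2: "((\<lambda>s. d1 F (?u s) (p s)) has_vector_derivative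
     d2 F (?u t) (p t) (p t) + d1 F (?u t) q) (at t within J)"
  proof (rule has_vector_derivative_near_cong[OF _ t, rotated])
    show "eventually (\<lambda>s. (\<Sum>i\<in>Basis. (p s \<bullet> i) *\<^sub>R d1 F (?u s) i) = d1 F (?u s) (p s)) (near t J)"
      using evU by eventually_elim (metis comp_apply linear_sum_Basis[OF Cinf_on_linear_d1[OF F']])
  qed
  show ?thesis using 1 2 by (simp add: second_order_def)
qed

section \<open>Geodesics of a manifold and of an extension\<close>

text \<open>Local in time and in one chart, whereas \<open>geodesic_on\<close> asks for one velocity
  and one acceleration function for all times spent in a chart.\<close>

definition geodesic_at ::
  "('a, 'e::euclidean_space) manifold \<Rightarrow> ('a, 'e) metric \<Rightarrow> ('a, 'e) chart \<Rightarrow> real set \<Rightarrow> (real \<Rightarrow> 'a) \<Rightarrow> real \<Rightarrow> bool"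
  where
  "geodesic_at M g c J \<gamma> t \<longleftrightarrow> (\<exists>p q. second_order c J \<gamma> t p q \<and>
     (\<forall>w. metric_in_chart M g c (snd c (\<gamma> t)) q w
           + christoffel M g c (snd c (\<gamma> t)) (p t) (p t) w = 0))"

locale extension =
  fixes M M' :: "('a, 'e::euclidean_space) manifold" and g g' :: "('a, 'e) metric"
  assumes riem: "riemannian_manifold M g" and embedded: "is_extension M g M' g'"
begin

lemma riem': "riemannian_manifold M' g'" and no_bd: "mboundary M' = {}"
  and points_sub: "points M \<subseteq> points M'" and top_eq: "mtop M = subtopology (mtop M') (points M)"
  using embedded unfolding is_extension_def by blast+

lemma smooth: "smooth_manifold M" "smooth_manifold M'"
  using riem riem' by (auto simp: riemannian_manifold_def)

lemma chart: "c \<in> atlas M \<Longrightarrow> is_chart (mtop M) c" and chart': "c \<in> atlas M' \<Longrightarrow> is_chart (mtop M') c"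
  using smooth by (auto simp: smooth_manifold_def)

lemma chart_inj: "c \<in> atlas M \<union> atlas M' \<Longrightarrow> inj_on (snd c) (fst c)"
  using chart chart' is_chart_inj by blast

lemma chart_open: "c \<in> atlas M \<Longrightarrow> openin (mtop M) (fst c)"
  and chart_open': "c \<in> atlas M' \<Longrightarrow> openin (mtop M') (fst c)"
  using chart chart' by (auto simp: is_chart_def)

lemma chart_sub: "c \<in> atlas M \<Longrightarrow> fst c \<subseteq> points M"
  using chart is_chart_subset by blast

lemma chart_at: assumes "x \<in> points M" shows "chart_at M x \<in> atlas M" "x \<in> fst (chart_at M x)"
proof -
  have "\<exists>c. c \<in> atlas M \<and> x \<in> fst c" using assms smooth by (auto simp: smooth_manifold_def)
  from someI_ex[OF this] show "chart_at M x \<in> atlas M" "x \<in> fst (chart_at M x)"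
    by (auto simp: chart_at_def)
qed

lemma chart_at': assumes "x \<in> points M'" shows "chart_at M' x \<in> atlas M'" "x \<in> fst (chart_at M' x)"
proof -
  have "\<exists>c. c \<in> atlas M' \<and> x \<in> fst c" using assms smooth by (auto simp: smooth_manifold_def)
  from someI_ex[OF this] show "chart_at M' x \<in> atlas M'" "x \<in> fst (chart_at M' x)"
    by (auto simp: chart_at_def)
qed

lemma half_image: "c \<in> atlas M \<union> atlas M' \<Longrightarrow> half_open (snd c ` fst c)"
  using chart chart' by (auto simp: is_chart_def)

text \<open>Without boundary points no coordinate vector lies on the edge of the half-space, and
  away from the edge relative openness is openness.\<close>

lemma open_image':
  assumes "c \<in> atlas M'"
  shows "open (snd c ` fst c)"
proof -
  obtain T where T: "open T" "snd c ` fst c = halfspace \<inter> T"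
    using half_image assms by (metis UnCI openin_open)
  have "y \<bullet> e_normal \<noteq> 0" if "y \<in> snd c ` fst c" for y
    using that no_bd assms by (auto simp: mboundary_def)
  then have "snd c ` fst c = {y. 0 < y \<bullet> e_normal} \<inter> T"
    using T(2) by (fastforce simp: halfspace_def order_le_less)
  moreover have "open {y :: 'e. 0 < y \<bullet> e_normal}" by (intro open_Collect_less continuous_intros)
  ultimately show ?thesis using T(1) by (metis open_Int)
qed

lemma pair: "c \<in> atlas M \<union> atlas M' \<Longrightarrow> d \<in> atlas M \<union> atlas M' \<Longrightarrow> smooth_pair c d"
proof -
  have 1: "\<forall>c\<in>atlas M. \<forall>d\<in>atlas M. smooth_on (overlap c d) (transition c d)"
    "\<forall>c\<in>atlas M'. \<forall>d\<in>atlas M'. smooth_on (overlap c d) (transition c d)"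
    using smooth unfolding smooth_manifold_def by simp_all
  have 2: "\<forall>c\<in>atlas M. \<forall>d\<in>atlas M'.
    smooth_on (overlap c d) (transition c d) \<and> smooth_on (overlap d c) (transition d c)"
    using embedded unfolding is_extension_def by simp
  assume "c \<in> atlas M \<union> atlas M'" "d \<in> atlas M \<union> atlas M'"
  then show ?thesis using 1 2 chart_inj unfolding smooth_pair_def by (elim UnE) simp_all
qed

text \<open>The roles of \<open>c\<close> and \<open>d\<close> are not symmetric: seen in a chart of
  \<open>M'\<close>, a piece of \<open>M\<close> that meets the boundary need not be relatively
  open.\<close>

lemma half_overlap: assumes "c \<in> atlas M" "d \<in> atlas M \<union> atlas M'" shows "half_open (overlap c d)"
proof -
  have "openin (mtop M) (fst d \<inter> points M)"
  proof (cases "d \<in> atlas M")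
    case True
    then show ?thesis using chart_open by blast
  next
    case False
    then have "openin (mtop M') (fst d)" using assms(2) chart_open' by blast
    then show ?thesis by (subst top_eq) (rule openin_subtopology_Int)
  qed
  from is_chart_open_image[OF chart[OF assms(1)] this]
  have "half_open (snd c ` (fst c \<inter> (fst d \<inter> points M)))" .
  moreover have "fst c \<inter> (fst d \<inter> points M) = fst c \<inter> fst d" using chart_sub[OF assms(1)] by blast
  ultimately show ?thesis by (simp add: overlap_def)
qed

lemma half_overlap': assumes "c \<in> atlas M'" "d \<in> atlas M'" shows "half_open (overlap c d)"
  using is_chart_open_image[OF chart'[OF assms(1)] chart_open'[OF assms(2)]] by (simp add: overlap_def)

lemma metric_in_chart_eq:
  "c \<in> atlas M \<union> atlas M' \<Longrightarrow> x \<in> fst c \<Longrightarrow> metric_in_chart N h c (snd c x) a b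
    = h x (coord_change c (chart_at N x) x a) (coord_change c (chart_at N x) x b)"
  using chart_inj by (simp add: metric_in_chart_def Let_def chart_inv_left)

text \<open>\<open>is_extension\<close> relates the two metrics in the preferred charts; the cocycle
  identity moves this relation to arbitrary charts.\<close>

lemma metric_compat:
  assumes "c \<in> atlas M" "d \<in> atlas M'" "x \<in> fst c" "x \<in> fst d"
  shows "metric_in_chart M g c (snd c x) a b
    = metric_in_chart M' g' d (snd d x) (coord_change c d x a) (coord_change c d x b)"
proof -
  have x: "x \<in> points M" "x \<in> points M'" using assms chart_sub[OF assms(1)] points_sub by auto
  note ca = chart_at[OF x(1)] chart_at'[OF x(2)]
  have 1: "coord_change (chart_at M x) (chart_at M' x) x (coord_change c (chart_at M x) x v)
      = coord_change c (chart_at M' x) x v" for v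
    by (rule coord_change_cocycle) (use pair half_overlap assms ca in auto)
  have 2: "coord_change d (chart_at M' x) x (coord_change c d x v)
      = coord_change c (chart_at M' x) x v" for v
    by (rule coord_change_cocycle) (use pair half_overlap assms ca in auto)
  have "g x v w = g' x (coord_change (chart_at M x) (chart_at M' x) x v)
     (coord_change (chart_at M x) (chart_at M' x) x w)" for v w
    using embedded x(1) by (simp add: is_extension_def tangent_incl_def)
  then show ?thesis using assms by (simp add: metric_in_chart_eq 1 2)
qed

lemma metric_field:
  assumes c: "c \<in> atlas M"
  shows "metric_field (snd c ` fst c) (metric_in_chart M g c)"
proof
  have x: "x \<in> points M" if "x \<in> fst c" for x using that chart_sub[OF c] by blast
  have cc: "smooth_pair c (chart_at M x)" "half_open (overlap c (chart_at M x))" "x \<in> fst (chart_at M x)"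
    if "x \<in> fst c" for x
    using pair half_overlap c chart_at[OF x[OF that]] by auto
  have lin: "linear (coord_change c (chart_at M x) x)" if "x \<in> fst c" for x
    using coord_change_linear[OF cc(1) that cc(3)] that by blast
  have gx: "bilinear (g x)" "g x v w = g x w v" "v \<noteq> 0 \<Longrightarrow> 0 < g x v v" if "x \<in> fst c" for x v w
    using riem x[OF that] by (auto simp: riemannian_manifold_def)
  show "half_open (snd c ` fst c)" using half_image c by blast
  fix y a b
  show "smooth_on (snd c ` fst c) (\<lambda>y. metric_in_chart M g c y a b)"
    using riem c by (simp add: riemannian_manifold_def)
  assume "y \<in> snd c ` fst c"
  then obtain x where y: "y = snd c x" "x \<in> fst c" by blast
  have eq: "metric_in_chart M g c y = (\<lambda>a b. g x (coord_change c (chart_at M x) x a) (coord_change c (chart_at M x) x b))"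
    using y c by (intro ext) (simp add: metric_in_chart_eq)
  note l = linear_add[OF lin[OF y(2)]] linear_cmul[OF lin[OF y(2)]]
  show "bilinear (metric_in_chart M g c y)"
    unfolding eq bilinear_def
    by (auto intro!: linearI simp: l bilinear_ladd[OF gx(1)[OF y(2)]] bilinear_radd[OF gx(1)[OF y(2)]]
      bilinear_lmul[OF gx(1)[OF y(2)]] bilinear_rmul[OF gx(1)[OF y(2)]])
  show "metric_in_chart M g c y a b = metric_in_chart M g c y b a"
    unfolding eq using gx(2)[OF y(2)] by blast
  assume "a \<noteq> 0"
  have "inj (coord_change c (chart_at M x) x)"
    using coord_change_bij[OF cc(1,2) y(2) cc(3)] y(2) bij_is_inj by blast
  then have "coord_change c (chart_at M x) x a \<noteq> 0"
    using \<open>a \<noteq> 0\<close> linear_injective_0[OF lin[OF y(2)]] by blast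
  then show "0 < metric_in_chart M g c y a a" unfolding eq using gx(3)[OF y(2)] by blast
qed

lemma christoffel_eq:
  assumes "c \<in> atlas M"
  shows "christoffel M g c = metric_field.\<Gamma> (snd c ` fst c) (metric_in_chart M g c)"
proof -
  interpret metric_field "snd c ` fst c" "metric_in_chart M g c" by (rule metric_field[OF assms])
  show ?thesis by (intro ext) (simp add: christoffel_def Let_def \<Gamma>_def DG_def)
qed

text \<open>So the results on pairs of charts of \<open>M\<close> and \<open>M'\<close> also apply to two charts of \<open>M'\<close>.\<close>

lemma self: "extension M' M' g' g'"
proof
  show "riemannian_manifold M' g'" by (rule riem')
  have "tangent_incl M' M' (x, v) = (x, v)" if "x \<in> points M'" for x v
    using coord_change_self[of "chart_at M' x" x v] pair half_overlap' chart_at'[OF that]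
    by (simp add: tangent_incl_def)
  then show "is_extension M' g' M' g'"
    using riem' no_bd pair by (simp add: is_extension_def smooth_pair_def)
qed

lemma isometric_coords:
  assumes c: "c \<in> atlas M" "d \<in> atlas M'" "x \<in> fst c" "x \<in> fst d"
  obtains U F where "chart_map c d x U F"
    "isometric_coords (snd c ` fst c) (metric_in_chart M g c) (snd d ` fst d) (metric_in_chart M' g' d) U F"
    "\<And>z. z \<in> fst c \<Longrightarrow> snd c z \<in> U \<Longrightarrow> z \<in> fst d \<and> coord_change c d z = d1 F (snd c z)"
proof -
  have cd: "smooth_pair c d" "half_open (overlap c d)" using pair half_overlap c by auto
  obtain U0 F where F0: "chart_map c d x U0 F" using chart_map_ex[OF cd(1) c(3,4)] .
  obtain T where T: "open T" "overlap c d = halfspace \<inter> T" using cd(2) by (auto simp: openin_open)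
  \<comment> \<open>Cutting down by \<open>T\<close> forces every point of the chart
    \<open>c\<close> with coordinates in \<open>U\<close> into the domain of
    \<open>d\<close>.\<close>
  define U where "U = U0 \<inter> T"
  have F: "Cinf_on U F" "snd c x \<in> U"
    using F0 T overlapI[OF c(3,4)] Cinf_on_subset[of U0 F U] Cinf_on_open
    by (auto simp: U_def chart_map_def intro: open_Int)
  have cm: "chart_map c d x U F" using F F0 by (auto simp: chart_map_def U_def)
  have zd: "z \<in> fst d" if "z \<in> fst c" "snd c z \<in> U" for z
  proof -
    have "snd c z \<in> halfspace"
      using half_image[of c] c that openin_imp_subset by blast
    then have "snd c z \<in> overlap c d" using that T by (auto simp: U_def)
    then show ?thesis using overlap_iff[OF chart_inj] that c by blast
  qed
  have cc: "coord_change c d z = d1 F (snd c z)" if "z \<in> fst c" "snd c z \<in> U" for z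
    using coord_change_eq_d1[OF cd cm that(1) zd[OF that] that(2)] .
  interpret S: extension M' M' g' g' by (rule self)
  interpret A: metric_field "snd c ` fst c" "metric_in_chart M g c" by (rule metric_field[OF c(1)])
  interpret B: metric_field "snd d ` fst d" "metric_in_chart M' g' d" by (rule S.metric_field[OF c(2)])
  show ?thesis
  proof (rule that[OF cm])
    show "isometric_coords (snd c ` fst c) (metric_in_chart M g c) (snd d ` fst d) (metric_in_chart M' g' d) U F"
    proof
      show "Cinf_on U F" by (rule F)
      fix z assume "z \<in> snd c ` fst c" "z \<in> U"
      then obtain w where w: "z = snd c w" "w \<in> fst c" "w \<in> fst d" using zd by blast
      have Fz: "F z = snd d w" using cm w \<open>z \<in> U\<close> by (simp add: chart_map_def)
      then show "F z \<in> snd d ` fst d" using w by blast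
      show "metric_in_chart M g c z a b = metric_in_chart M' g' d (F z) (d1 F z a) (d1 F z b)" for a b
        using metric_compat[OF c(1,2) w(2,3), of a b] cc[OF w(2)] w \<open>z \<in> U\<close> Fz by simp
    qed
  qed (use zd cc in auto)
qed

section \<open>Invariance of geodesics under changes of chart and under the inclusion\<close>

lemma geodesic_on_iff:
  "geodesic_on M g J \<gamma> \<longleftrightarrow> is_interval J \<and> interior J \<noteq> {} \<and> continuous_map (top_of_set J) (mtop M) \<gamma> \<and>
     (\<forall>c\<in>atlas M. \<forall>t\<in>J. \<gamma> t \<in> fst c \<longrightarrow> geodesic_at M g c J \<gamma> t)" (is "?L \<longleftrightarrow> ?R")
proof
  assume L: ?L
  then have J: "is_interval J" "interior J \<noteq> {}" "continuous_map (top_of_set J) (mtop M) \<gamma>"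
    by (auto simp: geodesic_on_def)
  have "geodesic_at M g c J \<gamma> t" if c: "c \<in> atlas M" and t: "t \<in> J" "\<gamma> t \<in> fst c" for c t
  proof -
    obtain u' u'' where u: "\<And>t. t \<in> J \<Longrightarrow> \<gamma> t \<in> fst c \<Longrightarrow>
        ((snd c \<circ> \<gamma>) has_vector_derivative u' t) (at t within J) \<and>
        (u' has_vector_derivative u'' t) (at t within J) \<and>
        (\<forall>w. metric_in_chart M g c (snd c (\<gamma> t)) (u'' t) w
              + christoffel M g c (snd c (\<gamma> t)) (u' t) (u' t) w = 0)"
      using L c unfolding geodesic_on_def by blast
    have "eventually (\<lambda>s. \<gamma> s \<in> fst c) (near t J)"
      by (rule continuous_map_near[OF J(3) t(1) chart_open[OF c] t(2)])
    moreover have "eventually (\<lambda>s. s \<in> J) (near t J)" by (simp add: eventually_inf_principal)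
    ultimately have "eventually (\<lambda>s. \<gamma> s \<in> fst c \<and> ((snd c \<circ> \<gamma>) has_vector_derivative u' s) (at s within J)) (near t J)"
      by eventually_elim (use u in blast)
    then have "second_order c J \<gamma> t u' (u'' t)" using u[OF t] by (simp add: second_order_def)
    then show ?thesis using u[OF t] unfolding geodesic_at_def by blast
  qed
  then show ?R using J by blast
next
  assume R: ?R
  have "\<exists>u' u''. \<forall>t\<in>J. \<gamma> t \<in> fst c \<longrightarrow>
        ((snd c \<circ> \<gamma>) has_vector_derivative u' t) (at t within J) \<and>
        (u' has_vector_derivative u'' t) (at t within J) \<and>
        (\<forall>w. metric_in_chart M g c (snd c (\<gamma> t)) (u'' t) w
              + christoffel M g c (snd c (\<gamma> t)) (u' t) (u' t) w = 0)" if c: "c \<in> atlas M" for c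
  proof -
    \<comment> \<open>Velocities and accelerations found near a single time are unique, so the
      vector derivatives give one choice valid for all times in the chart.\<close>
    define u' where "u' = (\<lambda>t. vector_derivative (snd c \<circ> \<gamma>) (at t within J))"
    define u'' where "u'' = (\<lambda>t. vector_derivative u' (at t within J))"
    have "((snd c \<circ> \<gamma>) has_vector_derivative u' t) (at t within J) \<and>
        (u' has_vector_derivative u'' t) (at t within J) \<and>
        (\<forall>w. metric_in_chart M g c (snd c (\<gamma> t)) (u'' t) w
              + christoffel M g c (snd c (\<gamma> t)) (u' t) (u' t) w = 0)"
      if t: "t \<in> J" "\<gamma> t \<in> fst c" for t
    proof -
      obtain p q where pq: "second_order c J \<gamma> t p q"
        "\<And>w. metric_in_chart M g c (snd c (\<gamma> t)) q w
           + christoffel M g c (snd c (\<gamma> t)) (p t) (p t) w = 0"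
        using R c t unfolding geodesic_at_def by blast
      have eq: "vector_derivative f (at s within J) = d"
        if "(f has_vector_derivative d) (at s within J)" "s \<in> J" for f :: "real \<Rightarrow> 'e" and d s
        using interval_vector_derivative_eq[of J] R that by blast
      have "eventually (\<lambda>s. s \<in> J) (near t J)" by (simp add: eventually_inf_principal)
      with pq(1)[unfolded second_order_def, THEN conjunct1]
      have "eventually (\<lambda>s. p s = u' s) (near t J)"
        by eventually_elim (use eq in \<open>auto simp: u'_def\<close>)
      then have "(u' has_vector_derivative q) (at t within J)" "p t = u' t"
        using has_vector_derivative_near_cong[OF _ t(1) second_orderD(3)[OF pq(1) t(1)]]
          eventually_nearD[OF _ t(1)] by auto
      moreover then have "u'' t = q" using eq t(1) by (simp add: u''_def)
      ultimately show ?thesis using second_orderD(2)[OF pq(1) t(1)] pq(2) by simp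
    qed
    then show ?thesis by blast
  qed
  then show ?L using R unfolding geodesic_on_def by blast
qed

lemma continuous_map_M_iff:
  assumes "\<gamma> ` J \<subseteq> points M"
  shows "continuous_map (top_of_set J) (mtop M) \<gamma> \<longleftrightarrow> continuous_map (top_of_set J) (mtop M') \<gamma>"
  by (subst top_eq) (use assms in \<open>auto simp: continuous_map_in_subtopology\<close>)

text \<open>From \<open>c\<close> to \<open>d\<close> the transformation formula applies, and
  surjectivity of the derivative of the coordinate change yields the equation for all test vectors.
  For the converse, an extension of the reverse transition only supplies differentiability in
  \<open>c\<close>; pushing the result forward again and comparing it with the given velocity and
  acceleration yields the equation.\<close>

lemma geodesic_at_transfer:
  assumes J: "is_interval J" "interior J \<noteq> {}" and cont: "continuous_map (top_of_set J) (mtop M) \<gamma>"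
    and c: "c \<in> atlas M" "d \<in> atlas M'" and t: "t \<in> J" "\<gamma> t \<in> fst c" "\<gamma> t \<in> fst d"
  shows "geodesic_at M g c J \<gamma> t \<longleftrightarrow> geodesic_at M' g' d J \<gamma> t"
proof -
  interpret S: extension M' M' g' g' by (rule self)
  have sub: "\<gamma> ` J \<subseteq> points M" using continuous_map_image_subset_topspace[OF cont] by simp
  then have cont': "continuous_map (top_of_set J) (mtop M') \<gamma>" using cont continuous_map_M_iff by blast
  have evc: "eventually (\<lambda>s. \<gamma> s \<in> fst c) (near t J)"
    by (rule continuous_map_near[OF cont t(1) chart_open[OF c(1)] t(2)])
  have evd: "eventually (\<lambda>s. \<gamma> s \<in> fst d) (near t J)"
    by (rule continuous_map_near[OF cont' t(1) chart_open'[OF c(2)] t(3)])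
  obtain U F where F: "chart_map c d (\<gamma> t) U F"
    "isometric_coords (snd c ` fst c) (metric_in_chart M g c) (snd d ` fst d) (metric_in_chart M' g' d) U F"
    "\<And>z. z \<in> fst c \<Longrightarrow> snd c z \<in> U \<Longrightarrow> z \<in> fst d \<and> coord_change c d z = d1 F (snd c z)"
    using isometric_coords[OF c t(2,3)] by metis
  interpret I: isometric_coords "snd c ` fst c" "metric_in_chart M g c" "snd d ` fst d" "metric_in_chart M' g' d" U F
    by (rule F(2))
  let ?y = "snd c (\<gamma> t)"
  have y: "?y \<in> U" "?y \<in> snd c ` fst c" "F ?y = snd d (\<gamma> t)" using F(1) t by (auto simp: chart_map_def)
  have surj: "surj (d1 F ?y)"
  proof -
    have "smooth_pair c d" "half_open (overlap c d)" using pair half_overlap c by auto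
    then have "bij (coord_change c d (\<gamma> t))" by (rule coord_change_bij) (use t in auto)
    then show ?thesis using F(3)[OF t(2) y(1)] bij_is_surj by simp
  qed
  have eqn: "metric_in_chart M g c ?y q w + christoffel M g c ?y p p w
    = metric_in_chart M' g' d (snd d (\<gamma> t)) (d2 F ?y p p + d1 F ?y q) (d1 F ?y w)
     + christoffel M' g' d (snd d (\<gamma> t)) (d1 F ?y p) (d1 F ?y p) (d1 F ?y w)" for p q w
    using I.geodesic_equation_transform[OF y(2,1), of q w p] y(3)
    by (simp add: christoffel_eq[OF c(1)] S.christoffel_eq[OF c(2)])
  show ?thesis
  proof
    assume "geodesic_at M g c J \<gamma> t"
    then obtain p q where pq: "second_order c J \<gamma> t p q"
      "\<And>w. metric_in_chart M g c ?y q w + christoffel M g c ?y (p t) (p t) w = 0"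
      unfolding geodesic_at_def by blast
    have "second_order d J \<gamma> t (\<lambda>s. d1 F (snd c (\<gamma> s)) (p s)) (d2 F ?y (p t) (p t) + d1 F ?y q)"
      by (rule chart_map_second_order[OF F(1) y(1) t(1) evd pq(1)])
    moreover have "metric_in_chart M' g' d (snd d (\<gamma> t)) (d2 F ?y (p t) (p t) + d1 F ?y q) w
      + christoffel M' g' d (snd d (\<gamma> t)) (d1 F ?y (p t)) (d1 F ?y (p t)) w = 0" for w
    proof -
      obtain v where "w = d1 F ?y v" using surj by (rule surjE)
      then show ?thesis using eqn[of q v "p t"] pq(2) by simp
    qed
    ultimately show "geodesic_at M' g' d J \<gamma> t" unfolding geodesic_at_def by blast
  next
    assume "geodesic_at M' g' d J \<gamma> t"
    then obtain r s where rs: "second_order d J \<gamma> t r s"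
      "\<And>w. metric_in_chart M' g' d (snd d (\<gamma> t)) s w
         + christoffel M' g' d (snd d (\<gamma> t)) (r t) (r t) w = 0"
      unfolding geodesic_at_def by blast
    obtain V H where H: "chart_map d c (\<gamma> t) V H"
      using chart_map_ex[of d c "\<gamma> t"] pair c t by blast
    have "snd d (\<gamma> t) \<in> V" using H by (simp add: chart_map_def)
    from chart_map_second_order[OF H this t(1) evc rs(1)]
    obtain p q where pq: "second_order c J \<gamma> t p q" by blast
    let ?r = "\<lambda>s. d1 F (snd c (\<gamma> s)) (p s)" and ?s = "d2 F ?y (p t) (p t) + d1 F ?y q"
    have so: "second_order d J \<gamma> t ?r ?s"
      by (rule chart_map_second_order[OF F(1) y(1) t(1) evd pq(1)])
    \<comment> \<open>The derivatives in \<open>d\<close> have now been computed twice, so pushed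
      forward and given ones coincide.\<close>
    note uniq = interval_vector_derivative_unique[OF J]
    have "eventually (\<lambda>s. s \<in> J) (near t J)" by (simp add: eventually_inf_principal)
    with so[unfolded second_order_def, THEN conjunct1] rs(1)[unfolded second_order_def, THEN conjunct1]
    have ev: "eventually (\<lambda>s. ?r s = r s) (near t J)"
      by eventually_elim (use uniq in blast)
    then have "?r t = r t" using t(1) by (rule eventually_nearD)
    moreover have "?s = s"
      using uniq[OF t(1)] has_vector_derivative_near_cong[OF ev t(1) second_orderD(3)[OF so t(1)]]
        second_orderD(3)[OF rs(1) t(1)] by blast
    ultimately have "metric_in_chart M g c ?y q w + christoffel M g c ?y (p t) (p t) w = 0" for w
      using eqn[of q w "p t"] rs(2) by simp
    then show "geodesic_at M g c J \<gamma> t" using pq unfolding geodesic_at_def by blast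
  qed
qed

lemma geodesic'I:
  assumes "is_interval J" "interior J \<noteq> {}" and cont: "continuous_map (top_of_set J) (mtop M') \<gamma>"
    and "\<And>t. t \<in> J \<Longrightarrow> \<exists>c\<in>atlas M'. \<gamma> t \<in> fst c \<and> geodesic_at M' g' c J \<gamma> t"
  shows "geodesic_on M' g' J \<gamma>"
proof -
  interpret S: extension M' M' g' g' by (rule self)
  show ?thesis unfolding S.geodesic_on_iff
    using assms S.geodesic_at_transfer[OF assms(1-3)] by blast
qed

lemma geodesic_iff:
  assumes sub: "\<gamma> ` J \<subseteq> points M"
  shows "geodesic_on M g J \<gamma> \<longleftrightarrow> geodesic_on M' g' J \<gamma>"
proof
  interpret S: extension M' M' g' g' by (rule self)
  show "geodesic_on M' g' J \<gamma>" if L: "geodesic_on M g J \<gamma>"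
  proof -
    note L' = L[unfolded geodesic_on_iff]
    have cont: "continuous_map (top_of_set J) (mtop M) \<gamma>" using L' by blast
    show ?thesis
    proof (rule geodesic'I)
      fix t assume t: "t \<in> J"
      then have x: "\<gamma> t \<in> points M" "\<gamma> t \<in> points M'" using sub points_sub by auto
      note ca = chart_at[OF x(1)] and ca' = chart_at'[OF x(2)]
      have "geodesic_at M g (chart_at M (\<gamma> t)) J \<gamma> t" using L' t ca by blast
      then have "geodesic_at M' g' (chart_at M' (\<gamma> t)) J \<gamma> t"
        using geodesic_at_transfer[OF _ _ cont ca(1) ca'(1) t ca(2) ca'(2)] L' by blast
      then show "\<exists>c\<in>atlas M'. \<gamma> t \<in> fst c \<and> geodesic_at M' g' c J \<gamma> t" using ca' by blast
    qed (use L' continuous_map_M_iff[OF sub] in auto)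
  qed
  show "geodesic_on M g J \<gamma>" if R: "geodesic_on M' g' J \<gamma>"
  proof -
    note R' = R[unfolded S.geodesic_on_iff]
    have cont: "continuous_map (top_of_set J) (mtop M) \<gamma>" using R' continuous_map_M_iff[OF sub] by blast
    have "geodesic_at M g c J \<gamma> t" if "c \<in> atlas M" "t \<in> J" "\<gamma> t \<in> fst c" for c t
    proof -
      have x: "\<gamma> t \<in> points M'" using that sub points_sub by auto
      note ca' = chart_at'[OF x]
      have "geodesic_at M' g' (chart_at M' (\<gamma> t)) J \<gamma> t" using R' that ca' by blast
      then show ?thesis
        using geodesic_at_transfer[OF _ _ cont that(1) ca'(1) that(2,3) ca'(2)] R' by blast
    qed
    then show ?thesis using R' cont unfolding geodesic_on_iff by blast
  qed
qed

section \<open>Velocities in different charts\<close>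

lemma velocity_transfer:
  assumes J: "is_interval J" "interior J \<noteq> {}" and cont: "continuous_map (top_of_set J) (mtop M) \<gamma>"
    and c: "c \<in> atlas M" "d \<in> atlas M \<union> atlas M'" and t: "t \<in> J" "\<gamma> t \<in> fst c" "\<gamma> t \<in> fst d"
    and p: "((snd c \<circ> \<gamma>) has_vector_derivative p) (at t within J)"
  shows "((snd d \<circ> \<gamma>) has_vector_derivative coord_change c d (\<gamma> t) p) (at t within J)"
proof -
  have sub: "\<gamma> ` J \<subseteq> points M" using continuous_map_image_subset_topspace[OF cont] by simp
  then have cont': "continuous_map (top_of_set J) (mtop M') \<gamma>" using cont continuous_map_M_iff by blast
  have evc: "eventually (\<lambda>s. \<gamma> s \<in> fst c) (near t J)"
    by (rule continuous_map_near[OF cont t(1) chart_open[OF c(1)] t(2)])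
  have evd: "eventually (\<lambda>s. \<gamma> s \<in> fst d) (near t J)"
    using continuous_map_near[OF cont t(1) chart_open _] continuous_map_near[OF cont' t(1) chart_open' _] c t
    by blast
  have cd: "smooth_pair c d" "half_open (overlap c d)" using pair half_overlap c by auto
  obtain U F where F: "chart_map c d (\<gamma> t) U F" using chart_map_ex[OF cd(1) t(2,3)] .
  have U: "snd c (\<gamma> t) \<in> U" using F by (simp add: chart_map_def)
  have "coord_change c d (\<gamma> t) = d1 F (snd c (\<gamma> t))" by (rule coord_change_eq_d1[OF cd F t(2,3) U])
  then show ?thesis
    using chart_map_velocity(1)[OF F U t(1) _ p] evc evd by (simp add: eventually_conj)
qed

lemma velocity_eq:
  assumes J: "is_interval J" "interior J \<noteq> {}" and cont: "continuous_map (top_of_set J) (mtop M) \<gamma>"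
    and c: "c \<in> atlas M" and t: "t \<in> J" "\<gamma> t \<in> fst c"
    and p: "((snd c \<circ> \<gamma>) has_vector_derivative p) (at t within J)"
  shows "velocity M J \<gamma> t = coord_change c (chart_at M (\<gamma> t)) (\<gamma> t) p"
    and "velocity M' J \<gamma> t = coord_change c (chart_at M' (\<gamma> t)) (\<gamma> t) p"
proof -
  have x: "\<gamma> t \<in> points M" "\<gamma> t \<in> points M'" using t chart_sub[OF c] points_sub by auto
  note ca = chart_at[OF x(1)] chart_at'[OF x(2)]
  show "velocity M J \<gamma> t = coord_change c (chart_at M (\<gamma> t)) (\<gamma> t) p"
    unfolding velocity_def
    by (rule interval_vector_derivative_eq[OF J t(1) velocity_transfer[OF J cont c _ t _ p]]) (use ca in auto)
  show "velocity M' J \<gamma> t = coord_change c (chart_at M' (\<gamma> t)) (\<gamma> t) p"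
    unfolding velocity_def
    by (rule interval_vector_derivative_eq[OF J t(1) velocity_transfer[OF J cont c _ t _ p]]) (use ca in auto)
qed

text \<open>Velocities are recorded in preferred charts, which differ for \<open>M\<close> and
  \<open>M'\<close>; the differential of the inclusion converts one record into the other.\<close>

lemma geodesic_velocity_incl:
  assumes geo: "geodesic_on M g J \<gamma>" and t: "t \<in> J"
  shows "((snd (chart_at M (\<gamma> t)) \<circ> \<gamma>) has_vector_derivative velocity M J \<gamma> t) (at t within J)"
    and "tangent_incl M M' (\<gamma> t, velocity M J \<gamma> t) = (\<gamma> t, velocity M' J \<gamma> t)"
proof -
  note L = geo[unfolded geodesic_on_iff]
  have cont: "continuous_map (top_of_set J) (mtop M) \<gamma>" and J: "is_interval J" "interior J \<noteq> {}"
    using L by auto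
  have x: "\<gamma> t \<in> points M" using continuous_map_image_subset_topspace[OF cont] t by auto
  note ca = chart_at[OF x]
  have "geodesic_at M g (chart_at M (\<gamma> t)) J \<gamma> t" using L t ca by blast
  then obtain p where p: "((snd (chart_at M (\<gamma> t)) \<circ> \<gamma>) has_vector_derivative p) (at t within J)"
    unfolding geodesic_at_def using second_orderD(2) t by blast
  then show 1: "((snd (chart_at M (\<gamma> t)) \<circ> \<gamma>) has_vector_derivative velocity M J \<gamma> t) (at t within J)"
    using interval_vector_derivative_eq[OF J t p] by (simp add: velocity_def)
  show "tangent_incl M M' (\<gamma> t, velocity M J \<gamma> t) = (\<gamma> t, velocity M' J \<gamma> t)"
    using velocity_eq(2)[OF J cont ca(1) t ca(2) 1] by (simp add: tangent_incl_def)
qed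

end

section \<open>Geodesics of manifolds without boundary\<close>

lemma eventually_near_open:
  assumes "eventually P (near t J)" "t \<in> J"
  obtains T where "openin (top_of_set J) T" "t \<in> T" "\<And>s. s \<in> T \<Longrightarrow> P s"
proof -
  obtain e where e: "e > 0" "\<And>s. s \<in> J \<Longrightarrow> \<bar>s - t\<bar> < e \<Longrightarrow> P s"
    using assms(1) unfolding eventually_near by blast
  show ?thesis
    by (rule that[of "J \<inter> ball t e"])
       (use e assms(2) in \<open>auto simp: dist_real_def abs_minus_commute openin_open_Int\<close>)
qed

lemma continuous_near_neq:
  fixes f :: "real \<Rightarrow> 'b::real_normed_vector"
  assumes "continuous (at t within J) f" "f t \<noteq> a"
  shows "eventually (\<lambda>s. f s \<noteq> a) (near t J)"
proof -
  have "eventually (\<lambda>s. f s \<in> - {a}) (at t within J)"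
    using assms topological_tendstoD[of f "f t" "at t within J" "- {a}"] by (auto simp: continuous_within)
  then have "eventually (\<lambda>s. s \<in> J \<longrightarrow> f s \<noteq> a) (nhds t)"
    unfolding eventually_at_filter by eventually_elim (use assms(2) in auto)
  then show ?thesis by (simp add: eventually_inf_principal)
qed

locale boundaryless =
  fixes M :: "('a, 'e::euclidean_space) manifold" and g :: "('a, 'e) metric"
  assumes riemannian: "riemannian_manifold M g" and boundaryless: "mboundary M = {}"
begin

text \<open>A manifold without boundary is its own extension, which makes everything proved about
  \<open>M\<close> and \<open>M'\<close> available for it.\<close>

lemma extension: "extension M M g g"
proof -
  have 1: "smooth_manifold M" using riemannian by (simp add: riemannian_manifold_def)
  have 2: "smooth_pair c d" if "c \<in> atlas M" "d \<in> atlas M" for c d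
    using 1 that is_chart_inj unfolding smooth_pair_def smooth_manifold_def by blast
  have 3: "tangent_incl M M (x, v) = (x, v)" if "x \<in> points M" for x v
  proof -
    have "\<exists>c. c \<in> atlas M \<and> x \<in> fst c" using that 1 by (auto simp: smooth_manifold_def)
    from someI_ex[OF this] have c: "chart_at M x \<in> atlas M" "x \<in> fst (chart_at M x)"
      by (auto simp: chart_at_def)
    have "is_chart (mtop M) (chart_at M x)" using 1 c by (simp add: smooth_manifold_def)
    then have "half_open (overlap (chart_at M x) (chart_at M x))"
      using is_chart_open_image[of "mtop M" "chart_at M x" "fst (chart_at M x)"]
      by (simp add: overlap_def is_chart_def)
    then show ?thesis using coord_change_self[OF 2[OF c(1) c(1)] _ c(2)] by (simp add: tangent_incl_def)
  qed
  show ?thesis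
  proof
    show "is_extension M g M g"
      unfolding is_extension_def using riemannian boundaryless 2 3 by (auto simp: smooth_pair_def)
  qed (rule riemannian)
qed

sublocale E: extension M M g g by (rule extension)

lemma open_metric_field:
  assumes "c \<in> atlas M"
  shows "open_metric_field (snd c ` fst c) (metric_in_chart M g c)"
  using E.metric_field[OF assms] E.open_image'[OF assms]
  by (simp add: open_metric_field_def open_metric_field_axioms_def)

definition acc :: "('a, 'e) chart \<Rightarrow> 'e \<Rightarrow> 'e \<Rightarrow> 'e" where
  "acc c = metric_field.acceleration (snd c ` fst c) (metric_in_chart M g c)"

lemma acc_iff:
  assumes "c \<in> atlas M" "y \<in> snd c ` fst c"
  shows "(\<forall>w. metric_in_chart M g c y q w + christoffel M g c y p p w = 0) \<longleftrightarrow> q = acc c y p"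
  using metric_field.acceleration_iff[OF E.metric_field[OF assms(1)] assms(2)]
  by (simp add: E.christoffel_eq[OF assms(1)] acc_def)

text \<open>The geodesic equation in solved form. The explicit \<open>u'\<close> allows the
  velocities of two curves to be compared within one chart.\<close>

definition chart_velocity :: "('a, 'e) chart \<Rightarrow> real set \<Rightarrow> (real \<Rightarrow> 'a) \<Rightarrow> (real \<Rightarrow> 'e) \<Rightarrow> bool" where
  "chart_velocity c J \<gamma> u' \<longleftrightarrow> (\<forall>t\<in>J. \<gamma> t \<in> fst c \<longrightarrow>
     ((snd c \<circ> \<gamma>) has_vector_derivative u' t) (at t within J) \<and>
     (u' has_vector_derivative acc c (snd c (\<gamma> t)) (u' t)) (at t within J))"

lemma geodesic_iff_chart_velocity:
  "geodesic_on M g J \<gamma> \<longleftrightarrow> is_interval J \<and> interior J \<noteq> {} \<and> continuous_map (top_of_set J) (mtop M) \<gamma> \<and>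
     (\<forall>c\<in>atlas M. \<exists>u'. chart_velocity c J \<gamma> u')"
proof -
  have "(\<exists>u' u''. \<forall>t\<in>J. \<gamma> t \<in> fst c \<longrightarrow>
        ((snd c \<circ> \<gamma>) has_vector_derivative u' t) (at t within J) \<and>
        (u' has_vector_derivative u'' t) (at t within J) \<and>
        (\<forall>w. metric_in_chart M g c (snd c (\<gamma> t)) (u'' t) w
              + christoffel M g c (snd c (\<gamma> t)) (u' t) (u' t) w = 0)) \<longleftrightarrow> (\<exists>u'. chart_velocity c J \<gamma> u')"
    (is "?L \<longleftrightarrow> ?R") if c: "c \<in> atlas M" for c
  proof
    assume ?L
    then obtain u' u'' where u: "\<And>t. t \<in> J \<Longrightarrow> \<gamma> t \<in> fst c \<Longrightarrow>
        ((snd c \<circ> \<gamma>) has_vector_derivative u' t) (at t within J) \<and>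
        (u' has_vector_derivative u'' t) (at t within J) \<and>
        (\<forall>w. metric_in_chart M g c (snd c (\<gamma> t)) (u'' t) w
              + christoffel M g c (snd c (\<gamma> t)) (u' t) (u' t) w = 0)" by blast
    have "u'' t = acc c (snd c (\<gamma> t)) (u' t)" if "t \<in> J" "\<gamma> t \<in> fst c" for t
      using acc_iff[OF c imageI[OF that(2)]] u[OF that] by blast
    then have "chart_velocity c J \<gamma> u'" using u by (simp add: chart_velocity_def)
    then show ?R by blast
  next
    assume ?R
    then obtain u' where "chart_velocity c J \<gamma> u'" by blast
    then show ?L unfolding chart_velocity_def
      by (intro exI[of _ u'] exI[of _ "\<lambda>t. acc c (snd c (\<gamma> t)) (u' t)"]) (simp add: acc_iff[OF c])
  qed
  then show ?thesis unfolding geodesic_on_def by blast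
qed

lemma geodesicD:
  assumes "geodesic_on M g J \<gamma>"
  shows "is_interval J" "interior J \<noteq> {}" "continuous_map (top_of_set J) (mtop M) \<gamma>"
    "t \<in> J \<Longrightarrow> \<gamma> t \<in> points M"
    "c \<in> atlas M \<Longrightarrow> \<exists>u'. chart_velocity c J \<gamma> u'"
proof -
  show cont: "continuous_map (top_of_set J) (mtop M) \<gamma>" using assms geodesic_iff_chart_velocity by blast
  show "t \<in> J \<Longrightarrow> \<gamma> t \<in> points M" using continuous_map_image_subset_topspace[OF cont] by auto
qed (use assms geodesic_iff_chart_velocity in blast)+

lemma velocity_chart:
  assumes geo: "geodesic_on M g J \<gamma>" and c: "c \<in> atlas M" "chart_velocity c J \<gamma> u'"
    and t: "t \<in> J" "\<gamma> t \<in> fst c"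
  shows "velocity M J \<gamma> t = coord_change c (chart_at M (\<gamma> t)) (\<gamma> t) (u' t)"
  using E.velocity_eq(1)[OF geodesicD(1-3)[OF geo] c(1) t] c(2) t by (simp add: chart_velocity_def)

lemma coord_change_eq_iff:
  assumes "c \<in> atlas M" "x \<in> fst c"
  shows "coord_change c (chart_at M x) x p = coord_change c (chart_at M x) x q \<longleftrightarrow> p = q"
proof -
  have x: "x \<in> points M" using assms E.chart_sub by blast
  note ca = E.chart_at[OF x]
  have "bij (coord_change c (chart_at M x) x)"
    using coord_change_bij[OF E.pair E.half_overlap assms(2) ca(2)] assms ca by blast
  then show ?thesis using bij_is_inj inj_eq by metis
qed

lemma chart_velocity_eq_iff:
  assumes "geodesic_on M g J1 \<gamma>1" "geodesic_on M g J2 \<gamma>2" "c \<in> atlas M"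
    and "chart_velocity c J1 \<gamma>1 u1" "chart_velocity c J2 \<gamma>2 u2"
    and "t1 \<in> J1" "t2 \<in> J2" "\<gamma>1 t1 \<in> fst c" "\<gamma>1 t1 = \<gamma>2 t2"
  shows "u1 t1 = u2 t2 \<longleftrightarrow> velocity M J1 \<gamma>1 t1 = velocity M J2 \<gamma>2 t2"
  using velocity_chart[OF assms(1,3,4,6,8)] velocity_chart[OF assms(2,3,5,7)] assms(8,9)
    coord_change_eq_iff[OF assms(3,8)] by simp

lemma geodesic_subset:
  assumes geo: "geodesic_on M g J \<gamma>" and J': "J' \<subseteq> J" "is_interval J'" "interior J' \<noteq> {}"
  shows "geodesic_on M g J' \<gamma>" "t \<in> J' \<Longrightarrow> velocity M J' \<gamma> t = velocity M J \<gamma> t"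
proof -
  have cv: "chart_velocity c J' \<gamma> u'" if "chart_velocity c J \<gamma> u'" for c u'
    using that J'(1) unfolding chart_velocity_def
    by (meson has_vector_derivative_within_subset subsetD)
  have "continuous_map (top_of_set J') (mtop M) \<gamma>"
    using continuous_map_from_subtopology_mono[OF geodesicD(3)[OF geo] J'(1)] .
  then show geo': "geodesic_on M g J' \<gamma>"
    using geodesicD(5)[OF geo] cv J'(2,3) unfolding geodesic_iff_chart_velocity by blast
  assume t: "t \<in> J'"
  then have x: "\<gamma> t \<in> points M" using geodesicD(4)[OF geo'] by blast
  note ca = E.chart_at[OF x]
  obtain u' where u': "chart_velocity (chart_at M (\<gamma> t)) J \<gamma> u'" using geodesicD(5)[OF geo ca(1)] by blast
  show "velocity M J' \<gamma> t = velocity M J \<gamma> t"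
    using velocity_chart[OF geo ca(1) u' _ ca(2)] velocity_chart[OF geo' ca(1) cv[OF u'] t ca(2)] t J'(1)
    by auto
qed

lemma geodesic_shift:
  assumes geo: "geodesic_on M g {c..d} \<gamma>"
  shows "geodesic_on M g {c-a..d-a} (\<lambda>s. \<gamma> (s + a))"
    "t \<in> {c-a..d-a} \<Longrightarrow> velocity M {c-a..d-a} (\<lambda>s. \<gamma> (s + a)) t = velocity M {c..d} \<gamma> (t + a)"
proof -
  have img: "(\<lambda>s. s + a) ` {c-a..d-a} = {c..d}" by (simp add: image_add_atLeastAtMost)
  have der: "((\<lambda>s. f (s + a)) has_vector_derivative v) (at t within {c-a..d-a})"
    if "(f has_vector_derivative v) (at (t + a) within {c..d})" for f :: "real \<Rightarrow> 'e" and v t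
  proof -
    have "((\<lambda>s. s + a) has_vector_derivative 1) (at t within {c-a..d-a})"
      by (auto intro!: derivative_eq_intros)
    from vector_diff_chain_within[OF this] show ?thesis using that img by (simp add: o_def)
  qed
  have cv: "chart_velocity k {c-a..d-a} (\<lambda>s. \<gamma> (s + a)) (\<lambda>s. u' (s + a))" if "chart_velocity k {c..d} \<gamma> u'" for k u'
    unfolding chart_velocity_def
  proof (intro ballI impI conjI)
    fix t assume t: "t \<in> {c-a..d-a}" "\<gamma> (t + a) \<in> fst k"
    then have "t + a \<in> {c..d}" by auto
    with that t(2) have *: "((snd k \<circ> \<gamma>) has_vector_derivative u' (t + a)) (at (t + a) within {c..d})"
      "(u' has_vector_derivative acc k (snd k (\<gamma> (t + a))) (u' (t + a))) (at (t + a) within {c..d})"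
      unfolding chart_velocity_def by blast+
    show "((snd k \<circ> (\<lambda>s. \<gamma> (s + a))) has_vector_derivative u' (t + a)) (at t within {c-a..d-a})"
      using der[OF *(1)] by (simp add: o_def)
    show "((\<lambda>s. u' (s + a)) has_vector_derivative acc k (snd k (\<gamma> (t + a))) (u' (t + a))) (at t within {c-a..d-a})"
      using der[OF *(2)] .
  qed
  have "continuous_map (top_of_set {c-a..d-a}) (top_of_set {c..d}) (\<lambda>s. s + a)"
    by (auto intro!: continuous_intros)
  from continuous_map_compose[OF this geodesicD(3)[OF geo]]
  have cont: "continuous_map (top_of_set {c-a..d-a}) (mtop M) (\<lambda>s. \<gamma> (s + a))" by (simp add: o_def)
  have "interior {c-a..d-a} \<noteq> {}" using geodesicD(2)[OF geo] by simp
  then show geo': "geodesic_on M g {c-a..d-a} (\<lambda>s. \<gamma> (s + a))"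
    unfolding geodesic_iff_chart_velocity using cont cv geodesicD(5)[OF geo] is_interval_cc by blast
  assume t: "t \<in> {c-a..d-a}"
  then have x: "\<gamma> (t + a) \<in> points M" using geodesicD(4)[OF geo'] by blast
  note ca = E.chart_at[OF x]
  obtain u' where u': "chart_velocity (chart_at M (\<gamma> (t + a))) {c..d} \<gamma> u'"
    using geodesicD(5)[OF geo ca(1)] by blast
  show "velocity M {c-a..d-a} (\<lambda>s. \<gamma> (s + a)) t = velocity M {c..d} \<gamma> (t + a)"
    using velocity_chart[OF geo ca(1) u' _ ca(2)] velocity_chart[OF geo' ca(1) cv[OF u'] t ca(2)] t
    by auto
qed

text \<open>Matching position and velocity suffices at the junction: the acceleration is a function
  of these two, so the second derivatives from both sides agree.\<close>

lemma geodesic_concat: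
  assumes geo: "geodesic_on M g {a..b} \<gamma>1" "geodesic_on M g {b..c} \<gamma>2"
    and eq: "\<gamma>1 b = \<gamma>2 b" "velocity M {a..b} \<gamma>1 b = velocity M {b..c} \<gamma>2 b"
  shows "geodesic_on M g {a..c} (\<lambda>t. if t \<le> b then \<gamma>1 t else \<gamma>2 t)" (is "geodesic_on _ _ _ ?\<gamma>")
proof -
  have ab: "a < b" "b < c" using geodesicD(2)[OF geo(1)] geodesicD(2)[OF geo(2)] by simp_all
  have un: "{a..b} \<union> {b..c} = {a..c}" "{a..b} \<inter> {b..c} = {b}" using ab by auto
  have cl: "{a..b} \<union> (closure {a..b} \<inter> closure {b..c}) = {a..b}"
    "{b..c} \<union> (closure {a..b} \<inter> closure {b..c}) = {b..c}" using ab by auto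
  have glue: "((\<lambda>t. if t \<le> b then f t else h t) has_vector_derivative (if t \<le> b then f' t else h' t)) (at t within {a..c})"
    if t: "t \<in> {a..c}" and f: "t \<le> b \<Longrightarrow> (f has_vector_derivative f' t) (at t within {a..b})"
      and h: "b \<le> t \<Longrightarrow> (h has_vector_derivative h' t) (at t within {b..c})"
      and e: "t = b \<Longrightarrow> f t = h t \<and> f' t = h' t" for f h f' h' :: "real \<Rightarrow> 'e" and t
  proof -
    have "((\<lambda>t. if t \<in> {a..b} then f t else h t) has_vector_derivative (if t \<in> {a..b} then f' t else h' t))
        (at t within {a..c})"
    proof (rule has_vector_derivative_If_within_closures[where T = "{b..c}"])
      show "t \<in> {a..b} \<union> {b..c}" "{a..c} = {a..b} \<union> {b..c}" using t un by auto
      show "(f has_vector_derivative f' t) (at t within {a..b} \<union> closure {a..b} \<inter> closure {b..c})"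
        if "t \<in> {a..b} \<union> closure {a..b} \<inter> closure {b..c}" using f that unfolding cl by auto
      show "(h has_vector_derivative h' t) (at t within {b..c} \<union> closure {a..b} \<inter> closure {b..c})"
        if "t \<in> {b..c} \<union> closure {a..b} \<inter> closure {b..c}" using h that unfolding cl by auto
      show "f t = h t" "f' t = h' t" if "t \<in> closure {a..b}" "t \<in> closure {b..c}"
        using e that by auto
    qed
    moreover have "(if t \<in> {a..b} then f' t else h' t) = (if t \<le> b then f' t else h' t)" using t by auto
    ultimately have "((\<lambda>t. if t \<in> {a..b} then f t else h t) has_vector_derivative (if t \<le> b then f' t else h' t))
        (at t within {a..c})" by simp
    then show ?thesis by (rule has_vector_derivative_transform[OF t, rotated]) auto
  qed
  have "\<exists>u'. chart_velocity k {a..c} ?\<gamma> u'" if k: "k \<in> atlas M" for k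
  proof -
    obtain u1 u2 where u: "chart_velocity k {a..b} \<gamma>1 u1" "chart_velocity k {b..c} \<gamma>2 u2"
      using geodesicD(5)[OF geo(1) k] geodesicD(5)[OF geo(2) k] by blast
    have uu: "u1 b = u2 b" if "\<gamma>1 b \<in> fst k"
      using chart_velocity_eq_iff[OF geo k u _ _ that eq(1)] eq(2) ab by auto
    have "chart_velocity k {a..c} ?\<gamma> (\<lambda>t. if t \<le> b then u1 t else u2 t)"
      unfolding chart_velocity_def
    proof (intro ballI impI conjI)
      fix t assume t: "t \<in> {a..c}" "?\<gamma> t \<in> fst k"
      have 1: "((snd k \<circ> \<gamma>1) has_vector_derivative u1 t) (at t within {a..b})"
        "(u1 has_vector_derivative acc k (snd k (\<gamma>1 t)) (u1 t)) (at t within {a..b})" if "t \<le> b"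
        using u(1) t that unfolding chart_velocity_def by auto
      have 2: "((snd k \<circ> \<gamma>2) has_vector_derivative u2 t) (at t within {b..c})"
        "(u2 has_vector_derivative acc k (snd k (\<gamma>2 t)) (u2 t)) (at t within {b..c})" if "b \<le> t"
      proof -
        have "t \<in> {b..c}" "\<gamma>2 t \<in> fst k" using t that eq(1) by (cases "t = b", auto split: if_splits)
        then show "((snd k \<circ> \<gamma>2) has_vector_derivative u2 t) (at t within {b..c})"
          "(u2 has_vector_derivative acc k (snd k (\<gamma>2 t)) (u2 t)) (at t within {b..c})"
          using u(2) unfolding chart_velocity_def by blast+
      qed
      have 3: "u1 t = u2 t" "\<gamma>1 t = \<gamma>2 t" if "t = b" using that t(2) eq(1) uu by auto
      have "((\<lambda>t. if t \<le> b then (snd k \<circ> \<gamma>1) t else (snd k \<circ> \<gamma>2) t) has_vector_derivative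
          (if t \<le> b then u1 t else u2 t)) (at t within {a..c})"
        by (rule glue[where f = "snd k \<circ> \<gamma>1" and h = "snd k \<circ> \<gamma>2" and f' = u1 and h' = u2, OF t(1) 1(1) 2(1)]) (use 3 in auto)
      then show "((snd k \<circ> ?\<gamma>) has_vector_derivative (if t \<le> b then u1 t else u2 t)) (at t within {a..c})"
        by (rule has_vector_derivative_transform[OF t(1), rotated]) auto
      have "((\<lambda>t. if t \<le> b then u1 t else u2 t) has_vector_derivative
          (if t \<le> b then acc k (snd k (\<gamma>1 t)) (u1 t) else acc k (snd k (\<gamma>2 t)) (u2 t))) (at t within {a..c})"
        by (rule glue[where f = u1 and h = u2 and f' = "\<lambda>t. acc k (snd k (\<gamma>1 t)) (u1 t)"
            and h' = "\<lambda>t. acc k (snd k (\<gamma>2 t)) (u2 t)", OF t(1) 1(2) 2(2)]) (use 3 in auto)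
      then show "((\<lambda>t. if t \<le> b then u1 t else u2 t) has_vector_derivative
          acc k (snd k (?\<gamma> t)) (if t \<le> b then u1 t else u2 t)) (at t within {a..c})"
        by (cases "t \<le> b") auto
    qed
    then show ?thesis by blast
  qed
  moreover have "continuous_map (top_of_set {a..c}) (mtop M) ?\<gamma>"
  proof (rule continuous_map_cases_le)
    have "{x \<in> topspace (top_of_set {a..c}). x \<le> b} = {a..b}" "{x \<in> topspace (top_of_set {a..c}). b \<le> x} = {b..c}"
      using ab by auto
    moreover have "{a..c} \<inter> {a..b} = {a..b}" "{a..c} \<inter> {b..c} = {b..c}" using ab by auto
    ultimately show "continuous_map (subtopology (top_of_set {a..c}) {x \<in> topspace (top_of_set {a..c}). x \<le> b}) (mtop M) \<gamma>1"
      "continuous_map (subtopology (top_of_set {a..c}) {x \<in> topspace (top_of_set {a..c}). b \<le> x}) (mtop M) \<gamma>2"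
      using geodesicD(3)[OF geo(1)] geodesicD(3)[OF geo(2)] ab
      by (simp_all add: subtopology_subtopology min_absorb2 max_absorb2)
  qed (use eq in \<open>auto intro: continuous_intros\<close>)
  ultimately show ?thesis unfolding geodesic_iff_chart_velocity using ab is_interval_cc by simp
qed

text \<open>The times at which both position and velocity agree form an open and closed subset of
  the interval.\<close>

lemma geodesic_unique:
  assumes geo: "geodesic_on M g {a..b} \<gamma>1" "geodesic_on M g {a..b} \<gamma>2"
    and t0: "t0 \<in> {a..b}" "\<gamma>1 t0 = \<gamma>2 t0" "velocity M {a..b} \<gamma>1 t0 = velocity M {a..b} \<gamma>2 t0"
    and t: "t \<in> {a..b}"
  shows "\<gamma>1 t = \<gamma>2 t \<and> velocity M {a..b} \<gamma>1 t = velocity M {a..b} \<gamma>2 t"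
proof -
  let ?J = "{a..b}"
  define P where "P = (\<lambda>t. \<gamma>1 t = \<gamma>2 t \<and> velocity M ?J \<gamma>1 t = velocity M ?J \<gamma>2 t)"
  have cont: "continuous_map (top_of_set ?J) (mtop M) \<gamma>1" "continuous_map (top_of_set ?J) (mtop M) \<gamma>2"
    using geo geodesicD(3) by blast+
  \<comment> \<open>Three cases at \<open>s\<close>: distinct positions are separated by the
    Hausdorff property, distinct velocities by continuity in a chart, and equal data agree nearby by
    uniqueness for the coordinate equation.\<close>
  have "eventually P (near s ?J) \<or> eventually (\<lambda>t. \<not> P t) (near s ?J)" if s: "s \<in> ?J" for s
  proof (cases "\<gamma>1 s = \<gamma>2 s")
    case False
    have "\<gamma>1 s \<in> points M" "\<gamma>2 s \<in> points M" using geo geodesicD(4) s by blast+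
    moreover have "Hausdorff_space (mtop M)" using E.smooth by (simp add: smooth_manifold_def)
    ultimately obtain U V where UV: "openin (mtop M) U" "openin (mtop M) V" "\<gamma>1 s \<in> U" "\<gamma>2 s \<in> V" "disjnt U V"
      using False unfolding Hausdorff_space_def by metis
    from continuous_map_near[OF cont(1) s UV(1,3)] continuous_map_near[OF cont(2) s UV(2,4)]
    have "eventually (\<lambda>t. \<not> P t) (near s ?J)"
    proof eventually_elim
      case (elim t)
      then show ?case using UV(5) by (auto simp: P_def disjnt_iff)
    qed
    then show ?thesis by blast
  next
    case True
    have x: "\<gamma>1 s \<in> points M" using geo geodesicD(4) s by blast
    define c where "c = chart_at M (\<gamma>1 s)"
    have c: "c \<in> atlas M" "\<gamma>1 s \<in> fst c" "\<gamma>2 s \<in> fst c" using E.chart_at[OF x] True by (simp_all add: c_def)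
    obtain u1 u2 where u: "chart_velocity c ?J \<gamma>1 u1" "chart_velocity c ?J \<gamma>2 u2"
      using geodesicD(5)[OF geo(1) c(1)] geodesicD(5)[OF geo(2) c(1)] by blast
    have iff: "u1 t = u2 t \<longleftrightarrow> velocity M ?J \<gamma>1 t = velocity M ?J \<gamma>2 t"
      if "t \<in> ?J" "\<gamma>1 t \<in> fst c" "\<gamma>1 t = \<gamma>2 t" for t
      using chart_velocity_eq_iff[OF geo c(1) u that(1,1,2,3)] .
    have evJ: "eventually (\<lambda>t. t \<in> ?J) (near s ?J)" by (simp add: eventually_inf_principal)
    have ev: "eventually (\<lambda>t. \<gamma>1 t \<in> fst c \<and> \<gamma>2 t \<in> fst c) (near s ?J)"
      using continuous_map_near[OF cont(1) s E.chart_open[OF c(1)] c(2)]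
        continuous_map_near[OF cont(2) s E.chart_open[OF c(1)] c(3)] by eventually_elim blast
    show ?thesis
    proof (cases "u1 s = u2 s")
      case False
      have "continuous (at s within ?J) u1" "continuous (at s within ?J) u2"
        using u s c unfolding chart_velocity_def by (blast intro: has_vector_derivative_continuous)+
      then have "continuous (at s within ?J) (\<lambda>t. u1 t - u2 t)" by (intro continuous_intros)
      then have "eventually (\<lambda>t. u1 t - u2 t \<noteq> 0) (near s ?J)"
        by (rule continuous_near_neq) (use False in simp)
      with ev evJ have "eventually (\<lambda>t. \<not> P t) (near s ?J)"
        by eventually_elim (use iff in \<open>auto simp: P_def\<close>)
      then show ?thesis by blast
    next
      case eqs: True
      interpret open_metric_field "snd c ` fst c" "metric_in_chart M g c" by (rule open_metric_field[OF c(1)])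
      obtain d0 where d0: "d0 > 0" "\<And>t. t \<in> ?J \<Longrightarrow> \<bar>t - s\<bar> < d0 \<Longrightarrow> \<gamma>1 t \<in> fst c \<and> \<gamma>2 t \<in> fst c"
        using ev unfolding eventually_near by blast
      obtain d where d: "d > 0" "\<And>t. t \<in> ?J \<Longrightarrow> \<bar>t - s\<bar> < d \<Longrightarrow>
          (snd c \<circ> \<gamma>1) t = (snd c \<circ> \<gamma>2) t \<and> u1 t = u2 t"
      proof (rule coordinate_geodesic_unique[OF d0(1) s])
        fix t assume "t \<in> ?J" "\<bar>t - s\<bar> < d0"
        then show "(snd c \<circ> \<gamma>1) t \<in> snd c ` fst c \<and> ((snd c \<circ> \<gamma>1) has_vector_derivative u1 t) (at t within ?J) \<and>
           (u1 has_vector_derivative acceleration ((snd c \<circ> \<gamma>1) t) (u1 t)) (at t within ?J)"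
          "(snd c \<circ> \<gamma>2) t \<in> snd c ` fst c \<and> ((snd c \<circ> \<gamma>2) has_vector_derivative u2 t) (at t within ?J) \<and>
           (u2 has_vector_derivative acceleration ((snd c \<circ> \<gamma>2) t) (u2 t)) (at t within ?J)"
          using d0(2) u unfolding chart_velocity_def acc_def by auto
      qed (use True eqs in auto)
      have "P t" if t: "t \<in> ?J" "\<bar>t - s\<bar> < min d d0" for t
      proof -
        have *: "snd c (\<gamma>1 t) = snd c (\<gamma>2 t)" "u1 t = u2 t" "\<gamma>1 t \<in> fst c" "\<gamma>2 t \<in> fst c"
          using d(2)[OF t(1)] d0(2)[OF t(1)] t(2) by auto
        then have "\<gamma>1 t = \<gamma>2 t" using E.chart_inj[of c] c(1) by (auto dest: inj_onD)
        then show ?thesis using iff[OF t(1) *(3)] * by (simp add: P_def)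
      qed
      then have "eventually P (near s ?J)" unfolding eventually_near using d(1) d0(1)
        by (intro exI[of _ "min d d0"]) auto
      then show ?thesis by blast
    qed
  qed
  then have loc: "\<exists>T. openin (top_of_set ?J) T \<and> s \<in> T \<and> (\<forall>x\<in>T. \<forall>y\<in>T. P x \<longrightarrow> P y)" if "s \<in> ?J" for s
    using eventually_near_open[OF _ that, of P] eventually_near_open[OF _ that, of "\<lambda>t. \<not> P t"] that by metis
  have "P t"
    by (rule connected_induction_simple[of ?J t0 t P])
       (use t0 t loc in \<open>auto simp: P_def connected_Icc\<close>)
  then show ?thesis by (simp add: P_def)
qed

text \<open>The derivative of the squared speed is twice the left-hand side of the geodesic equation
  tested against the velocity itself.\<close>

lemma geodesic_speed:
  assumes geo: "geodesic_on M g J \<gamma>" and st: "s \<in> J" "t \<in> J"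
  shows "g (\<gamma> s) (velocity M J \<gamma> s) (velocity M J \<gamma> s) = g (\<gamma> t) (velocity M J \<gamma> t) (velocity M J \<gamma> t)"
proof -
  define \<sigma> where "\<sigma> = (\<lambda>t. g (\<gamma> t) (velocity M J \<gamma> t) (velocity M J \<gamma> t))"
  have der: "(\<sigma> has_derivative (\<lambda>h. 0)) (at r within J)" if r: "r \<in> J" for r
  proof -
    have x: "\<gamma> r \<in> points M" using geodesicD(4)[OF geo r] .
    define c where "c = chart_at M (\<gamma> r)"
    have c: "c \<in> atlas M" "\<gamma> r \<in> fst c" using E.chart_at[OF x] by (simp_all add: c_def)
    obtain u where u: "chart_velocity c J \<gamma> u" using geodesicD(5)[OF geo c(1)] by blast
    let ?G = "metric_in_chart M g c"
    interpret metric_field "snd c ` fst c" ?G by (rule E.metric_field[OF c(1)])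
    have \<sigma>: "\<sigma> t = ?G ((snd c \<circ> \<gamma>) t) (u t) (u t)" if "t \<in> J" "\<gamma> t \<in> fst c" for t
      using velocity_chart[OF geo c(1) u that] E.metric_in_chart_eq[of c "\<gamma> t" M g] c that
      by (simp add: \<sigma>_def)
    have "eventually (\<lambda>t. \<gamma> t \<in> fst c) (near r J)"
      by (rule continuous_map_near[OF geodesicD(3)[OF geo] r E.chart_open[OF c(1)] c(2)])
    then obtain e where e: "e > 0" "\<And>t. t \<in> J \<Longrightarrow> \<bar>t - r\<bar> < e \<Longrightarrow> \<gamma> t \<in> fst c"
      unfolding eventually_near by blast
    define S where "S = J \<inter> ball r e"
    have S: "r \<in> S" "\<And>t. t \<in> S \<Longrightarrow> t \<in> J \<and> \<gamma> t \<in> fst c"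
      using r e by (auto simp: S_def dist_real_def abs_minus_commute)
    have at: "at r within S = at r within J"
      by (rule at_within_nhd[of _ "ball r e"]) (use e(1) in \<open>auto simp: S_def\<close>)
    let ?u = "snd c \<circ> \<gamma>" and ?q = "acc c (snd c (\<gamma> r)) (u r)"
    have d: "(?u has_derivative (\<lambda>h. h *\<^sub>R u r)) (at r within S)" "(u has_derivative (\<lambda>h. h *\<^sub>R ?q)) (at r within S)"
      using u r c(2) unfolding at chart_velocity_def has_vector_derivative_def by blast+
    have "?u ` S \<subseteq> snd c ` fst c" using S(2) by auto
    from has_derivative_product[OF d(1) this S(1) d(2) d(2)]
    have D: "((\<lambda>t. ?G (?u t) (u t) (u t)) has_derivative
       (\<lambda>h. DG (?u r) (h *\<^sub>R u r) (u r) (u r) + ?G (?u r) (h *\<^sub>R ?q) (u r) + ?G (?u r) (u r) (h *\<^sub>R ?q)))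
       (at r within S)" .
    have y: "?u r \<in> snd c ` fst c" using c(2) by simp
    have "?G (?u r) ?q (u r) + \<Gamma> (?u r) (u r) (u r) (u r) = 0"
      using acc_iff[OF c(1) y, of ?q "u r"] by (simp add: E.christoffel_eq[OF c(1)])
    \<comment> \<open>With three equal arguments the Christoffel expression collapses to half of
      \<open>DG\<close>.\<close>
    then have "DG (?u r) (u r) (u r) (u r) + 2 * ?G (?u r) ?q (u r) = 0" by (simp add: \<Gamma>_def)
    moreover have "?G (?u r) (u r) ?q = ?G (?u r) ?q (u r)" using sym[OF y] .
    moreover have "DG (?u r) (h *\<^sub>R u r) (u r) (u r) + ?G (?u r) (h *\<^sub>R ?q) (u r) + ?G (?u r) (u r) (h *\<^sub>R ?q)
       = h * (DG (?u r) (u r) (u r) (u r) + ?G (?u r) ?q (u r) + ?G (?u r) (u r) ?q)" for h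
      by (simp only: DG_add(2)[OF y] bilinear_lmul[OF bilin[OF y]] bilinear_rmul[OF bilin[OF y]])
        (simp add: algebra_simps)
    ultimately have "((\<lambda>t. ?G (?u t) (u t) (u t)) has_derivative (\<lambda>h. 0)) (at r within S)"
      using D by (simp add: add.assoc)
    then have "(\<sigma> has_derivative (\<lambda>h. 0)) (at r within S)"
      by (rule has_derivative_transform[OF S(1), rotated]) (use S(2) \<sigma> in auto)
    then show ?thesis unfolding at .
  qed
  have "convex J" using geodesicD(1)[OF geo] is_interval_convex by blast
  then obtain k where "\<And>t. t \<in> J \<Longrightarrow> \<sigma> t = k" using has_derivative_zero_constant[of J \<sigma>] der by metis
  then show ?thesis using st by (simp add: \<sigma>_def)
qed

lemma geodesic_exists:
  assumes c: "c \<in> atlas M" and y0: "y0 \<in> snd c ` fst c"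
  obtains r e where "r > 0" "e > 0" "\<And>x p. x \<in> fst c \<Longrightarrow> dist y0 (snd c x) \<le> r \<Longrightarrow> norm p \<le> R \<Longrightarrow>
    \<exists>\<gamma>. geodesic_on M g {0..e} \<gamma> \<and> \<gamma> 0 = x \<and> velocity M {0..e} \<gamma> 0 = coord_change c (chart_at M x) x p"
proof -
  let ?G = "metric_in_chart M g c"
  interpret open_metric_field "snd c ` fst c" ?G by (rule open_metric_field[OF c])
  obtain r e where re: "r > 0" "e > 0"
    "\<And>y p. y \<in> cball y0 r \<Longrightarrow> norm p \<le> R \<Longrightarrow> \<exists>u u'. u 0 = y \<and> u' 0 = p \<and> (\<forall>t\<in>{0..e}. u t \<in> snd c ` fst c \<and>
       (u has_vector_derivative u' t) (at t within {0..e}) \<and>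
       (u' has_vector_derivative acceleration (u t) (u' t)) (at t within {0..e}))"
    using coordinate_geodesic_exists[OF y0] by metis
  show ?thesis
  proof (rule that[OF re(1,2)])
    fix x p assume x: "x \<in> fst c" "dist y0 (snd c x) \<le> r" and p: "norm (p :: 'e) \<le> R"
    obtain u u' where u: "u 0 = snd c x" "u' 0 = p"
      "\<And>t. t \<in> {0..e} \<Longrightarrow> u t \<in> snd c ` fst c"
      "\<And>t. t \<in> {0..e} \<Longrightarrow> (u has_vector_derivative u' t) (at t within {0..e})"
      "\<And>t. t \<in> {0..e} \<Longrightarrow> (u' has_vector_derivative acceleration (u t) (u' t)) (at t within {0..e})"
      using re(3)[of "snd c x" p] x p by auto
    define \<gamma> where "\<gamma> = (\<lambda>t. chart_inv c (u t))"
    have \<gamma>: "\<gamma> t \<in> fst c" "snd c (\<gamma> t) = u t" if "t \<in> {0..e}" for t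
      using u(3)[OF that] by (simp_all add: \<gamma>_def chart_inv_in chart_inv_right)
    have "continuous_map (top_of_set {0..e}) (top_of_set (snd c ` fst c)) u"
    proof -
      have "continuous_on {0..e} u"
        unfolding continuous_on_eq_continuous_within using u(4) has_vector_derivative_continuous by blast
      then show ?thesis using u(3) by auto
    qed
    from continuous_map_compose[OF this is_chart_inv_continuous[OF E.chart[OF c]]]
    have cont: "continuous_map (top_of_set {0..e}) (mtop M) \<gamma>" by (simp add: \<gamma>_def o_def)
    have d: "((snd c \<circ> \<gamma>) has_vector_derivative u' t) (at t within {0..e})" if "t \<in> {0..e}" for t
      by (rule has_vector_derivative_transform[OF that _ u(4)[OF that]]) (use \<gamma> in auto)
    have int: "interior {0..e} \<noteq> {}" using re(2) by simp
    have geo: "geodesic_on M g {0..e} \<gamma>"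
    proof (rule E.geodesic'I[OF is_interval_cc int cont])
      fix t assume t: "t \<in> {0..e}"
      have "eventually (\<lambda>t. t \<in> {0..e}) (near t {0..e})" by (simp add: eventually_inf_principal)
      then have "eventually (\<lambda>s. \<gamma> s \<in> fst c \<and> ((snd c \<circ> \<gamma>) has_vector_derivative u' s) (at s within {0..e})) (near t {0..e})"
        by eventually_elim (use \<gamma> d in blast)
      then have "second_order c {0..e} \<gamma> t u' (acceleration (u t) (u' t))"
        using u(5)[OF t] by (simp add: second_order_def)
      moreover have "\<forall>w. ?G (snd c (\<gamma> t)) (acceleration (u t) (u' t)) w
          + christoffel M g c (snd c (\<gamma> t)) (u' t) (u' t) w = 0"
        using acc_iff[OF c u(3)[OF t]] \<gamma>[OF t] by (simp add: acc_def)
      ultimately show "\<exists>c\<in>atlas M. \<gamma> t \<in> fst c \<and> geodesic_at M g c {0..e} \<gamma> t"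
        using c \<gamma>[OF t] unfolding geodesic_at_def by blast
    qed
    have 0: "0 \<in> {0..e}" using re(2) by simp
    have \<gamma>0: "\<gamma> 0 = x" using u(1) x E.chart_inj[of c] c by (simp add: \<gamma>_def chart_inv_left)
    have "velocity M {0..e} \<gamma> 0 = coord_change c (chart_at M x) x p"
      using E.velocity_eq(1)[OF is_interval_cc int cont c 0 \<gamma>(1)[OF 0] d[OF 0]] \<gamma>0 u(2) by simp
    then show "\<exists>\<gamma>. geodesic_on M g {0..e} \<gamma> \<and> \<gamma> 0 = x \<and> velocity M {0..e} \<gamma> 0 = coord_change c (chart_at M x) x p"
      using geo \<gamma>0 by blast
  qed
qed

end

section \<open>Forward geodesics and their extension\<close>

text \<open>Otherwise each point of \<open>K\<close> has a neighbourhood that \<Gamma> avoids on a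
  final stretch of time; finitely many of them cover \<open>K\<close>, and the shortest stretch
  leaves no place for \<Gamma>. No continuity of \<Gamma> enters, since its values will be taken
  from different geodesics.\<close>

lemma compactin_cluster:
  fixes T :: real
  assumes K: "compactin X K" and T: "0 < T" and \<Gamma>: "\<And>t. 0 < t \<Longrightarrow> t < T \<Longrightarrow> \<Gamma> t \<in> K"
  shows "\<exists>x\<in>K. \<forall>W d. openin X W \<longrightarrow> x \<in> W \<longrightarrow> d > 0 \<longrightarrow> (\<exists>t. 0 < t \<and> T - d < t \<and> t < T \<and> \<Gamma> t \<in> W)"
proof (rule ccontr)
  define Q where "Q = (\<lambda>W d. \<exists>t. 0 < t \<and> T - d < t \<and> t < T \<and> \<Gamma> t \<in> W)"
  assume "\<not> ?thesis"
  then have "\<not> (\<exists>x\<in>K. \<forall>W d. openin X W \<longrightarrow> x \<in> W \<longrightarrow> d > 0 \<longrightarrow> Q W d)"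
    unfolding Q_def .
  then have "\<forall>x\<in>K. \<exists>W d. openin X W \<and> x \<in> W \<and> d > 0 \<and> \<not> Q W d" by simp
  then obtain W d where "\<And>x. x \<in> K \<Longrightarrow> openin X (W x) \<and> x \<in> W x \<and> d x > 0 \<and> \<not> Q (W x) (d x)"
    by metis
  then have Wd: "x \<in> K \<Longrightarrow> openin X (W x) \<and> x \<in> W x \<and> d x > 0 \<and>
      (\<forall>t. 0 < t \<longrightarrow> T - d x < t \<longrightarrow> t < T \<longrightarrow> \<Gamma> t \<notin> W x)" for x
    unfolding Q_def by blast
  have "\<forall>U\<in>W ` K. openin X U" "K \<subseteq> \<Union>(W ` K)" using Wd by auto
  then obtain F where F: "finite F" "F \<subseteq> W ` K" "K \<subseteq> \<Union>F"
    using K unfolding compactin_def by meson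
  obtain C where C: "C \<subseteq> K" "finite C" "F = W ` C" using finite_subset_image[OF F(1,2)] by blast
  \<comment> \<open>Including \<open>T\<close> in the minimum keeps the time \<open>t\<close> below
    positive.\<close>
  define e where "e = Min (insert T (d ` C))"
  have e: "e > 0" "e \<le> T" "\<And>x. x \<in> C \<Longrightarrow> e \<le> d x" using C Wd T by (auto simp: e_def subset_iff)
  define t where "t = T - e / 2"
  have t: "0 < t" "t < T" using e by (auto simp: t_def)
  obtain x where x: "x \<in> C" "\<Gamma> t \<in> W x" using \<Gamma>[OF t] F(3) C(3) by blast
  have "T - d x < t" using e(1) e(3)[OF x(1)] by (simp add: t_def)
  then show False using Wd[of x] x C t by blast
qed

context boundaryless
begin

text \<open>Geodesics on compact intervals that begin at \<open>0\<close> stand in for the maximal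
  geodesic; the lemmas below express \<open>geodesic_domain\<close> and \<open>geodesic_flow\<close>
  by them.\<close>

definition forward :: "('a, 'e) tvec \<Rightarrow> real \<Rightarrow> (real \<Rightarrow> 'a) \<Rightarrow> bool" where
  "forward \<xi> b \<gamma> \<longleftrightarrow> 0 < b \<and> geodesic_from M g \<xi> {0..b} \<gamma>"

lemma forwardD:
  assumes "forward \<xi> b \<gamma>"
  shows "0 < b" "geodesic_on M g {0..b} \<gamma>" "\<gamma> 0 = fst \<xi>" "velocity M {0..b} \<gamma> 0 = snd \<xi>"
  using assms by (auto simp: forward_def geodesic_from_def)

lemma forward_subset:
  assumes "forward \<xi> b \<gamma>" "0 < c" "c \<le> b"
  shows "forward \<xi> c \<gamma>" "t \<in> {0..c} \<Longrightarrow> velocity M {0..c} \<gamma> t = velocity M {0..b} \<gamma> t"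
proof -
  have sub: "{0..c} \<subseteq> {0..b}" "interior {0..c} \<noteq> {}" using assms(2,3) by auto
  note r = geodesic_subset[OF forwardD(2)[OF assms(1)] sub(1) is_interval_cc sub(2)]
  show "t \<in> {0..c} \<Longrightarrow> velocity M {0..c} \<gamma> t = velocity M {0..b} \<gamma> t" by (rule r(2))
  show "forward \<xi> c \<gamma>"
    using r(1) r(2)[of 0] forwardD[OF assms(1)] assms(2) by (simp add: forward_def geodesic_from_def)
qed

lemma forward_unique:
  assumes "forward \<xi> b \<gamma>1" "forward \<xi> c \<gamma>2" "0 \<le> t" "t \<le> b" "t \<le> c"
  shows "\<gamma>1 t = \<gamma>2 t" "velocity M {0..b} \<gamma>1 t = velocity M {0..c} \<gamma>2 t"
proof -
  define d where "d = min b c"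
  have d: "0 < d" "d \<le> b" "d \<le> c" using forwardD(1) assms(1,2) by (auto simp: d_def)
  note 1 = forward_subset[OF assms(1) d(1,2)] and 2 = forward_subset[OF assms(2) d(1,3)]
  have t: "t \<in> {0..d}" using assms by (simp add: d_def)
  have "\<gamma>1 t = \<gamma>2 t \<and> velocity M {0..d} \<gamma>1 t = velocity M {0..d} \<gamma>2 t"
    by (rule geodesic_unique[OF forwardD(2)[OF 1(1)] forwardD(2)[OF 2(1)] _ _ _ t, of 0])
       (use d forwardD(3,4)[OF 1(1)] forwardD(3,4)[OF 2(1)] in auto)
  then show "\<gamma>1 t = \<gamma>2 t" "velocity M {0..b} \<gamma>1 t = velocity M {0..c} \<gamma>2 t"
    using 1(2)[OF t] 2(2)[OF t] by auto
qed

lemma geodesic_from_forward: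
  assumes "geodesic_from M g \<xi> J \<gamma>" "t \<in> J" "0 < t"
  shows "forward \<xi> t \<gamma>" "s \<in> {0..t} \<Longrightarrow> velocity M {0..t} \<gamma> s = velocity M J \<gamma> s"
proof -
  have geo: "geodesic_on M g J \<gamma>" and 0: "0 \<in> J" and init: "\<gamma> 0 = fst \<xi>" "velocity M J \<gamma> 0 = snd \<xi>"
    using assms(1) by (auto simp: geodesic_from_def)
  have sub: "{0..t} \<subseteq> J" using mem_is_interval_1_I[OF geodesicD(1)[OF geo] 0 assms(2)] by auto
  have int: "interior {0..t} \<noteq> {}" using assms(3) by simp
  note r = geodesic_subset[OF geo sub is_interval_cc int]
  show "s \<in> {0..t} \<Longrightarrow> velocity M {0..t} \<gamma> s = velocity M J \<gamma> s" by (rule r(2))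
  show "forward \<xi> t \<gamma>" using r(1) r(2)[of 0] init assms(3) by (simp add: forward_def geodesic_from_def)
qed

lemma geodesic_domain_iff:
  assumes "0 < t"
  shows "t \<in> geodesic_domain M g \<xi> \<longleftrightarrow> (\<exists>\<gamma>. forward \<xi> t \<gamma>)"
proof
  assume "t \<in> geodesic_domain M g \<xi>"
  then show "\<exists>\<gamma>. forward \<xi> t \<gamma>"
    unfolding geodesic_domain_def using geodesic_from_forward(1)[OF _ _ assms] by blast
next
  assume "\<exists>\<gamma>. forward \<xi> t \<gamma>"
  then obtain \<gamma> where "geodesic_from M g \<xi> {0..t} \<gamma>" unfolding forward_def by blast
  moreover have "t \<in> {0..t}" using assms by simp
  ultimately show "t \<in> geodesic_domain M g \<xi>" unfolding geodesic_domain_def by blast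
qed

lemma geodesic_from_unique:
  assumes "forward \<xi> b \<gamma>" "0 \<le> t" "t \<le> b" "geodesic_from M g \<xi> J \<delta>" "t \<in> J"
  shows "\<delta> t = \<gamma> t" "velocity M J \<delta> t = velocity M {0..b} \<gamma> t"
proof -
  have "\<delta> t = \<gamma> t \<and> velocity M J \<delta> t = velocity M {0..b} \<gamma> t"
  proof (cases "t = 0")
    case True
    then show ?thesis using assms(4) forwardD(3,4)[OF assms(1)] by (simp add: geodesic_from_def)
  next
    case False
    then have t: "0 < t" using assms(2) by simp
    note f = geodesic_from_forward[OF assms(4,5) t]
    show ?thesis using forward_unique[OF assms(1) f(1) assms(2,3) order_refl] f(2)[of t] t by simp
  qed
  then show "\<delta> t = \<gamma> t" "velocity M J \<delta> t = velocity M {0..b} \<gamma> t" by auto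
qed

text \<open>Uniqueness of forward geodesics is what gives the definite description in
  \<open>geodesic_flow\<close> its value.\<close>

lemma geodesic_flow_eq:
  assumes "forward \<xi> b \<gamma>" "0 \<le> t" "t \<le> b"
  shows "geodesic_flow M g \<xi> t = (\<gamma> t, velocity M {0..b} \<gamma> t)"
  unfolding geodesic_flow_def
proof (rule the_equality)
  show "\<exists>J \<delta>. geodesic_from M g \<xi> J \<delta> \<and> t \<in> J \<and> (\<gamma> t, velocity M {0..b} \<gamma> t) = (\<delta> t, velocity M J \<delta> t)"
    using assms unfolding forward_def by (metis atLeastAtMost_iff)
  show "\<eta> = (\<gamma> t, velocity M {0..b} \<gamma> t)"
    if "\<exists>J \<delta>. geodesic_from M g \<xi> J \<delta> \<and> t \<in> J \<and> \<eta> = (\<delta> t, velocity M J \<delta> t)" for \<eta>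
    using that geodesic_from_unique[OF assms] by blast
qed

lemma geodesic_exists_initial:
  assumes "x \<in> points M"
  obtains e \<gamma> where "e > 0" "geodesic_on M g {0..e} \<gamma>" "\<gamma> 0 = x" "velocity M {0..e} \<gamma> 0 = v"
proof -
  note ca = E.chart_at[OF assms]
  have y: "snd (chart_at M x) x \<in> snd (chart_at M x) ` fst (chart_at M x)" using ca by blast
  obtain r e where re: "r > 0" "e > 0" "\<And>z p. z \<in> fst (chart_at M x) \<Longrightarrow>
    dist (snd (chart_at M x) x) (snd (chart_at M x) z) \<le> r \<Longrightarrow> norm p \<le> norm v \<Longrightarrow>
    \<exists>\<gamma>. geodesic_on M g {0..e} \<gamma> \<and> \<gamma> 0 = z \<and>
      velocity M {0..e} \<gamma> 0 = coord_change (chart_at M x) (chart_at M z) z p"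
    using geodesic_exists[OF ca(1) y, of "norm v"] by metis
  obtain \<gamma> where \<gamma>: "geodesic_on M g {0..e} \<gamma>" "\<gamma> 0 = x"
    "velocity M {0..e} \<gamma> 0 = coord_change (chart_at M x) (chart_at M x) x v"
    using re(3)[OF ca(2), of v] re(1) by auto
  moreover have "coord_change (chart_at M x) (chart_at M x) x v = v"
    by (rule coord_change_self) (use E.pair E.half_overlap ca in auto)
  ultimately show ?thesis using that re(2) by metis
qed

lemma forward_exists:
  assumes "fst \<xi> \<in> points M"
  obtains b \<gamma> where "forward \<xi> b \<gamma>"
proof -
  obtain e \<gamma> where "e > 0" "geodesic_on M g {0..e} \<gamma>" "\<gamma> 0 = fst \<xi>" "velocity M {0..e} \<gamma> 0 = snd \<xi>"
    using geodesic_exists_initial[OF assms] by blast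
  then have "forward \<xi> e \<gamma>" by (simp add: forward_def geodesic_from_def)
  then show ?thesis by (rule that)
qed

lemma forward_concat:
  assumes "forward \<xi> b \<gamma>" and \<eta>: "geodesic_on M g {0..e} \<eta>" "\<eta> 0 = \<gamma> b"
    "velocity M {0..e} \<eta> 0 = velocity M {0..b} \<gamma> b"
  obtains \<delta> where "forward \<xi> (b + e) \<delta>"
proof -
  have b: "0 < b" using forwardD(1)[OF assms(1)] .
  have e: "0 < e" using geodesicD(2)[OF \<eta>(1)] by simp
  have s: "{0 - - b..e - - b} = {b..b + e}" by auto
  note sh = geodesic_shift[OF \<eta>(1), where a = "- b", unfolded s]
  define \<delta> where "\<delta> = (\<lambda>t. if t \<le> b then \<gamma> t else \<eta> (t + - b))"
  have geo: "geodesic_on M g {0..b + e} \<delta>"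
    unfolding \<delta>_def using geodesic_concat[OF forwardD(2)[OF assms(1)] sh(1)] sh(2)[where t = b] \<eta>(2,3) e by simp
  have sub: "{0..b} \<subseteq> {0..b + e}" "interior {0..b} \<noteq> {}" using e b by auto
  note r = geodesic_subset[OF geo sub(1) is_interval_cc sub(2)]
  \<comment> \<open>\<delta> is a different function that agrees with \<gamma> on
    \<open>{0..b}\<close>, so the equality of velocities is obtained by transporting the derivative
    in a chart.\<close>
  have "velocity M {0..b} \<delta> 0 = velocity M {0..b} \<gamma> 0"
  proof -
    have 0: "0 \<in> {0..b}" using b by simp
    have x: "\<gamma> 0 \<in> points M" using geodesicD(4)[OF forwardD(2)[OF assms(1)] 0] .
    note ca = E.chart_at[OF x]
    obtain u where u: "chart_velocity (chart_at M (\<gamma> 0)) {0..b} \<gamma> u"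
      using geodesicD(5)[OF forwardD(2)[OF assms(1)] ca(1)] by blast
    then have "((snd (chart_at M (\<gamma> 0)) \<circ> \<gamma>) has_vector_derivative u 0) (at 0 within {0..b})"
      using 0 ca(2) by (simp add: chart_velocity_def)
    then have "((snd (chart_at M (\<gamma> 0)) \<circ> \<delta>) has_vector_derivative u 0) (at 0 within {0..b})"
      by (rule has_vector_derivative_transform[OF 0, rotated]) (simp add: \<delta>_def)
    then have "velocity M {0..b} \<delta> 0 = coord_change (chart_at M (\<gamma> 0)) (chart_at M (\<gamma> 0)) (\<gamma> 0) (u 0)"
      using E.velocity_eq(1)[OF geodesicD(1-3)[OF r(1)] ca(1) 0, of "u 0"] ca(2) b by (simp add: \<delta>_def)
    then show ?thesis using velocity_chart[OF forwardD(2)[OF assms(1)] ca(1) u 0 ca(2)] by simp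
  qed
  then have "velocity M {0..b + e} \<delta> 0 = snd \<xi>" using r(2)[of 0] b forwardD(4)[OF assms(1)] by simp
  then have "forward \<xi> (b + e) \<delta>"
    using geo b e forwardD(3)[OF assms(1)] by (simp add: forward_def geodesic_from_def \<delta>_def)
  then show ?thesis by (rule that)
qed

lemma forward_restart:
  assumes "forward \<xi> b \<gamma>" "0 \<le> a" "a < b"
  shows "forward (\<gamma> a, velocity M {0..b} \<gamma> a) (b - a) (\<lambda>s. \<gamma> (s + a))"
    "t \<in> {0..b - a} \<Longrightarrow> velocity M {0..b - a} (\<lambda>s. \<gamma> (s + a)) t = velocity M {0..b} \<gamma> (t + a)"
proof -
  have sub: "{a..b} \<subseteq> {0..b}" "interior {a..b} \<noteq> {}" using assms by auto
  note r = geodesic_subset[OF forwardD(2)[OF assms(1)] sub(1) is_interval_cc sub(2)]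
  note s = geodesic_shift[OF r(1), where a = a, unfolded diff_self]
  show v: "velocity M {0..b - a} (\<lambda>s. \<gamma> (s + a)) t = velocity M {0..b} \<gamma> (t + a)" if "t \<in> {0..b - a}" for t
    using s(2)[where t = t] r(2)[of "t + a"] that by auto
  show "forward (\<gamma> a, velocity M {0..b} \<gamma> a) (b - a) (\<lambda>s. \<gamma> (s + a))"
    using s(1) v[of 0] assms(3) by (simp add: forward_def geodesic_from_def)
qed

text \<open>Starting \<gamma> later by \<open>T - S\<close> lets both geodesics run on a common
  interval on which they agree at time \<open>S\<close>; uniqueness then reaches back to time
  \<open>0\<close>.\<close>

lemma forward_backward_unique:
  assumes "forward \<xi> b \<gamma>" "forward \<eta> c \<delta>" and T: "0 \<le> S" "S \<le> T" "T < b" "S \<le> c"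
    and eq: "\<gamma> T = \<delta> S" "velocity M {0..b} \<gamma> T = velocity M {0..c} \<delta> S"
  shows "\<gamma> (T - S) = fst \<eta>" "velocity M {0..b} \<gamma> (T - S) = snd \<eta>"
proof -
  define a where "a = T - S"
  have a: "0 \<le> a" "a < b" using T by (auto simp: a_def)
  note r = forward_restart[OF assms(1) a]
  define d where "d = min (b - a) c"
  have d: "0 < d" "d \<le> b - a" "d \<le> c" "S \<in> {0..d}" "S + a = T"
    using a T forwardD(1)[OF assms(2)] by (auto simp: d_def a_def)
  note 1 = forward_subset[OF r(1) d(1,2)] and 2 = forward_subset[OF assms(2) d(1,3)]
  have "\<gamma> (0 + a) = \<delta> 0 \<and> velocity M {0..d} (\<lambda>s. \<gamma> (s + a)) 0 = velocity M {0..d} \<delta> 0"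
    by (rule geodesic_unique[OF forwardD(2)[OF 1(1)] forwardD(2)[OF 2(1)] d(4)])
       (use d eq 1(2)[OF d(4)] 2(2)[OF d(4)] r(2)[of S] in auto)
  then show "\<gamma> (T - S) = fst \<eta>" "velocity M {0..b} \<gamma> (T - S) = snd \<eta>"
    using d(1) forwardD(3,4)[OF 1(1)] forwardD(3,4)[OF 2(1)] by (auto simp: a_def)
qed

lemma forward_speed:
  assumes "forward \<xi> b \<gamma>" "0 \<le> t" "t \<le> b"
  shows "g (\<gamma> t) (velocity M {0..b} \<gamma> t) (velocity M {0..b} \<gamma> t) = g (fst \<xi>) (snd \<xi>) (snd \<xi>)"
  using geodesic_speed[OF forwardD(2)[OF assms(1)], of t 0] assms forwardD[OF assms(1)] by simp

text \<open>By compactness the geodesic accumulates at some point as \<open>t\<close> tends to \<open>T\<close>. Its speed is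
  constant, so near that point there is a uniform lower bound on the existence time.\<close>

lemma forward_compact:
  assumes K: "compactin (mtop M) K" and T: "0 < T"
    and fwd: "\<And>t. 0 < t \<Longrightarrow> t < T \<Longrightarrow> \<exists>\<gamma>. forward \<xi> t \<gamma> \<and> \<gamma> ` {0..t} \<subseteq> K"
  obtains b \<gamma> where "T < b" "forward \<xi> b \<gamma>" "\<gamma> ` {0..T} \<subseteq> K"
proof -
  obtain \<gamma>s where \<gamma>s: "\<And>t. 0 < t \<Longrightarrow> t < T \<Longrightarrow> forward \<xi> t (\<gamma>s t) \<and> \<gamma>s t ` {0..t} \<subseteq> K"
    using fwd by metis
  have "\<gamma>s t t \<in> K" if "0 < t" "t < T" for t using \<gamma>s[OF that] that by auto
  then obtain x where x: "x \<in> K" "\<And>W d. openin (mtop M) W \<Longrightarrow> x \<in> W \<Longrightarrow> d > 0 \<Longrightarrow>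
      \<exists>t. 0 < t \<and> T - d < t \<and> t < T \<and> \<gamma>s t t \<in> W"
    using compactin_cluster[OF K T, of "\<lambda>t. \<gamma>s t t"] by blast
  have xM: "x \<in> points M" using x(1) compactin_subset_topspace[OF K] by blast
  define c where "c = chart_at M x"
  have c: "c \<in> atlas M" "x \<in> fst c" using E.chart_at[OF xM] by (simp_all add: c_def)
  let ?G = "metric_in_chart M g c"
  interpret open_metric_field "snd c ` fst c" ?G by (rule open_metric_field[OF c(1)])
  have y0: "snd c x \<in> snd c ` fst c" using c by blast
  obtain r1 m where r1: "r1 > 0" "m > 0" "\<And>y a. y \<in> cball (snd c x) r1 \<Longrightarrow> m * (norm a)\<^sup>2 \<le> ?G y a a"
    using G_lower[OF y0] by metis
  \<comment> \<open>Near \<open>x\<close>, the constant speed and the lower bound \<open>m\<close>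
    for the metric confine the coordinate velocity to norm at most \<open>R\<close>.\<close>
  define R where "R = sqrt (g (fst \<xi>) (snd \<xi>) (snd \<xi>) / m)"
  obtain r2 e where re: "r2 > 0" "e > 0" "\<And>z p. z \<in> fst c \<Longrightarrow> dist (snd c x) (snd c z) \<le> r2 \<Longrightarrow> norm p \<le> R \<Longrightarrow>
    \<exists>\<gamma>. geodesic_on M g {0..e} \<gamma> \<and> \<gamma> 0 = z \<and> velocity M {0..e} \<gamma> 0 = coord_change c (chart_at M z) z p"
    using geodesic_exists[OF c(1) y0, of R] by metis
  define W where "W = {z \<in> fst c. snd c z \<in> ball (snd c x) (min r1 r2)}"
  have W: "openin (mtop M) W" "x \<in> W"
    using is_chart_open_vimage[OF E.chart[OF c(1)] open_ball, of "snd c x" "min r1 r2"] c r1(1) re(1) unfolding W_def by simp_all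
  \<comment> \<open>The uniform existence time \<open>e\<close> exceeds the remaining time
    \<open>T - t\<close>, so a continuation from this \<open>t\<close> passes
    \<open>T\<close>.\<close>
  obtain t where t: "0 < t" "T - e < t" "t < T" "\<gamma>s t t \<in> W" using x(2)[OF W re(2)] by blast
  have f: "forward \<xi> t (\<gamma>s t)" using \<gamma>s[OF t(1,3)] by blast
  note geo = forwardD(2)[OF f]
  define z where "z = \<gamma>s t t"
  have z: "z \<in> fst c" "dist (snd c x) (snd c z) \<le> r1" "dist (snd c x) (snd c z) \<le> r2"
    using t(4) by (auto simp: W_def z_def)
  obtain u where u: "chart_velocity c {0..t} (\<gamma>s t) u" using geodesicD(5)[OF geo c(1)] by blast
  have tt: "t \<in> {0..t}" using t by simp
  have vel: "velocity M {0..t} (\<gamma>s t) t = coord_change c (chart_at M z) z (u t)"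
    using velocity_chart[OF geo c(1) u tt] z(1) by (simp add: z_def)
  have "m * (norm (u t))\<^sup>2 \<le> ?G (snd c z) (u t) (u t)" using r1(3) z(2) by simp
  also have "\<dots> = g z (velocity M {0..t} (\<gamma>s t) t) (velocity M {0..t} (\<gamma>s t) t)"
    using E.metric_in_chart_eq[of c z M g] c(1) z(1) vel by simp
  also have "\<dots> = g (fst \<xi>) (snd \<xi>) (snd \<xi>)" using forward_speed[OF f, of t] t(1) by (simp add: z_def)
  finally have "(norm (u t))\<^sup>2 \<le> g (fst \<xi>) (snd \<xi>) (snd \<xi>) / m"
    using r1(2) by (simp add: pos_le_divide_eq mult.commute)
  then have "norm (u t) \<le> R" unfolding R_def by (rule real_le_rsqrt)
  from re(3)[OF z(1,3) this] obtain \<eta> where \<eta>: "geodesic_on M g {0..e} \<eta>" "\<eta> 0 = \<gamma>s t t"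
    "velocity M {0..e} \<eta> 0 = velocity M {0..t} (\<gamma>s t) t" unfolding vel by (auto simp: z_def)
  obtain \<delta> where \<delta>: "forward \<xi> (t + e) \<delta>" using forward_concat[OF f \<eta>] .
  have in_K: "\<delta> s \<in> K" if "0 \<le> s" "s < T" for s
  proof -
    \<comment> \<open>A forward geodesic has positive duration, so small values of \<open>s\<close>,
      including \<open>0\<close>, are seen on the geodesic up to \<open>T / 2\<close>.\<close>
    define r where "r = max s (T / 2)"
    have r: "0 < r" "s \<le> r" "r < T" "r \<le> t + e" using that t(2) T by (auto simp: r_def)
    have "\<gamma>s r s \<in> K" using \<gamma>s[OF r(1,3)] that r by auto
    then show ?thesis using forward_unique(1)[OF \<delta> conjunct1[OF \<gamma>s[OF r(1,3)]], of s] that r by simp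
  qed
  \<comment> \<open>\<open>K\<close> is closed because the space is Hausdorff, so the endpoint
    follows by continuity.\<close>
  have "\<delta> T \<in> K"
  proof (rule ccontr)
    assume "\<delta> T \<notin> K"
    have geo: "geodesic_on M g {0..t + e} \<delta>" using forwardD(2)[OF \<delta>] .
    have TJ: "T \<in> {0..t + e}" using t T by auto
    have "Hausdorff_space (mtop M)" using E.smooth by (simp add: smooth_manifold_def)
    then have "openin (mtop M) (points M - K)" using compactin_imp_closedin[OF _ K] by blast
    moreover have "\<delta> T \<in> points M - K" using geodesicD(4)[OF geo TJ] \<open>\<delta> T \<notin> K\<close> by blast
    ultimately have "eventually (\<lambda>s. \<delta> s \<in> points M - K) (near T {0..t + e})"
      using continuous_map_near[OF geodesicD(3)[OF geo] TJ] by blast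
    then obtain d where d: "d > 0" "\<And>s. s \<in> {0..t + e} \<Longrightarrow> \<bar>s - T\<bar> < d \<Longrightarrow> \<delta> s \<notin> K"
      unfolding eventually_near by blast
    define s where "s = max 0 (T - d / 2)"
    have "0 \<le> s" "s < T" "\<bar>s - T\<bar> < d" "s \<in> {0..t + e}" using d(1) T t by (auto simp: s_def)
    then show False using d(2) in_K by blast
  qed
  then have "\<delta> ` {0..T} \<subseteq> K" using in_K by (force simp: order_le_less)
  then show ?thesis using that[OF _ \<delta>] t(2) by simp
qed

end

section \<open>The boundary\<close>

context extension
begin

text \<open>Away from the edge of the half-space the overlap is open in the model space, where
  invariance of domain applies to the injective transition map. The target may be a chart of
  \<open>M'\<close>, which gives the openness of the interior of \<open>M\<close> in
  \<open>M'\<close>.\<close>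

lemma open_transition_image:
  assumes c: "c \<in> atlas M" and d: "d \<in> atlas M \<union> atlas M'"
  shows "open (transition c d ` (overlap c d \<inter> {y. 0 < y \<bullet> e_normal}))"
proof (rule invariance_of_domain)
  let ?Y = "overlap c d \<inter> {y. 0 < y \<bullet> e_normal}"
  have cd: "smooth_pair c d" using pair c d by auto
  have "transition c d differentiable_on overlap c d"
    unfolding differentiable_on_def using cd smooth_on_differentiable by (auto simp: smooth_pair_def)
  then show "continuous_on ?Y (transition c d)"
    by (intro continuous_on_subset[OF differentiable_imp_continuous_on]) auto
  obtain T where T: "open T" "overlap c d = halfspace \<inter> T"
    using half_overlap[OF c d] by (auto simp: openin_open)
  have "?Y = T \<inter> {y. 0 < y \<bullet> e_normal}"     by (rule set_eqI, simp only: T(2) halfspace_def Int_iff mem_Collect_eq) (meson less_imp_le)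
  moreover have "open {y :: 'e. 0 < y \<bullet> e_normal}" by (intro open_Collect_less continuous_intros)
  ultimately show "open ?Y" using T(1) open_Int by auto
  show "inj_on (transition c d) ?Y"
  proof (rule inj_onI)
    fix y z assume yz: "y \<in> ?Y" "z \<in> ?Y" "transition c d y = transition c d z"
    from yz(1) obtain p where p: "y = snd c p" "p \<in> fst c" "p \<in> fst d" by (auto simp: overlap_def)
    from yz(2) obtain q where q: "z = snd c q" "q \<in> fst c" "q \<in> fst d" by (auto simp: overlap_def)
    have inj: "inj_on (snd c) (fst c)" "inj_on (snd d) (fst d)" using chart_inj c d by auto
    have "snd d p = snd d q" using yz(3) p q inj by (simp add: transition_eq)
    then have "p = q" by (rule inj_onD[OF inj(2) _ p(3) q(3)])
    then show "y = z" using p(1) q(1) by simp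
  qed
qed

lemma in_halfspace: "c \<in> atlas M \<Longrightarrow> x \<in> fst c \<Longrightarrow> 0 \<le> snd c x \<bullet> e_normal"
  using openin_imp_subset[OF half_image[of c]] by (auto simp: halfspace_def)

lemma mboundary_sub: "mboundary M \<subseteq> points M"
  using chart_sub by (auto simp: mboundary_def)

text \<open>By invariance of domain, interior and boundary points can be told apart in any chart.\<close>

lemma mboundary_iff:
  assumes c: "c \<in> atlas M" "x \<in> fst c"
  shows "x \<in> mboundary M \<longleftrightarrow> snd c x \<bullet> e_normal = 0"
proof
  assume "x \<in> mboundary M"
  then obtain d where d: "d \<in> atlas M" "x \<in> fst d" "snd d x \<bullet> e_normal = 0" by (auto simp: mboundary_def)
  show "snd c x \<bullet> e_normal = 0"
  proof (rule ccontr)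
    assume "snd c x \<bullet> e_normal \<noteq> 0"
    then have pos: "0 < snd c x \<bullet> e_normal" using in_halfspace[OF c] by linarith
    let ?Z = "transition c d ` (overlap c d \<inter> {y. 0 < y \<bullet> e_normal})"
    have "transition c d (snd c x) = snd d x" using chart_inj[of c] c by (simp add: transition_eq)
    then have "snd d x \<in> ?Z" using pos overlapI[OF c(2) d(2)] by (metis (mono_tags) IntI imageI mem_Collect_eq)
    moreover have "open ?Z" using open_transition_image c d by blast
    ultimately obtain r where r: "r > 0" "ball (snd d x) r \<subseteq> ?Z" using openE by blast
    \<comment> \<open>A point of the neighbourhood with negative normal coordinate, a value that no
      chart of \<open>M\<close> attains.\<close>
    define y where "y = snd d x - (r / 2) *\<^sub>R e_normal"
    have n: "norm (e_normal :: 'e) = 1" by (rule norm_Basis[OF e_normal_Basis])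
    have "y \<in> ball (snd d x) r" using r(1) n by (simp add: y_def dist_norm)
    then obtain p where "y = snd d p" "p \<in> fst d"
      using r(2) chart_inj[of c] c by (auto simp: overlap_def transition_eq)
    then have "0 \<le> y \<bullet> e_normal" using in_halfspace d by blast
    moreover have "y \<bullet> e_normal = - r / 2"
      using d(3) n by (simp add: y_def inner_diff_left norm_eq_1)
    ultimately show False using r(1) by simp
  qed
qed (use c in \<open>auto simp: mboundary_def\<close>)

lemma minteriorI: "c \<in> atlas M \<Longrightarrow> x \<in> fst c \<Longrightarrow> 0 < snd c x \<bullet> e_normal \<Longrightarrow> x \<in> minterior M"
  using mboundary_iff[of c x] chart_sub[of c] by (auto simp: minterior_def)

text \<open>The openness is in \<open>M'\<close>, so that a geodesic of \<open>M'\<close> at an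
  interior point of \<open>M\<close> stays in \<open>M\<close> for a while.\<close>

lemma openin_minterior: "openin (mtop M') (minterior M)"
proof (subst openin_subopen, intro ballI)
  fix x assume x: "x \<in> minterior M"
  then have xM: "x \<in> points M" "x \<in> points M'" "x \<notin> mboundary M"
    using points_sub by (auto simp: minterior_def)
  define c d where "c = chart_at M x" and "d = chart_at M' x"
  have c: "c \<in> atlas M" "x \<in> fst c" and d: "d \<in> atlas M'" "x \<in> fst d"
    using chart_at[OF xM(1)] chart_at'[OF xM(2)] by (auto simp: c_def d_def)
  have pos: "0 < snd c x \<bullet> e_normal" using xM(3) mboundary_iff[OF c] in_halfspace[OF c] by linarith
  let ?Z = "transition c d ` (overlap c d \<inter> {y. 0 < y \<bullet> e_normal})"
  define W where "W = {z \<in> fst d. snd d z \<in> ?Z}"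
  have inj: "inj_on (snd c) (fst c)" "inj_on (snd d) (fst d)" using chart_inj c d by auto
  have "openin (mtop M') W"
    unfolding W_def by (rule is_chart_open_vimage[OF chart'[OF d(1)] open_transition_image]) (use c d in auto)
  moreover have "snd d x = transition c d (snd c x)" using inj c by (simp add: transition_eq)
  then have "x \<in> W" using pos overlapI[OF c(2) d(2)] d(2) by (auto simp: W_def)
  moreover have "W \<subseteq> minterior M"
  proof
    fix z assume z: "z \<in> W"
    then obtain p where p: "p \<in> fst c" "p \<in> fst d" "0 < snd c p \<bullet> e_normal" "snd d z = snd d p"
      using inj by (auto simp: W_def overlap_def transition_eq)
    then have "z = p" using inj_onD[OF inj(2)] z by (auto simp: W_def)
    then show "z \<in> minterior M" using minteriorI c p by blast
  qed
  ultimately show "\<exists>T. openin (mtop M') T \<and> x \<in> T \<and> T \<subseteq> minterior M" by blast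
qed

text \<open>The covector of the outward normal vanishes on \<open>T_bd M\<close>, so it is a
  multiple of the normal coordinate, with a negative factor. This replaces the metric condition by
  the sign of a coordinate.\<close>

lemma bd_inward_iff: "(x, v) \<in> bd_inward M g \<longleftrightarrow> x \<in> mboundary M \<and> 0 < v \<bullet> e_normal"
proof (cases "x \<in> mboundary M")
  case False
  then show ?thesis by (simp add: bd_inward_def bd_TM_def)
next
  case True
  then have x: "x \<in> points M" using mboundary_sub by blast
  let ?G = "g x" and ?e = "e_normal :: 'e"
  have G: "bilinear ?G" "\<And>v w. ?G v w = ?G w v" "\<And>v. v \<noteq> 0 \<Longrightarrow> 0 < ?G v v"
    using riem x by (auto simp: riemannian_manifold_def)
  have ee: "?e \<bullet> ?e = 1" by (rule inner_same_Basis[OF e_normal_Basis])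
  define P where "P = (\<lambda>n. ?G n n = 1 \<and> (\<forall>w. (x, w) \<in> T_bd M \<longrightarrow> ?G n w = 0) \<and> n \<bullet> ?e < 0)"
  have P: "?G n w = ?G n ?e * (w \<bullet> ?e)" if "P n" for n w
  proof -
    have "(w - (w \<bullet> ?e) *\<^sub>R ?e) \<bullet> ?e = 0" using ee by (simp add: inner_diff_left)
    then have "(x, w - (w \<bullet> ?e) *\<^sub>R ?e) \<in> T_bd M" using True by (simp add: T_bd_def)
    then have "?G n (w - (w \<bullet> ?e) *\<^sub>R ?e) = 0" using that by (simp add: P_def)
    then show ?thesis by (simp add: bilinear_rsub[OF G(1)] bilinear_rmul[OF G(1)] mult.commute)
  qed
  have neg: "?G n ?e < 0" if "P n" for n
    using P[OF that, of n] that by (auto simp: P_def mult_less_0_iff zero_less_mult_iff)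
      (smt (verit) mult_nonneg_nonpos)
  have nondeg: "a = b" if "\<And>w. ?G a w = ?G b w" for a b
    using G(3)[of "a - b"] that by (force simp: bilinear_lsub[OF G(1)])
  \<comment> \<open>Two candidates have proportional covectors, hence are proportional; the factor
    is positive, and the normalization makes it \<open>1\<close>.\<close>
  have uniq: "n = m" if "P n" "P m" for n m
  proof -
    let ?r = "?G n ?e / ?G m ?e"
    have n: "n = ?r *\<^sub>R m"
    proof (rule nondeg)
      fix w show "?G n w = ?G (?r *\<^sub>R m) w"
        using P[OF that(1), of w] P[OF that(2), of w] neg[OF that(2)] by (simp add: bilinear_lmul[OF G(1)])
    qed
    have "?G n n = ?r * (?r * ?G m m)"
      by (subst (1 2) n) (simp add: bilinear_lmul[OF G(1)] bilinear_rmul[OF G(1)])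
    moreover have "?G n n = 1" "?G m m = 1" using that by (simp_all add: P_def)
    ultimately have "1 = ?r * (?r * 1)" by (simp only:)
    then have "?r * ?r = 1" by (simp only: mult_1_right)
    moreover have "?r > 0" using neg that by (simp add: divide_neg_neg)
    ultimately have "?r = 1" by (metis abs_of_pos abs_mult_self_eq mult_1 real_sqrt_abs2 real_sqrt_one)
    then show ?thesis using n by simp
  qed
  \<comment> \<open>The vector representing the negative of the normal coordinate, rescaled to unit
    length.\<close>
  have "\<exists>n. P n"
  proof -
    define f where "f = (\<lambda>q. \<Sum>i\<in>Basis. ?G q i *\<^sub>R i)"
    have lin: "linear (\<lambda>q. ?G q w)" "linear (?G q)" for q w using G(1) by (auto simp: bilinear_def)
    have "linear f" unfolding f_def
      by (rule linearI) (simp_all add: linear_add[OF lin(1)] linear_cmul[OF lin(1)] algebra_simps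
        sum.distrib scaleR_sum_right)
    have Gf: "?G q w = f q \<bullet> w" for q w
    proof -
      have "?G q w = (\<Sum>i\<in>Basis. (w \<bullet> i) *\<^sub>R ?G q i)" by (rule linear_sum_Basis[OF lin(2)])
      also have "\<dots> = f q \<bullet> w"
        unfolding f_def inner_sum_left by (intro sum.cong refl) (simp add: inner_commute)
      finally show ?thesis .
    qed
    have "inj f"
    proof (rule injI)
      fix a b assume "f a = f b"
      then show "a = b" using Gf by (intro nondeg) simp
    qed
    then have "surj f" using \<open>linear f\<close> linear_injective_imp_surjective by blast
    then obtain n where "- ?e = f n" by (rule surjE)
    then have n: "?G n w = - (w \<bullet> ?e)" for w using Gf[of n w] by (simp add: inner_commute) (metis inner_commute inner_minus_left)
    then have "n \<noteq> 0" using n[of ?e] ee bilinear_lzero[OF G(1)] by force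
    then have s: "?G n n > 0" using G(3) by blast
    define k where "k = 1 / sqrt (?G n n)"
    have k: "k > 0" "k * k * ?G n n = 1" using s by (simp_all add: k_def field_simps)
    have "P (k *\<^sub>R n)"
      unfolding P_def
    proof (intro conjI allI impI)
      show "?G (k *\<^sub>R n) (k *\<^sub>R n) = 1"
        using k(2) by (simp add: bilinear_lmul[OF G(1)] bilinear_rmul[OF G(1)])
      show "?G (k *\<^sub>R n) w = 0" if "(x, w) \<in> T_bd M" for w
        using that n[of w] by (simp add: bilinear_lmul[OF G(1)] T_bd_def)
      show "(k *\<^sub>R n) \<bullet> ?e < 0" using n[of n] s k(1) by (simp add: mult_pos_neg)
    qed
    then show ?thesis by blast
  qed
  then have "\<exists>!n. P n" using uniq by blast
  from theI'[OF this] have "P (outward_normal M g x)" by (simp add: outward_normal_def P_def)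
  from P[OF this, of v] neg[OF this] show ?thesis
    using True G(2)[of v "outward_normal M g x"]
    by (auto simp: bd_inward_def bd_TM_def mult_less_0_iff)
qed

section \<open>The differential of the inclusion\<close>

lemma tangent_incl_inj:
  assumes "x \<in> points M"
  shows "bij (coord_change (chart_at M x) (chart_at M' x) x)"
proof -
  have x': "x \<in> points M'" using assms points_sub by blast
  show ?thesis
    by (rule coord_change_bij) (use pair half_overlap chart_at[OF assms] chart_at'[OF x'] in auto)
qed

lemma fst_tangent_incl [simp]: "fst (tangent_incl M M' \<xi>) = fst \<xi>"
  by (simp add: tangent_incl_def)

lemma inj_tangent_incl: "inj_on (tangent_incl M M') (tangent_bundle M)"
proof (rule inj_onI)
  fix \<xi> \<eta> assume h: "\<xi> \<in> tangent_bundle M" "\<eta> \<in> tangent_bundle M" "tangent_incl M M' \<xi> = tangent_incl M M' \<eta>"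
  then have f: "fst \<xi> = fst \<eta>" "fst \<xi> \<in> points M" by (auto simp: tangent_incl_def tangent_bundle_def)
  then have "snd \<xi> = snd \<eta>"
    using h(3) tangent_incl_inj[OF f(2)] by (auto simp: tangent_incl_def bij_def dest: injD)
  then show "\<xi> = \<eta>" using f prod_eqI by blast
qed

lemma tangent_incl_surj:
  assumes "x \<in> points M"
  obtains \<eta> where "\<eta> \<in> tangent_bundle M" "tangent_incl M M' \<eta> = (x, v)"
proof -
  obtain w where "v = coord_change (chart_at M x) (chart_at M' x) x w"
    using bij_is_surj[OF tangent_incl_inj[OF assms]] by (rule surjE)
  then show ?thesis using that[of "(x, w)"] assms by (simp add: tangent_incl_def tangent_bundle_def)
qed

lemma metric_incl:
  assumes "\<xi> \<in> tangent_bundle M"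
  shows "g (fst \<xi>) (snd \<xi>) (snd \<xi>) = g' (fst \<xi>) (snd (tangent_incl M M' \<xi>)) (snd (tangent_incl M M' \<xi>))"
  using embedded assms by (cases \<xi>) (auto simp: is_extension_def tangent_bundle_def)

sublocale B: boundaryless M' g'
  by unfold_locales (rule riem' no_bd)+

text \<open>The chart of \<open>M\<close> extends to a chart of \<open>M'\<close> near \<open>x\<close>, and the coordinate of \<open>\<gamma>\<close> along
  \<open>e_normal\<close> in this extended chart has a positive derivative at time \<open>0\<close>.\<close>

lemma inward_enters_interior:
  assumes \<xi>: "\<xi> \<in> bd_inward M g" and fwd: "B.forward (tangent_incl M M' \<xi>) b \<gamma>"
  obtains d where "d > 0" "\<And>t. 0 < t \<Longrightarrow> t < d \<Longrightarrow> t \<le> b \<and> \<gamma> t \<in> minterior M"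
proof -
  obtain x v where xv: "\<xi> = (x, v)" by (cases \<xi>)
  have x: "x \<in> mboundary M" and v: "0 < v \<bullet> e_normal" using \<xi> by (auto simp: xv bd_inward_iff)
  have xM: "x \<in> points M" "x \<in> points M'" using x mboundary_sub points_sub by auto
  have b: "0 < b" using B.forwardD(1)[OF fwd] .
  let ?J = "{0..b}"
  have geo: "geodesic_on M' g' ?J \<gamma>" and \<gamma>0: "\<gamma> 0 = x" using B.forwardD[OF fwd] by (simp_all add: xv)
  define c d where "c = chart_at M x" and "d = chart_at M' x"
  have c: "c \<in> atlas M" "x \<in> fst c" and d: "d \<in> atlas M'" "x \<in> fst d"
    using chart_at[OF xM(1)] chart_at'[OF xM(2)] by (auto simp: c_def d_def)
  have inj: "inj_on (snd c) (fst c)" "inj_on (snd d) (fst d)" using chart_inj c d by auto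
  have cd: "smooth_pair c d" "half_open (overlap c d)" using pair half_overlap c d by auto
  obtain U F where F: "chart_map c d x U F" using chart_map_ex[OF cd(1) c(2) d(2)] .
  let ?y = "snd c x"
  have F': "Cinf_on U F" "?y \<in> U" "F ?y = snd d x" using F c d by (auto simp: chart_map_def)
  let ?A = "coord_change c d x"
  have A: "?A = d1 F ?y" by (rule coord_change_eq_d1[OF cd F c(2) d(2) F'(2)])
  have bijA: "bij ?A" by (rule coord_change_bij[OF cd c(2) d(2)])
  define A' where "A' = inv ?A"
  have A': "A' (?A w) = w" "?A (A' w) = w" for w
    using bijA by (simp_all add: A'_def bij_is_inj bij_is_surj surj_f_inv_f)
  have linA: "linear ?A" by (rule coord_change_linear[OF cd(1) c(2) d(2)])
  have linA': "linear A'"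
  proof (rule linearI)
    show "A' (p + q) = A' p + A' q" for p q
      by (metis A' linear_add[OF linA])
    show "A' (r *\<^sub>R p) = r *\<^sub>R A' p" for r p
      by (metis A' linear_cmul[OF linA])
  qed
  have "\<exists>e>0. \<forall>z. dist ?y z < e \<longrightarrow> onorm (\<lambda>v. d1 F z v - d1 F ?y v) < \<epsilon>" if "\<epsilon> > 0" for \<epsilon>
    using d1_continuous_onorm[OF F'(1,2) that] by metis
  then obtain r where r: "r > 0" "ball ?y r \<subseteq> U" "inj_on F (ball ?y r)"
    using has_derivative_locally_injective[OF F'(2) Cinf_on_open[OF F'(1)],
        of A' "d1 F" F] linA' A'(1) A Cinf_on_d1[OF F'(1)]
    by (auto simp: linear_conv_bounded_linear fun_eq_iff)
  obtain T where T: "open T" "overlap c d = halfspace \<inter> T" using cd(2) by (auto simp: openin_open)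
  \<comment> \<open>On \<open>V\<close> the extension \<open>F\<close> is injective, and the points
    of \<open>V\<close> in the half-space are coordinates of points common to both charts.\<close>
  define V where "V = ball ?y r \<inter> T"
  have yT: "?y \<in> T" using overlapI[OF c(2) d(2)] T(2) by blast
  have V: "open V" "?y \<in> V" "V \<subseteq> U" using T(1) yT r by (auto simp: V_def)
  have injV: "inj_on F V" using r(3) by (rule inj_on_subset) (auto simp: V_def)
  have contV: "continuous_on V F"
    using Cinf_on_d1[OF F'(1)] V(3)
    by (meson continuous_at_imp_continuous_on has_derivative_continuous subsetD)
  have openFV: "open (F ` V)" by (rule invariance_of_domain[OF contV V(1) injV])
  \<comment> \<open>The extended chart is \<open>H\<close> after the coordinate map of
    \<open>d\<close>.\<close>
  define H where "H = inv_into V F"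
  have HF: "H (F z) = z" if "z \<in> V" for z using inv_into_f_f[OF injV that] by (simp add: H_def)
  have FH: "H w \<in> V" "F (H w) = w" if "w \<in> F ` V" for w
    using that by (simp_all add: H_def inv_into_into f_inv_into_f)
  have derH: "(H has_derivative A') (at (F ?y))"
    by (rule has_derivative_inverse_strong[OF V(1,2) contV HF Cinf_on_d1[OF F'(1,2)]])
       (use A A'(2) in auto)
  obtain u where u: "B.chart_velocity d ?J \<gamma> u" using B.geodesicD(5)[OF geo d(1)] by blast
  have 0: "0 \<in> ?J" using b by simp
  have "velocity M' ?J \<gamma> 0 = ?A v"
    using B.forwardD(4)[OF fwd] by (simp add: xv tangent_incl_def c_def d_def)
  moreover have "velocity M' ?J \<gamma> 0 = coord_change d d x (u 0)"
    using B.velocity_chart[OF geo d(1) u 0] d(2) by (simp add: \<gamma>0 d_def)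
  moreover have "coord_change d d x (u 0) = u 0"
    by (rule coord_change_self) (use pair half_overlap' d in auto)
  ultimately have u0: "u 0 = ?A v" by simp
  define w where "w = (\<lambda>t. snd d (\<gamma> t))"
  have w0: "w 0 = F ?y" by (simp add: w_def \<gamma>0 F'(3))
  have w: "(w has_vector_derivative ?A v) (at 0 within ?J)"
  proof -
    have "((snd d \<circ> \<gamma>) has_vector_derivative u 0) (at 0 within ?J)"
      using u 0 d(2) unfolding B.chart_velocity_def \<gamma>0[symmetric] by blast
    then show ?thesis by (simp add: u0 w_def o_def)
  qed
  have "((\<lambda>t. H (w t)) has_derivative (\<lambda>h. A' (h *\<^sub>R ?A v))) (at 0 within ?J)"
    by (rule has_derivative_compose[OF w[unfolded has_vector_derivative_def]]) (use derH w0 in simp)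
  then have "((\<lambda>t. H (w t) \<bullet> e_normal) has_derivative (\<lambda>h. A' (h *\<^sub>R ?A v) \<bullet> e_normal)) (at 0 within ?J)"
    by (rule has_derivative_inner_left)
  moreover have "(\<lambda>h. A' (h *\<^sub>R ?A v) \<bullet> e_normal) = (*) (v \<bullet> e_normal)"
    by (simp add: linear_cmul[OF linA'] A'(1) fun_eq_iff mult.commute)
  ultimately have "((\<lambda>t. H (w t) \<bullet> e_normal) has_real_derivative (v \<bullet> e_normal)) (at 0 within ?J)"
    by (simp add: has_field_derivative_def)
  from has_real_derivative_pos_inc_right[OF this v]
  obtain d1 where d1: "d1 > 0" "\<And>h. 0 < h \<Longrightarrow> 0 + h \<in> ?J \<Longrightarrow> h < d1 \<Longrightarrow> H (w 0) \<bullet> e_normal < H (w (0 + h)) \<bullet> e_normal"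
    by blast
  have Hw0: "H (w 0) \<bullet> e_normal = 0" using HF[OF V(2)] w0 x mboundary_iff[OF c] by simp
  have "continuous (at 0 within ?J) w" using w has_vector_derivative_continuous by blast
  then have "(w \<longlongrightarrow> w 0) (at 0 within ?J)" by (simp add: continuous_within)
  moreover have "w 0 \<in> F ` V" using w0 V(2) by blast
  ultimately have "eventually (\<lambda>t. w t \<in> F ` V) (at 0 within ?J)"
    using openFV topological_tendstoD by blast
  then obtain d2 where d2: "d2 > 0" "\<And>t. t \<in> ?J \<Longrightarrow> t \<noteq> 0 \<Longrightarrow> dist t 0 < d2 \<Longrightarrow> w t \<in> F ` V"
    unfolding eventually_at by blast
  have "eventually (\<lambda>t. \<gamma> t \<in> fst d) (near 0 ?J)"
    by (rule continuous_map_near[OF B.geodesicD(3)[OF geo] 0 chart_open'[OF d(1)]]) (simp add: \<gamma>0 d(2))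
  then obtain d3 where d3: "d3 > 0" "\<And>t. t \<in> ?J \<Longrightarrow> \<bar>t - 0\<bar> < d3 \<Longrightarrow> \<gamma> t \<in> fst d"
    unfolding eventually_near by blast
  show ?thesis
  proof (rule that[of "min (min d1 d2) (min d3 b)"])
    show "min (min d1 d2) (min d3 b) > 0" using d1 d2 d3 b by simp
    fix t assume t: "0 < t" "t < min (min d1 d2) (min d3 b)"
    then have tJ: "t \<in> ?J" by simp
    have wt: "w t \<in> F ` V" by (rule d2(2)[OF tJ]) (use t in \<open>auto simp: dist_real_def\<close>)
    have \<gamma>t: "\<gamma> t \<in> fst d" by (rule d3(2)[OF tJ]) (use t in auto)
    have pos: "0 < H (w t) \<bullet> e_normal" using d1(2)[of t] t tJ Hw0 by simp
    \<comment> \<open>Positivity of the normal coordinate brings \<open>H (w t)\<close> back into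
      the half-space, so it is the coordinate vector in \<open>c\<close> of a point of
      \<open>M\<close>, which turns out to be \<open>\<gamma> t\<close>.\<close>
    then have "H (w t) \<in> overlap c d" using FH(1)[OF wt] T(2) by (auto simp: V_def halfspace_def)
    then obtain q where q: "H (w t) = snd c q" "q \<in> fst c" "q \<in> fst d" by (auto simp: overlap_def)
    have "F (snd c q) = snd d q" using F q FH(1)[OF wt] V(3) by (auto simp: chart_map_def)
    then have "snd d q = snd d (\<gamma> t)" using FH(2)[OF wt] q(1) by (simp add: w_def)
    then have "q = \<gamma> t" using inj_onD[OF inj(2)] q(3) \<gamma>t by blast
    then show "t \<le> b \<and> \<gamma> t \<in> minterior M" using minteriorI[OF c(1)] q pos t by auto
  qed
qed

text \<open>The normal coordinate is nonnegative along \<gamma> and vanishes at \<open>s\<close>, so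
  its derivative is zero there. That \<open>s\<close> is interior to the time interval excludes the
  exit time.\<close>

lemma touching_boundary_tangent:
  assumes geo: "geodesic_on M g {a..b} \<gamma>" and s: "a < s" "s < b" "\<gamma> s \<in> mboundary M"
  shows "(\<gamma> s, velocity M {a..b} \<gamma> s) \<in> T_bd M"
proof -
  let ?J = "{a..b}" and ?v = "velocity M {a..b} \<gamma> s"
  have sJ: "s \<in> ?J" using s by simp
  have x: "\<gamma> s \<in> points M" using s(3) mboundary_sub by blast
  define c where "c = chart_at M (\<gamma> s)"
  have c: "c \<in> atlas M" "\<gamma> s \<in> fst c" using chart_at[OF x] by (auto simp: c_def)
  have "((snd c \<circ> \<gamma>) has_vector_derivative ?v) (at s within ?J)"
    using geodesic_velocity_incl(1)[OF geo sJ] by (simp add: c_def)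
  moreover have "at s within ?J = at s" using s by (intro at_within_interior) simp
  ultimately have "((snd c \<circ> \<gamma>) has_derivative (\<lambda>h. h *\<^sub>R ?v)) (at s)" by (simp add: has_vector_derivative_def)
  then have D: "((\<lambda>t. (snd c \<circ> \<gamma>) t \<bullet> e_normal) has_derivative (\<lambda>h. (h *\<^sub>R ?v) \<bullet> e_normal)) (at s)"
    by (rule has_derivative_inner_left)
  have cont: "continuous_map (top_of_set ?J) (mtop M) \<gamma>" using geo by (simp add: geodesic_on_def)
  obtain e where e: "e > 0" "\<And>t. t \<in> ?J \<Longrightarrow> \<bar>t - s\<bar> < e \<Longrightarrow> \<gamma> t \<in> fst c"
    using continuous_map_near[OF cont sJ chart_open[OF c(1)] c(2)] unfolding eventually_near by blast
  have "(\<lambda>h. (h *\<^sub>R ?v) \<bullet> e_normal) = (\<lambda>h. 0)"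
  proof (rule has_derivative_local_min[OF D])
    define d where "d = min e (min (s - a) (b - s))"
    have d: "d > 0" using e s by (simp add: d_def)
    show "eventually (\<lambda>t. (snd c \<circ> \<gamma>) s \<bullet> e_normal \<le> (snd c \<circ> \<gamma>) t \<bullet> e_normal) (at s)"
      unfolding eventually_at
    proof (intro exI[of _ d] conjI d ballI impI)
      fix t assume "t \<noteq> s \<and> dist t s < d"
      then have "t \<in> ?J" "\<bar>t - s\<bar> < e" by (auto simp: d_def dist_real_def)
      then have "0 \<le> snd c (\<gamma> t) \<bullet> e_normal" using e(2) in_halfspace[OF c(1)] by blast
      then show "(snd c \<circ> \<gamma>) s \<bullet> e_normal \<le> (snd c \<circ> \<gamma>) t \<bullet> e_normal"
        using s(3) mboundary_iff[OF c] by simp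
    qed
  qed
  from fun_cong[OF this, of 1] show ?thesis using s(3) by (simp add: T_bd_def)
qed

end

section \<open>Lens data\<close>

text \<open>For the passage from travel times, which are suprema in \<open>ennreal\<close>, to
  statements about real times.\<close>

lemma Sup_ennreal_downward:
  assumes down: "\<And>s t. t \<in> A \<Longrightarrow> 0 < s \<Longrightarrow> s \<le> t \<Longrightarrow> s \<in> A" and fin: "Sup (ennreal ` A) < \<infinity>"
  shows "0 < t \<Longrightarrow> t < enn2real (Sup (ennreal ` A)) \<Longrightarrow> t \<in> A"
    and "enn2real (Sup (ennreal ` A)) < t \<Longrightarrow> t \<notin> A"
proof -
  have S: "Sup (ennreal ` A) = ennreal (enn2real (Sup (ennreal ` A)))" (is "?S = ennreal ?T") using fin by simp
  show "t \<in> A" if t: "0 < t" "t < ?T"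
  proof -
    have "ennreal t < ?S" using t by (subst S) (simp add: ennreal_lessI)
    then obtain s where "s \<in> A" "ennreal t < ennreal s" unfolding less_Sup_iff by blast
    then show ?thesis using down[of s t] t by (simp add: ennreal_less_iff)
  qed
  show "t \<notin> A" if t: "?T < t"
  proof
    assume "t \<in> A"
    then have "ennreal t \<le> ?S" by (intro Sup_upper) auto
    also have "\<dots> = ennreal ?T" by (rule S)
    finally have "t \<le> ?T" by (simp add: ennreal_le_iff)
    then show False using t by simp
  qed
qed

lemma Sup_ennreal_eq:
  assumes "\<And>t. 0 < t \<Longrightarrow> t < T \<Longrightarrow> t \<in> A" "\<And>t. t \<in> A \<Longrightarrow> t \<le> T" "0 \<le> T"
  shows "Sup (ennreal ` A) = ennreal T"
proof (rule antisym)
  show "Sup (ennreal ` A) \<le> ennreal T" using assms(2) by (auto intro!: Sup_least ennreal_leI)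
  show "ennreal T \<le> Sup (ennreal ` A)"
  proof (rule dense_le)
    fix x assume x: "x < ennreal T"
    then have "x = ennreal (enn2real x)" by (metis ennreal_enn2real less_top order.strict_trans ennreal_less_top)
    then obtain r where r: "x = ennreal r" "0 \<le> r" by (metis enn2real_nonneg)
    then have "r < T" using x by (simp add: ennreal_less_iff)
    then obtain t where t: "r < t" "t < T" using dense by blast
    then have "t \<in> A" using assms(1) r by simp
    then have "ennreal t \<le> Sup (ennreal ` A)" by (intro Sup_upper) auto
    then show "x \<le> Sup (ennreal ` A)" using r t by (meson ennreal_leI less_imp_le order_trans)
  qed
qed

text \<open>Built from complete data alone, so that an identification of boundaries carries it over.
  An outward pointing exit vector is not in it, which leaves the case without earlier contact to be
  treated apart.\<close>

definition later_boundary_vectors ::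
  "('a, 'e::euclidean_space) manifold \<Rightarrow> ('a, 'e) metric \<Rightarrow> ('a, 'e) manifold \<Rightarrow> ('a, 'e) metric \<Rightarrow>
    ('a, 'e) tvec \<Rightarrow> (('a, 'e) tvec \<times> real) set" where
  "later_boundary_vectors M g M' g' \<xi> = {(\<eta>, l). \<eta> \<in> bd_inward_closure M g \<and>
     S_complete M M' g' \<eta> = S_complete M M' g' \<xi> \<and> ell_complete M g M' g' \<eta> = Some l \<and>
     (\<exists>l'. ell_complete M g M' g' \<xi> = Some l' \<and> l < l')}"

locale nontrapping_extension = extension M M' g g'
  for M M' :: "('a, 'e::euclidean_space) manifold" and g g' +
  assumes compact: "compact_space (mtop M)" and non_trapping: "non_trapping M g"
begin

abbreviation incl where "incl \<equiv> tangent_incl M M'"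

lemma compactin_points: "compactin (mtop M') (points M)"
  unfolding compactin_subspace using points_sub compact top_eq by metis

section \<open>Geodesics of \<open>M\<close> inside the extension, travel times and exits\<close>

lemma geodesic_from_M_iff:
  assumes \<xi>: "\<xi> \<in> tangent_bundle M" and sub: "\<gamma> ` J \<subseteq> points M"
  shows "geodesic_from M g \<xi> J \<gamma> \<longleftrightarrow> geodesic_from M' g' (incl \<xi>) J \<gamma>"
proof -
  have "velocity M J \<gamma> 0 = snd \<xi> \<longleftrightarrow> velocity M' J \<gamma> 0 = snd (incl \<xi>)"
    if geo: "geodesic_on M g J \<gamma>" and 0: "0 \<in> J" "\<gamma> 0 = fst \<xi>"
  proof -
    have 1: "incl (fst \<xi>, velocity M J \<gamma> 0) = (fst \<xi>, velocity M' J \<gamma> 0)"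
      using geodesic_velocity_incl(2)[OF geo 0(1)] 0(2) by simp
    have "(fst \<xi>, velocity M J \<gamma> 0) \<in> tangent_bundle M" using \<xi> by (auto simp: tangent_bundle_def)
    then have "(fst \<xi>, velocity M J \<gamma> 0) = \<xi> \<longleftrightarrow> incl (fst \<xi>, velocity M J \<gamma> 0) = incl \<xi>"
      using inj_on_eq_iff[OF inj_tangent_incl _ \<xi>] by blast
    then show ?thesis unfolding 1 by (auto simp: prod_eq_iff)
  qed
  then show ?thesis unfolding geodesic_from_def using geodesic_iff[OF sub] by auto
qed

lemma geodesic_from_M:
  assumes "\<xi> \<in> tangent_bundle M" "geodesic_from M g \<xi> J \<gamma>"
  shows "geodesic_from M' g' (incl \<xi>) J \<gamma>" "\<gamma> ` J \<subseteq> points M"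
proof -
  have "continuous_map (top_of_set J) (mtop M) \<gamma>"
    using assms(2) by (simp add: geodesic_from_def geodesic_on_def)
  then show sub: "\<gamma> ` J \<subseteq> points M" using continuous_map_image_subset_topspace by fastforce
  show "geodesic_from M' g' (incl \<xi>) J \<gamma>" using geodesic_from_M_iff[OF assms(1) sub] assms(2) by blast
qed

text \<open>Uniqueness in \<open>M\<close> is borrowed from \<open>M'\<close>: every geodesic of
  \<open>M\<close> is one of \<open>M'\<close>, and the inclusion of tangent bundles is
  injective.\<close>

lemma geodesic_flow_M:
  assumes \<xi>: "\<xi> \<in> tangent_bundle M" and fwd: "B.forward (incl \<xi>) b \<gamma>" and sub: "\<gamma> ` {0..b} \<subseteq> points M"
    and t: "0 \<le> t" "t \<le> b"
  shows "geodesic_flow M g \<xi> t = (\<gamma> t, velocity M {0..b} \<gamma> t)"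
    and "incl (\<gamma> t, velocity M {0..b} \<gamma> t) = (\<gamma> t, velocity M' {0..b} \<gamma> t)"
    and "geodesic_from M g \<xi> {0..b} \<gamma>"
proof -
  show geo: "geodesic_from M g \<xi> {0..b} \<gamma>"
    using geodesic_from_M_iff[OF \<xi> sub] fwd by (simp add: B.forward_def)
  have tJ: "t \<in> {0..b}" using t by simp
  show inc: "incl (\<gamma> t, velocity M {0..b} \<gamma> t) = (\<gamma> t, velocity M' {0..b} \<gamma> t)"
    using geodesic_velocity_incl(2)[OF _ tJ] geo by (simp add: geodesic_from_def)
  show "geodesic_flow M g \<xi> t = (\<gamma> t, velocity M {0..b} \<gamma> t)"
    unfolding geodesic_flow_def
  proof (rule the_equality)
    show "\<exists>J \<delta>. geodesic_from M g \<xi> J \<delta> \<and> t \<in> J \<and> (\<gamma> t, velocity M {0..b} \<gamma> t) = (\<delta> t, velocity M J \<delta> t)"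
      using geo tJ by blast
    fix \<eta> assume "\<exists>J \<delta>. geodesic_from M g \<xi> J \<delta> \<and> t \<in> J \<and> \<eta> = (\<delta> t, velocity M J \<delta> t)"
    then obtain J \<delta> where \<delta>: "geodesic_from M g \<xi> J \<delta>" "t \<in> J" "\<eta> = (\<delta> t, velocity M J \<delta> t)" by blast
    note \<delta>' = geodesic_from_M[OF \<xi> \<delta>(1)]
    have "geodesic_on M g J \<delta>" using \<delta>(1) by (simp add: geodesic_from_def)
    then have "incl \<eta> = (\<delta> t, velocity M' J \<delta> t)" using geodesic_velocity_incl(2) \<delta>(2,3) by simp
    also have "\<dots> = (\<gamma> t, velocity M' {0..b} \<gamma> t)" using B.geodesic_from_unique[OF fwd t \<delta>'(1) \<delta>(2)] by simp
    also have "\<dots> = incl (\<gamma> t, velocity M {0..b} \<gamma> t)" using inc by simp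
    finally have "incl \<eta> = incl (\<gamma> t, velocity M {0..b} \<gamma> t)" .
    moreover have "\<eta> \<in> tangent_bundle M" "(\<gamma> t, velocity M {0..b} \<gamma> t) \<in> tangent_bundle M"
      using \<delta>(2,3) \<delta>'(2) sub tJ by (auto simp: tangent_bundle_def)
    ultimately show "\<eta> = (\<gamma> t, velocity M {0..b} \<gamma> t)" using inj_onD[OF inj_tangent_incl] by blast
  qed
qed

text \<open>The set of times in the definition of \<open>tau\<close>, with a single geodesic in
  place of the pointwise conditions on domain and flow.\<close>

definition travel_times :: "('a, 'e) tvec \<Rightarrow> real set" where
  "travel_times \<xi> = {t. 0 < t \<and> (\<exists>\<gamma>. B.forward (incl \<xi>) t \<gamma> \<and> \<gamma> ` {0..t} \<subseteq> points M)}"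

lemma travel_times_downward:
  assumes "t \<in> travel_times \<xi>" "0 < s" "s \<le> t"
  shows "s \<in> travel_times \<xi>"
proof -
  obtain \<gamma> where "B.forward (incl \<xi>) t \<gamma>" "\<gamma> ` {0..t} \<subseteq> points M"
    using assms(1) by (auto simp: travel_times_def)
  then have "B.forward (incl \<xi>) s \<gamma>" "\<gamma> ` {0..s} \<subseteq> points M"
    using B.forward_subset(1)[OF _ assms(2,3)] assms(3) by (auto simp: image_subset_iff)
  then show ?thesis using assms(2) by (auto simp: travel_times_def)
qed

lemma tau_eq:
  assumes \<xi>: "\<xi> \<in> tangent_bundle M"
  shows "tau M M' g' \<xi> = Sup (ennreal ` travel_times \<xi>)"
proof -
  have "0 < t \<and> (\<forall>s\<in>{0..t}. s \<in> geodesic_domain M' g' (incl \<xi>) \<and> fst (geodesic_flow M' g' (incl \<xi>) s) \<in> points M)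
    \<longleftrightarrow> t \<in> travel_times \<xi>" for t
  proof
    assume L: "0 < t \<and> (\<forall>s\<in>{0..t}. s \<in> geodesic_domain M' g' (incl \<xi>) \<and> fst (geodesic_flow M' g' (incl \<xi>) s) \<in> points M)"
    then obtain \<gamma> where \<gamma>: "B.forward (incl \<xi>) t \<gamma>" 
      using iffD1[OF B.geodesic_domain_iff, of t "incl \<xi>"] by force
    have "\<gamma> ` {0..t} \<subseteq> points M" using L B.geodesic_flow_eq[OF \<gamma>] by force
    then show "t \<in> travel_times \<xi>" using \<gamma> L by (auto simp: travel_times_def)
  next
    assume "t \<in> travel_times \<xi>"
    then obtain \<gamma> where t: "0 < t" and \<gamma>: "B.forward (incl \<xi>) t \<gamma>" "\<gamma> ` {0..t} \<subseteq> points M"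
      by (auto simp: travel_times_def)
    have "s \<in> geodesic_domain M' g' (incl \<xi>)" if "s \<in> {0..t}" for s
      using \<gamma>(1) that unfolding B.forward_def geodesic_domain_def by blast
    moreover have "fst (geodesic_flow M' g' (incl \<xi>) s) \<in> points M" if "s \<in> {0..t}" for s
      using B.geodesic_flow_eq[OF \<gamma>(1), of s] that \<gamma>(2) by auto
    ultimately show "0 < t \<and> (\<forall>s\<in>{0..t}. s \<in> geodesic_domain M' g' (incl \<xi>) \<and> fst (geodesic_flow M' g' (incl \<xi>) s) \<in> points M)"
      using t by blast
  qed
  then show ?thesis by (simp add: tau_def Let_def)
qed

lemma travel_time_in_domain:
  assumes "\<xi> \<in> tangent_bundle M" "t \<in> travel_times \<xi>"
  shows "t \<in> geodesic_domain M g \<xi>"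
proof -
  obtain \<gamma> where t: "0 < t" and \<gamma>: "B.forward (incl \<xi>) t \<gamma>" "\<gamma> ` {0..t} \<subseteq> points M"
    using assms(2) by (auto simp: travel_times_def)
  have "geodesic_from M g \<xi> {0..t} \<gamma>" using geodesic_flow_M(3)[OF assms(1) \<gamma>, of t] t by simp
  moreover have "t \<in> {0..t}" using t by simp
  ultimately show ?thesis unfolding geodesic_domain_def by blast
qed

text \<open>A geodesic of \<open>M'\<close> that remains in \<open>M\<close> is a geodesic of
  \<open>M\<close>, so non-trapping bounds its duration.\<close>

lemma tau_finite:
  assumes "\<xi> \<in> tangent_bundle M" "snd \<xi> \<noteq> 0"
  shows "tau M M' g' \<xi> < \<infinity>"
proof -
  have "bdd_above (geodesic_domain M g \<xi>)" 
    using bspec[OF non_trapping[unfolded non_trapping_def] assms(1)] assms(2) by simp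
  then obtain B where "\<And>t. t \<in> travel_times \<xi> \<Longrightarrow> t \<le> B"
    using travel_time_in_domain[OF assms(1)] unfolding bdd_above_def by blast
  then have "Sup (ennreal ` travel_times \<xi>) \<le> ennreal B" by (auto intro!: Sup_least ennreal_leI)
  then show ?thesis using tau_eq[OF assms(1)] by (simp add: le_less_trans)
qed

text \<open>A witness for the complete travel time \<open>T\<close>. The geodesic is defined beyond
  \<open>T\<close>, so that it leaves \<open>M\<close> there instead of merely coming to the end of
  its domain.\<close>

definition exits :: "('a, 'e) tvec \<Rightarrow> real \<Rightarrow> real \<Rightarrow> (real \<Rightarrow> 'a) \<Rightarrow> bool" where
  "exits \<xi> T b \<gamma> \<longleftrightarrow> 0 \<le> T \<and> T < b \<and> B.forward (incl \<xi>) b \<gamma> \<and> \<gamma> ` {0..T} \<subseteq> points M \<and>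
     (\<forall>t. T < t \<longrightarrow> t \<le> b \<longrightarrow> \<not> \<gamma> ` {0..t} \<subseteq> points M)"

lemma exits_tau:
  assumes \<xi>: "\<xi> \<in> tangent_bundle M" and ex: "exits \<xi> T b \<gamma>"
  shows "tau M M' g' \<xi> = ennreal T"
  unfolding tau_eq[OF \<xi>]
proof (rule Sup_ennreal_eq)
  have fwd: "B.forward (incl \<xi>) b \<gamma>" and T: "0 \<le> T" "T < b" and sub: "\<gamma> ` {0..T} \<subseteq> points M"
    using ex by (auto simp: exits_def)
  show "0 \<le> T" by (rule T)
  show "t \<in> travel_times \<xi>" if t: "0 < t" "t < T" for t
    using B.forward_subset(1)[OF fwd t(1)] t T sub by (auto simp: travel_times_def image_subset_iff)
  show "t \<le> T" if t: "t \<in> travel_times \<xi>" for t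
  proof (rule ccontr)
    assume "\<not> t \<le> T"
    define s where "s = min t b"
    have s: "0 < s" "s \<le> t" "s \<le> b" "T < s" using \<open>\<not> t \<le> T\<close> T by (auto simp: s_def)
    then have "s \<in> travel_times \<xi>" using travel_times_downward t by blast
    then obtain \<delta> where \<delta>: "B.forward (incl \<xi>) s \<delta>" "\<delta> ` {0..s} \<subseteq> points M"
      by (auto simp: travel_times_def)
    have "\<gamma> r = \<delta> r" if "r \<in> {0..s}" for r
      using B.forward_unique(1)[OF fwd \<delta>(1), of r] that s by auto
    then have "\<gamma> ` {0..s} \<subseteq> points M" using \<delta>(2) by (auto simp: image_subset_iff)
    then show False using ex s by (auto simp: exits_def)
  qed
qed

text \<open>A finite supremum does not by itself give a geodesic up to time \<open>T\<close>, let
  alone beyond; compactness of \<open>M\<close> supplies it through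
  \<open>forward_compact\<close>.\<close>

lemma tau_exits:
  assumes \<xi>: "\<xi> \<in> tangent_bundle M" and fin: "tau M M' g' \<xi> < \<infinity>"
  obtains T b \<gamma> where "exits \<xi> T b \<gamma>"
proof -
  define T where "T = enn2real (tau M M' g' \<xi>)"
  have fin': "Sup (ennreal ` travel_times \<xi>) < \<infinity>" using fin tau_eq[OF \<xi>] by simp
  have S1: "t \<in> travel_times \<xi>" if "0 < t" "t < T" for t
    by (rule Sup_ennreal_downward(1)[OF _ fin' that(1)])
       (use travel_times_downward that(2) in \<open>simp_all only: T_def tau_eq[OF \<xi>]\<close>)
  have S2: "t \<notin> travel_times \<xi>" if "T < t" for t
    by (rule Sup_ennreal_downward(2)[OF _ fin'])
       (use travel_times_downward that in \<open>simp_all only: T_def tau_eq[OF \<xi>]\<close>)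
  have x: "fst (incl \<xi>) \<in> points M'" "fst \<xi> \<in> points M" using \<xi> points_sub by (auto simp: tangent_bundle_def)
  have T0: "0 \<le> T" by (simp add: T_def)
  have "\<exists>b \<gamma>. T < b \<and> B.forward (incl \<xi>) b \<gamma> \<and> \<gamma> ` {0..T} \<subseteq> points M"
  \<comment> \<open>With \<open>T = 0\<close> there are no earlier times from which to continue, and
    local existence takes the place of the compactness argument.\<close>
  proof (cases "T = 0")
    case True
    obtain b \<gamma> where f: "B.forward (incl \<xi>) b \<gamma>" using B.forward_exists[OF x(1)] .
    then have "0 < b" "\<gamma> ` {0..T} \<subseteq> points M" using True B.forwardD(1,3)[OF f] x(2) by auto
    then show ?thesis using f True by blast
  next
    case False
    then have "0 < T" using T0 by simp
    have ex: "\<exists>\<gamma>. B.forward (incl \<xi>) t \<gamma> \<and> \<gamma> ` {0..t} \<subseteq> points M" if "0 < t" "t < T" for t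
      using S1[OF that] by (simp add: travel_times_def)
    show ?thesis
    proof (rule B.forward_compact[OF compactin_points \<open>0 < T\<close> ex])
      fix b \<gamma> assume "T < b" "B.forward (incl \<xi>) b \<gamma>" "\<gamma> ` {0..T} \<subseteq> points M"
      then show ?thesis by blast
    qed
  qed
  then obtain b \<gamma> where *: "T < b" "B.forward (incl \<xi>) b \<gamma>" "\<gamma> ` {0..T} \<subseteq> points M" by blast
  have "\<not> \<gamma> ` {0..t} \<subseteq> points M" if "T < t" "t \<le> b" for t
    using S2[OF that(1)] B.forward_subset(1)[OF *(2), of t] that T0 by (auto simp: travel_times_def)
  then have "exits \<xi> T b \<gamma>" using * T0 by (simp add: exits_def)
  then show ?thesis by (rule that)
qed

text \<open>At an interior point the geodesic could stay in \<open>M\<close> a little longer, since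
  the interior is open in \<open>M'\<close>.\<close>

lemma exits_boundary:
  assumes "exits \<xi> T b \<gamma>"
  shows "\<gamma> T \<in> mboundary M"
proof (rule ccontr)
  assume neg: "\<gamma> T \<notin> mboundary M"
  have fwd: "B.forward (incl \<xi>) b \<gamma>" and T: "0 \<le> T" "T < b" and sub: "\<gamma> ` {0..T} \<subseteq> points M"
    using assms by (auto simp: exits_def)
  have geo: "geodesic_on M' g' {0..b} \<gamma>" using B.forwardD(2)[OF fwd] .
  have TJ: "T \<in> {0..b}" using T by simp
  have "\<gamma> T \<in> minterior M" using neg sub T by (auto simp: minterior_def)
  from continuous_map_near[OF B.geodesicD(3)[OF geo] TJ openin_minterior this]
  obtain e where e: "e > 0" "\<And>t. t \<in> {0..b} \<Longrightarrow> \<bar>t - T\<bar> < e \<Longrightarrow> \<gamma> t \<in> minterior M"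
    unfolding eventually_near by blast
  define t where "t = min b (T + e / 2)"
  have t: "T < t" "t \<le> b" "t < T + e" using e T by (auto simp: t_def)
  have "\<gamma> s \<in> points M" if "s \<in> {0..t}" for s
  proof (cases "s \<le> T")
    case True
    then show ?thesis using that sub by auto
  next
    case False
    then have "\<gamma> s \<in> minterior M" using that t by (intro e(2)) auto
    then show ?thesis by (simp add: minterior_def)
  qed
  then show False using assms t by (auto simp: exits_def)
qed

lemma exits_complete:
  assumes \<xi>: "\<xi> \<in> tangent_bundle M" and ex: "exits \<xi> T b \<gamma>"
  obtains \<zeta> where "\<zeta> \<in> bd_TM M" "incl \<zeta> = (\<gamma> T, velocity M' {0..b} \<gamma> T)" "S_complete M M' g' \<xi> = Some \<zeta>"
    "ell_complete M g M' g' \<xi> = Some (T * sqrt \<bar>g (fst \<xi>) (snd \<xi>) (snd \<xi>)\<bar>)"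
proof -
  have fwd: "B.forward (incl \<xi>) b \<gamma>" and T: "0 \<le> T" "T < b" and sub: "\<gamma> ` {0..T} \<subseteq> points M"
    using ex by (auto simp: exits_def)
  note tau = exits_tau[OF \<xi> ex]
  have bd: "\<gamma> T \<in> mboundary M" by (rule exits_boundary[OF ex])
  then have "\<gamma> T \<in> points M" using mboundary_sub by blast
  then obtain \<zeta> where \<zeta>: "\<zeta> \<in> tangent_bundle M" "incl \<zeta> = (\<gamma> T, velocity M' {0..b} \<gamma> T)"
    using tangent_incl_surj by blast
  have flow: "geodesic_flow M' g' (incl \<xi>) T = incl \<zeta>"
    using B.geodesic_flow_eq[OF fwd T(1)] T \<zeta>(2) by simp
  have "fst \<zeta> = \<gamma> T" using \<zeta>(2) fst_tangent_incl by (metis fst_conv)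
  then have "\<zeta> \<in> bd_TM M" using bd by (cases \<zeta>) (simp add: bd_TM_def)
  moreover have "S_complete M M' g' \<xi> = Some \<zeta>"
    using T by (simp add: S_complete_def tau flow inv_into_f_f[OF inj_tangent_incl \<zeta>(1)])
  moreover have "ell_complete M g M' g' \<xi> = Some (T * sqrt \<bar>g (fst \<xi>) (snd \<xi>) (snd \<xi>)\<bar>)"
    using T by (simp add: ell_complete_def tau)
  ultimately show ?thesis using that \<zeta>(2) by blast
qed

lemma closure_tangent: "\<eta> \<in> bd_inward_closure M g \<Longrightarrow> \<eta> \<in> tangent_bundle M"
  using mboundary_sub by (auto simp: bd_inward_closure_def bd_inward_def bd_TM_def T_bd_def tangent_bundle_def)

lemma closure_boundary: "\<eta> \<in> bd_inward_closure M g \<Longrightarrow> fst \<eta> \<in> mboundary M"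
  by (auto simp: bd_inward_closure_def bd_inward_def bd_TM_def T_bd_def)

text \<open>A boundary identification is injective on \<open>bd_TM M\<close>; to compare exit
  vectors through it they have to be known to lie there.\<close>

lemma complete_in_bd:
  assumes "\<eta> \<in> bd_inward_closure M g" "S_complete M M' g' \<eta> = Some \<zeta>"
  shows "\<zeta> \<in> bd_TM M"
proof -
  have \<eta>: "\<eta> \<in> tangent_bundle M" using assms(1) by (rule closure_tangent)
  have "tau M M' g' \<eta> < \<infinity>" using assms(2) by (auto simp: S_complete_def split: if_splits)
  then obtain T b \<gamma> where "exits \<eta> T b \<gamma>" using tau_exits[OF \<eta>] by blast
  then show ?thesis using exits_complete[OF \<eta>] assms(2) by (metis option.inject)
qed

text \<open>Here \<open>l\<close> measures the whole way to the exit and \<open>l0\<close> the way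
  that remains after the first return to the boundary. The last conclusion makes \<eta> the only
  maximiser, so that together with the case \<open>l0 = 0\<close> the interior data are pinned down
  by complete data.\<close>

lemma interior_from_complete:
  assumes \<xi>: "\<xi> \<in> bd_inward M g"
  obtains \<eta> l l0 where "S_in M g \<xi> = Some \<eta>" "ell_in M g \<xi> = Some (l - l0)"
    "ell_complete M g M' g' \<xi> = Some l" "0 \<le> l0"
    "l0 = 0 \<Longrightarrow> S_complete M M' g' \<xi> = Some \<eta>"
    "0 < l0 \<Longrightarrow> (\<eta>, l0) \<in> later_boundary_vectors M g M' g' \<xi>"
    "\<And>\<zeta> k. (\<zeta>, k) \<in> later_boundary_vectors M g M' g' \<xi> \<Longrightarrow> k \<le> l0 \<and> (k = l0 \<longrightarrow> \<zeta> = \<eta>)"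
proof -
  have \<xi>TM: "\<xi> \<in> tangent_bundle M" using \<xi> closure_tangent by (auto simp: bd_inward_closure_def)
  have \<xi>0: "snd \<xi> \<noteq> 0" using \<xi> bd_inward_iff[of "fst \<xi>" "snd \<xi>"] by auto
  obtain T b \<gamma> where ex: "exits \<xi> T b \<gamma>" using tau_exits[OF \<xi>TM tau_finite[OF \<xi>TM \<xi>0]] .
  have fwd: "B.forward (incl \<xi>) b \<gamma>" and Tb: "0 \<le> T" "T < b" and sub: "\<gamma> ` {0..T} \<subseteq> points M"
    using ex by (auto simp: exits_def)
  have geo: "geodesic_on M' g' {0..b} \<gamma>" using B.forwardD(2)[OF fwd] .
  obtain d where d: "d > 0" "\<And>t. 0 < t \<Longrightarrow> t < d \<Longrightarrow> t \<le> b \<and> \<gamma> t \<in> minterior M"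
    using inward_enters_interior[OF \<xi> fwd] by blast
  \<comment> \<open>Otherwise \<gamma> would stay in \<open>M\<close> on an interval longer than
    \<open>{0..T}\<close>. In particular the exit time is positive.\<close>
  have dT: "d \<le> T"
  proof (rule ccontr)
    assume "\<not> d \<le> T"
    then have "T < (T + d) / 2" "(T + d) / 2 < d" "0 < (T + d) / 2" using Tb by auto
    moreover have "\<gamma> s \<in> points M" if "s \<in> {0..(T + d) / 2}" for s
    proof (cases "s = 0")
      case True
      then show ?thesis using sub Tb by auto
    next
      case False
      then show ?thesis using d(2)[of s] that calculation by (auto simp: minterior_def)
    qed
    then have "\<gamma> ` {0..(T + d) / 2} \<subseteq> points M" by blast
    ultimately show False using ex d(2)[of "(T + d) / 2"] unfolding exits_def by blast
  qed
  have T: "0 < T" using d dT by simp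
  \<comment> \<open>The times after \<open>0\<close> and up to \<open>T\<close> at which \<gamma> is
    on the boundary. Beginning at \<open>d\<close> keeps the set away from time \<open>0\<close>, so
    it is compact and has a least element.\<close>
  define C where "C = {s \<in> {0..b}. \<gamma> s \<in> points M' - minterior M} \<inter> {d..T}"
  have "closedin (mtop M') (points M' - minterior M)" using openin_minterior by blast
  from closedin_continuous_map_preimage[OF B.geodesicD(3)[OF geo] this]
  have "closed {s \<in> {0..b}. \<gamma> s \<in> points M' - minterior M}"
    by (simp add: closedin_closed_trans[OF _ closed_atLeastAtMost])
  then have C: "compact C" unfolding C_def by (rule closed_Int_compact) simp
  have C_iff: "s \<in> C \<longleftrightarrow> s \<in> {0<..T} \<and> \<gamma> s \<in> mboundary M" for s
  proof
    assume s: "s \<in> C"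
    then have "\<gamma> s \<in> points M" using d(1) sub by (auto simp: C_def image_subset_iff)
    then show "s \<in> {0<..T} \<and> \<gamma> s \<in> mboundary M" using s d(1) by (auto simp: C_def minterior_def)
  next
    assume s: "s \<in> {0<..T} \<and> \<gamma> s \<in> mboundary M"
    then have "\<gamma> s \<in> points M' - minterior M" using mboundary_sub points_sub by (auto simp: minterior_def)
    moreover have "d \<le> s" using d(2)[of s] s by (force simp: minterior_def)
    ultimately show "s \<in> C" using s Tb by (auto simp: C_def)
  qed
  have "T \<in> C" using C_iff exits_boundary[OF ex] T by simp
  then obtain s where s: "s \<in> C" "\<And>t. t \<in> C \<Longrightarrow> s \<le> t"
    using compact_attains_inf[OF C] by blast
  have s': "0 < s" "s \<le> T" "\<gamma> s \<in> mboundary M" using s(1) C_iff by auto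
  have int: "\<gamma> t \<in> minterior M" if "0 < t" "t < s" for t
  proof -
    have "t \<notin> C" using s(2) that by force
    then show ?thesis using C_iff that s' sub by (auto simp: minterior_def)
  qed
  note fT = B.forward_subset[OF fwd T less_imp_le[OF Tb(2)]]
  note flow = geodesic_flow_M[OF \<xi>TM fT(1) sub]
  define \<eta> where "\<eta> = (\<gamma> s, velocity M {0..T} \<gamma> s)"
  have incl\<eta>: "incl \<eta> = (\<gamma> s, velocity M' {0..b} \<gamma> s)"
    using flow(2)[of s] fT(2)[of s] s' by (simp add: \<eta>_def)
  have \<eta>TM: "\<eta> \<in> tangent_bundle M" using s' mboundary_sub by (auto simp: \<eta>_def tangent_bundle_def)
  have tau_in: "tau_in M g \<xi> = ennreal s"
    unfolding tau_in_def
  proof (rule Sup_ennreal_eq)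
    fix t assume t: "0 < t" "t < s"
    have "r \<in> geodesic_domain M g \<xi> \<and> fst (geodesic_flow M g \<xi> r) \<in> minterior M" if "r \<in> {0<..<t}" for r
    proof
      have "geodesic_from M g \<xi> {0..T} \<gamma>" using flow(3)[of T] T by simp
      moreover have "r \<in> {0..T}" using that t s' by simp
      ultimately show "r \<in> geodesic_domain M g \<xi>" unfolding geodesic_domain_def by blast
      show "fst (geodesic_flow M g \<xi> r) \<in> minterior M" using flow(1)[of r] that t s' int by simp
    qed
    then show "t \<in> {t. 0 < t \<and> (\<forall>s\<in>{0<..<t}. s \<in> geodesic_domain M g \<xi> \<and> fst (geodesic_flow M g \<xi> s) \<in> minterior M)}"
      using t by blast
  next
    fix t assume t: "t \<in> {t. 0 < t \<and> (\<forall>s\<in>{0<..<t}. s \<in> geodesic_domain M g \<xi> \<and> fst (geodesic_flow M g \<xi> s) \<in> minterior M)}"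
    show "t \<le> s"
    proof (rule ccontr)
      assume "\<not> t \<le> s"
      then have "s \<in> {0<..<t}" using s' by simp
      then have "fst (geodesic_flow M g \<xi> s) \<in> minterior M" using t by blast
      then show False using flow(1)[of s] s' by (simp add: minterior_def)
    qed
  qed (use s' in simp)
  define \<sigma> where "\<sigma> = sqrt \<bar>g (fst \<xi>) (snd \<xi>) (snd \<xi>)\<bar>"
  have "0 < g (fst \<xi>) (snd \<xi>) (snd \<xi>)"
    using riem \<xi>TM \<xi>0 by (auto simp: riemannian_manifold_def tangent_bundle_def)
  then have \<sigma>: "\<sigma> > 0" by (simp add: \<sigma>_def)
  obtain \<omega> where \<omega>: "\<omega> \<in> bd_TM M" "incl \<omega> = (\<gamma> T, velocity M' {0..b} \<gamma> T)"
    "S_complete M M' g' \<xi> = Some \<omega>" "ell_complete M g M' g' \<xi> = Some (T * \<sigma>)"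
    using exits_complete[OF \<xi>TM ex] unfolding \<sigma>_def by metis
  have \<omega>TM: "\<omega> \<in> tangent_bundle M" using \<omega>(1) mboundary_sub by (auto simp: bd_TM_def tangent_bundle_def)
  \<comment> \<open>A geodesic that meets \<gamma> with equal position and velocity has the same
    constant speed; this applies to vectors with a common exit vector.\<close>
  have speed: "sqrt \<bar>g (fst \<zeta>) (snd \<zeta>) (snd \<zeta>)\<bar> = \<sigma>"
    if "\<zeta> \<in> tangent_bundle M" "B.forward (incl \<zeta>) c \<delta>" "0 \<le> r" "r \<le> c" "0 \<le> r'" "r' \<le> b"
      "\<delta> r = \<gamma> r'" "velocity M' {0..c} \<delta> r = velocity M' {0..b} \<gamma> r'" for \<zeta> c \<delta> r r'
    using B.forward_speed[OF that(2-4)] B.forward_speed[OF fwd that(5,6)] that(7,8)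
    by (simp add: \<sigma>_def metric_incl[OF that(1)] metric_incl[OF \<xi>TM])
  show ?thesis
  proof (rule that[of \<eta> "T * \<sigma>" "(T - s) * \<sigma>"])
    show "S_in M g \<xi> = Some \<eta>" using flow(1)[of s] s' by (simp add: S_in_def tau_in \<eta>_def)
    show "ell_in M g \<xi> = Some (T * \<sigma> - (T - s) * \<sigma>)"
      using s' by (simp add: ell_in_def tau_in \<sigma>_def algebra_simps)
    show "ell_complete M g M' g' \<xi> = Some (T * \<sigma>)" by (rule \<omega>(4))
    show "0 \<le> (T - s) * \<sigma>" using s' \<sigma> by simp
    show "S_complete M M' g' \<xi> = Some \<eta>" if "(T - s) * \<sigma> = 0"
    proof -
      have "s = T" using that \<sigma> by simp
      then have "incl \<eta> = incl \<omega>" using incl\<eta> \<omega>(2) by simp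
      then show ?thesis using inj_onD[OF inj_tangent_incl _ \<eta>TM \<omega>TM] \<omega>(3) by simp
    qed
    show "(\<eta>, (T - s) * \<sigma>) \<in> later_boundary_vectors M g M' g' \<xi>" if "0 < (T - s) * \<sigma>"
    proof -
      have sT: "s < T" using that \<sigma> by (simp add: zero_less_mult_iff)
      have geoM: "geodesic_on M g {0..T} \<gamma>" using flow(3)[of T] T by (simp add: geodesic_from_def)
      have "\<eta> \<in> T_bd M" unfolding \<eta>_def by (rule touching_boundary_tangent[OF geoM s'(1) sT s'(3)])
      then have cl: "\<eta> \<in> bd_inward_closure M g" by (simp add: bd_inward_closure_def)
      have sb: "s < b" using sT Tb by simp
      note re = B.forward_restart[OF fwd less_imp_le[OF s'(1)] sb, folded incl\<eta>]
      \<comment> \<open>If the rest of \<gamma> after time \<open>s\<close> stayed in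
        \<open>M\<close> longer than \<open>T - s\<close>, then \<gamma> itself would stay longer
        than \<open>T\<close>.\<close>
      have "exits \<eta> (T - s) (b - s) (\<lambda>r. \<gamma> (r + s))"
        unfolding exits_def
      proof (intro conjI allI impI)
        show "(\<lambda>r. \<gamma> (r + s)) ` {0..T - s} \<subseteq> points M" using sub s' by (auto simp: image_subset_iff)
        fix t assume t: "T - s < t" "t \<le> b - s"
        show "\<not> (\<lambda>r. \<gamma> (r + s)) ` {0..t} \<subseteq> points M"
        proof
          assume a: "(\<lambda>r. \<gamma> (r + s)) ` {0..t} \<subseteq> points M"
          have "\<gamma> r \<in> points M" if "r \<in> {0..t + s}" for r
          proof (cases "r \<le> s")
            case True
            then show ?thesis using that sub s' by auto
          next
            case False
            then have "r - s \<in> {0..t}" using that by simp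
            then have "\<gamma> (r - s + s) \<in> points M" using a by blast
            then show ?thesis by simp
          qed
          then have "\<gamma> ` {0..t + s} \<subseteq> points M" by blast
          moreover have "T < t + s" "t + s \<le> b" using t by auto
          ultimately show False using ex by (auto simp: exits_def)
        qed
      qed (use re(1) sT Tb in auto)
      from exits_complete[OF \<eta>TM this] obtain \<zeta> where \<zeta>: "\<zeta> \<in> bd_TM M"
        "incl \<zeta> = (\<gamma> T, velocity M' {0..b - s} (\<lambda>r. \<gamma> (r + s)) (T - s))" "S_complete M M' g' \<eta> = Some \<zeta>"
        "ell_complete M g M' g' \<eta> = Some ((T - s) * sqrt \<bar>g (fst \<eta>) (snd \<eta>) (snd \<eta>)\<bar>)" by auto
      have "velocity M' {0..b - s} (\<lambda>r. \<gamma> (r + s)) (T - s) = velocity M' {0..b} \<gamma> T"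
        using re(2)[of "T - s"] sT Tb by simp
      then have "incl \<zeta> = incl \<omega>" using \<zeta>(2) \<omega>(2) by simp
      moreover have "\<zeta> \<in> tangent_bundle M" using \<zeta>(1) mboundary_sub by (auto simp: bd_TM_def tangent_bundle_def)
      ultimately have "\<zeta> = \<omega>" using inj_onD[OF inj_tangent_incl] \<omega>TM by blast
      moreover have "sqrt \<bar>g (fst \<eta>) (snd \<eta>) (snd \<eta>)\<bar> = \<sigma>"
        by (rule speed[OF \<eta>TM re(1), of 0 s]) (use re(2)[of 0] s' sb in auto)
      ultimately show ?thesis
        using cl \<zeta>(3,4) \<omega>(3,4) s' \<sigma> by (simp add: later_boundary_vectors_def)
    qed
    fix \<zeta> k assume "(\<zeta>, k) \<in> later_boundary_vectors M g M' g' \<xi>"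
    then have \<zeta>: "\<zeta> \<in> bd_inward_closure M g" "S_complete M M' g' \<zeta> = Some \<omega>"
      "ell_complete M g M' g' \<zeta> = Some k" "k < T * \<sigma>"
      using \<omega>(3,4) by (auto simp: later_boundary_vectors_def)
    have \<zeta>TM: "\<zeta> \<in> tangent_bundle M" using \<zeta>(1) by (rule closure_tangent)
    have "tau M M' g' \<zeta> < \<infinity>" using \<zeta>(2) by (auto simp: S_complete_def split: if_splits)
    then obtain R c \<delta> where ex\<zeta>: "exits \<zeta> R c \<delta>" using tau_exits[OF \<zeta>TM] by blast
    then have fwd\<zeta>: "B.forward (incl \<zeta>) c \<delta>" and R: "0 \<le> R" "R < c" by (auto simp: exits_def)
    obtain \<omega>' where \<omega>': "incl \<omega>' = (\<delta> R, velocity M' {0..c} \<delta> R)" "S_complete M M' g' \<zeta> = Some \<omega>'"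
      "ell_complete M g M' g' \<zeta> = Some (R * sqrt \<bar>g (fst \<zeta>) (snd \<zeta>) (snd \<zeta>)\<bar>)"
      using exits_complete[OF \<zeta>TM ex\<zeta>] by metis
    have "incl \<omega>' = incl \<omega>" using \<omega>'(2) \<zeta>(2) by simp
    then have same: "\<gamma> T = \<delta> R" "velocity M' {0..b} \<gamma> T = velocity M' {0..c} \<delta> R"
      using \<omega>'(1) \<omega>(2) by auto
    have "sqrt \<bar>g (fst \<zeta>) (snd \<zeta>) (snd \<zeta>)\<bar> = \<sigma>"
      by (rule speed[OF \<zeta>TM fwd\<zeta>, of R T]) (use same R Tb in auto)
    then have k: "k = R * \<sigma>" using \<omega>'(3) \<zeta>(3) by simp
    then have RT: "R < T" using \<zeta>(4) \<sigma> by simp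
    \<comment> \<open>Going back by time \<open>R\<close> from the common exit vector, \<gamma>
      passes through \<zeta> at time \<open>T - R\<close>, which is therefore a boundary time and no
      earlier than \<open>s\<close>.\<close>
    note bw = B.forward_backward_unique[OF fwd fwd\<zeta> R(1) less_imp_le[OF RT] Tb(2) less_imp_le[OF R(2)] same]
    have "\<gamma> (T - R) \<in> mboundary M" using bw(1) closure_boundary[OF \<zeta>(1)] by simp
    then have "T - R \<in> C" using C_iff R RT by simp
    then have sR: "s \<le> T - R" using s(2) by blast
    then have "k \<le> (T - s) * \<sigma>" using \<sigma> unfolding k by (intro mult_right_mono) auto
    moreover have "\<zeta> = \<eta>" if "k = (T - s) * \<sigma>"
    proof -
      have "T - R = s" using that k \<sigma> by simp
      then have "incl \<zeta> = incl \<eta>" using bw incl\<eta> by (simp add: prod_eq_iff)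
      then show ?thesis using inj_onD[OF inj_tangent_incl] \<zeta>TM \<eta>TM by blast
    qed
    ultimately show "k \<le> (T - s) * \<sigma> \<and> (k = (T - s) * \<sigma> \<longrightarrow> \<zeta> = \<eta>)" by blast
  qed
qed

end

text \<open>Recovery is expressed as determination: whenever the complete data of two manifolds
  correspond under \<Phi>, so do their interior data.\<close>

theorem lemma6p1:
  fixes M M' :: "('a, 'e::euclidean_space) manifold" and g g' :: "('a, 'e) metric"
    and N N' :: "('b, 'f::euclidean_space) manifold" and h h' :: "('b, 'f) metric"
    and \<Phi> :: "('a, 'e) tvec \<Rightarrow> ('b, 'f) tvec"
  assumes "riemannian_manifold M g" "compact_space (mtop M)" "non_trapping M g"
    and "riemannian_manifold N h" "compact_space (mtop N)" "non_trapping N h"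
    and "is_extension M g M' g'" "is_extension N h N' h'"
    and "boundary_identification M g N h \<Phi>"
    and "\<forall>\<xi>\<in>bd_inward_closure M g.
           S_complete N N' h' (\<Phi> \<xi>) = map_option \<Phi> (S_complete M M' g' \<xi>)"
    and "\<forall>\<xi>\<in>bd_inward_closure M g.
           ell_complete N h N' h' (\<Phi> \<xi>) = ell_complete M g M' g' \<xi>"
  shows "\<forall>\<xi>\<in>bd_inward M g.
           S_in N h (\<Phi> \<xi>) = map_option \<Phi> (S_in M g \<xi>) \<and> ell_in N h (\<Phi> \<xi>) = ell_in M g \<xi>"
proof
  fix \<xi> assume \<xi>: "\<xi> \<in> bd_inward M g"
  interpret M: nontrapping_extension M M' g g' by unfold_locales (rule assms)+
  interpret N: nontrapping_extension N N' h h' by unfold_locales (rule assms)+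
  have inj: "inj_on \<Phi> (bd_TM M)" and im: "\<Phi> ` bd_inward M g = bd_inward N h" "\<Phi> ` T_bd M = T_bd N"
    using assms(9) by (auto simp: boundary_identification_def bij_betw_def)
  have cl: "\<Phi> ` bd_inward_closure M g = bd_inward_closure N h"
    unfolding bd_inward_closure_def image_Un im ..
  have \<xi>cl: "\<xi> \<in> bd_inward_closure M g" using \<xi> by (simp add: bd_inward_closure_def)
  have \<Phi>\<xi>: "\<Phi> \<xi> \<in> bd_inward N h" using \<xi> im by blast
  have S: "S_complete N N' h' (\<Phi> \<eta>) = map_option \<Phi> (S_complete M M' g' \<eta>)"
    and L: "ell_complete N h N' h' (\<Phi> \<eta>) = ell_complete M g M' g' \<eta>" if "\<eta> \<in> bd_inward_closure M g" for \<eta>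
    using assms(10,11) that by blast+
  \<comment> \<open>Exit vectors are boundary vectors, on which \<Phi> is injective, so comparing
    them after applying \<Phi> loses nothing.\<close>
  have S_iff: "S_complete N N' h' (\<Phi> \<eta>) = S_complete N N' h' (\<Phi> \<xi>)
      \<longleftrightarrow> S_complete M M' g' \<eta> = S_complete M M' g' \<xi>" if \<eta>: "\<eta> \<in> bd_inward_closure M g" for \<eta>
    unfolding S[OF \<eta>] S[OF \<xi>cl]
    using M.complete_in_bd[OF \<eta>] M.complete_in_bd[OF \<xi>cl] inj_onD[OF inj]
    by (cases "S_complete M M' g' \<eta>"; cases "S_complete M M' g' \<xi>") auto
  have later: "(\<Phi> \<eta>, k) \<in> later_boundary_vectors N h N' h' (\<Phi> \<xi>)
      \<longleftrightarrow> (\<eta>, k) \<in> later_boundary_vectors M g M' g' \<xi>" if \<eta>: "\<eta> \<in> bd_inward_closure M g" for \<eta> k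
    using cl \<eta> by (auto simp: later_boundary_vectors_def S_iff[OF \<eta>] L[OF \<eta>] L[OF \<xi>cl])
  obtain \<eta> l m where M: "S_in M g \<xi> = Some \<eta>" "ell_in M g \<xi> = Some (l - m)"
    "ell_complete M g M' g' \<xi> = Some l" "0 \<le> m" "m = 0 \<Longrightarrow> S_complete M M' g' \<xi> = Some \<eta>"
    "0 < m \<Longrightarrow> (\<eta>, m) \<in> later_boundary_vectors M g M' g' \<xi>"
    "\<And>\<zeta> k. (\<zeta>, k) \<in> later_boundary_vectors M g M' g' \<xi> \<Longrightarrow> k \<le> m \<and> (k = m \<longrightarrow> \<zeta> = \<eta>)"
    by (rule M.interior_from_complete[OF \<xi>]) blast
  obtain \<theta> l' n where N: "S_in N h (\<Phi> \<xi>) = Some \<theta>" "ell_in N h (\<Phi> \<xi>) = Some (l' - n)"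
    "ell_complete N h N' h' (\<Phi> \<xi>) = Some l'" "0 \<le> n" "n = 0 \<Longrightarrow> S_complete N N' h' (\<Phi> \<xi>) = Some \<theta>"
    "0 < n \<Longrightarrow> (\<theta>, n) \<in> later_boundary_vectors N h N' h' (\<Phi> \<xi>)"
    "\<And>\<zeta> k. (\<zeta>, k) \<in> later_boundary_vectors N h N' h' (\<Phi> \<xi>) \<Longrightarrow> k \<le> n \<and> (k = n \<longrightarrow> \<zeta> = \<theta>)"
    by (rule N.interior_from_complete[OF \<Phi>\<xi>]) blast
  have ll: "l = l'" using M(3) N(3) L[OF \<xi>cl] by simp
  \<comment> \<open>Each maximiser is, under \<Phi>, a competitor on the other manifold, so the two
    maxima agree.\<close>
  have mn: "m \<le> n \<and> (m = n \<longrightarrow> \<Phi> \<eta> = \<theta>)" if "0 < m"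
  proof -
    have "\<eta> \<in> bd_inward_closure M g" using M(6)[OF that] by (simp add: later_boundary_vectors_def)
    then show ?thesis using N(7) later M(6)[OF that] by blast
  qed
  have nm: "n \<le> m" if "0 < n"
  proof -
    have "\<theta> \<in> bd_inward_closure N h" using N(6)[OF that] by (simp add: later_boundary_vectors_def)
    then obtain \<kappa> where "\<kappa> \<in> bd_inward_closure M g" "\<theta> = \<Phi> \<kappa>" using cl by blast
    then show ?thesis using M(7) later N(6)[OF that] by blast
  qed
  have eq: "m = n" using mn nm M(4) N(4) by fastforce
  have "\<theta> = \<Phi> \<eta>"
  \<comment> \<open>For \<open>m = 0\<close> the first return is the exit, and interior and complete
    scattering coincide; otherwise uniqueness of the maximiser identifies the vectors.\<close>
  proof (cases "m = 0")
    case True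
    then show ?thesis using M(5) N(5) eq S[OF \<xi>cl] by simp
  next
    case False
    then show ?thesis using mn M(4) eq by auto
  qed
  then show "S_in N h (\<Phi> \<xi>) = map_option \<Phi> (S_in M g \<xi>) \<and> ell_in N h (\<Phi> \<xi>) = ell_in M g \<xi>"
    using M(1,2) N(1,2) ll eq by simp
qed

end
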